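(* Let $p$ be a prime or the symbol $\infty$, let $G$ be a finite group, and let $(\mathscr L_H)_{H\le G}$ be an admissible family of nonempty sublattices of a finite $G$-lattice $\mathscr L$ (see context). Assume that, given $s\in\mathscr L$ with $s\in\mathscr L_K$ for some $K\leq G$, there exist subgroups $H$ and $U$ of $G$ with $U\leq H\leq N_G(U)$ satisfying the following conditions: (i) The set of subgroups $K$ of $H$ containing $U$ coincides with $\{K\leq G\mid s\in\mathscr L_K\}$. (ii) If $s$ covers $t$ in $\mathscr L_U$, then $s=\inf\{s'\in\mathscr L_{\langle g\rangle U}\mid s'\geq t\}$ for some $gU\in W_G(U,t)_p$ with $g\notin U$. Then $G$ is a $p$-group (where an $\infty$-group means a solvable group) if and only if the prime spectrum of $\Omega(G,M_{\mathscr L})_{(p)}$ is connected in the Zariski topology, that is, if and only if $0$ and $1$ are the only idempotents of $\Omega(G,M_{\mathscr L})_{(p)}$.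
   Context: Write ${}^gH=gHg^{-1}$. A finite $G$-lattice is a finite lattice $\mathscr L$ with an order-preserving left $G$-action $(g,s)\mapsto{}^gs$. An admissible family consists of nonempty sublattices $\mathscr L_H\subseteq\mathscr L$, $H\leq G$, such that for all $K\le H\leq G$, $g\in G$: (1) $\mathscr L_{{}^gH}=\{{}^gs\mid s\in\mathscr L_H\}$; (2) ${}^hs=s$ for $h\in H$, $s\in\mathscr L_H$; (3) $s\wedge\sup\mathscr L_K\in\mathscr L_K$ for $s\in\mathscr L_H$; (4) $\sup\mathscr L_K\leq\sup\mathscr L_H$. $M_{\mathscr L}$ denotes the resulting functor $H\mapsto\mathscr L_H$ (monoids under $\wedge$), with restriction maps $s\mapsto s\wedge\sup\mathscr L_K$. $\mathcal S(G,M_{\mathscr L})=\{(K,s)\mid K\leq G,\ s\in\mathscr L_K\}$ with $G$-action $g.(K,s)=({}^gK,{}^gs)$; $N_G(K,s)$ is the stabilizer of $(K,s)$ and $W_G(K,s)=N_G(K,s)/K$. $W_G(K,s)_p$ is a Sylow $p$-subgroup of $W_G(K,s)$ if $p$ is a prime, and $W_G(K,s)_\infty=W_G(K,s)$. The lattice Burnside ring $\Omega(G,M_{\mathscr L})$ is the free abelian group on symbols $[(G/K)_s]$, one for each $G$-orbit of pairs $(K,s)\in\mathcal S(G,M_{\mathscr L})$ (so $[(G/{}^gK)_{{}^gs}]=[(G/K)_s]$), with multiplication $[(G/K)_s]\cdot[(G/U)_t]=\sum_{KhU\in K\backslash G/U}[(G/(K\cap{}^hU))_{s\wedge{}^ht\wedge\sup\mathscr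 L_{K\cap{}^hU}}]$. $\Omega(G,M_{\mathscr L})_{(p)}=\mathbb Z_{(p)}\otimes_{\mathbb Z}\Omega(G,M_{\mathscr L})$ for $p$ prime ($\mathbb Z_{(p)}$ the localization of $\mathbb Z$ at $p$) and $\Omega(G,M_{\mathscr L})_{(\infty)}=\Omega(G,M_{\mathscr L})$. For $s,t\in\mathscr L_U$ with $s>t$, "$s$ covers $t$ in $\mathscr L_U$" means there is no $t'\in\mathscr L_U$ with $s>t'>t$. *)

theory Defs
  imports
    "HOL-Algebra.Group_Action"
    "HOL-Algebra.Solvable_Groups"
    "HOL-Algebra.Ideal"
    "HOL-Library.Poly_Mapping"
    "HOL-Library.Extended_Nat"
    "HOL-Computational_Algebra.Primes"
    "HOL-Analysis.Abstract_Topology"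
begin

section \<open>Groups\<close>

definition conjugate :: "('a, 'm) monoid_scheme \<Rightarrow> 'a \<Rightarrow> 'a set \<Rightarrow> 'a set"
  where "conjugate G g H = g <#\<^bsub>G\<^esub> H #>\<^bsub>G\<^esub> inv\<^bsub>G\<^esub> g"

definition double_cosets :: "('a, 'm) monoid_scheme \<Rightarrow> 'a set \<Rightarrow> 'a set \<Rightarrow> 'a set set"
  where "double_cosets G K U = {K <#>\<^bsub>G\<^esub> (h <#\<^bsub>G\<^esub> U) | h. h \<in> carrier G}"

definition sylow_subgroup :: "nat \<Rightarrow> ('a, 'm) monoid_scheme \<Rightarrow> 'a set \<Rightarrow> bool"
  where "sylow_subgroup q G P \<longleftrightarrow> subgroup P G \<and> card P = q ^ multiplicity q (order G)"

text \<open>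
  Below, a parameter \<open>p :: enat\<close> is either \<open>enat q\<close> with \<open>q\<close> prime, or \<open>\<infinity>\<close>.
\<close>

definition prime_or_infinity :: "enat \<Rightarrow> bool"
  where "prime_or_infinity p \<longleftrightarrow> (\<exists>q. p = enat q \<and> prime q) \<or> p = \<infinity>"

definition p_part :: "enat \<Rightarrow> ('a, 'm) monoid_scheme \<Rightarrow> 'a set \<Rightarrow> bool"
  where "p_part p G P =
    (case p of enat q \<Rightarrow> sylow_subgroup q G P | \<infinity> \<Rightarrow> P = carrier G)"

definition p_group :: "enat \<Rightarrow> ('a, 'm) monoid_scheme \<Rightarrow> bool"
  where "p_group p G =
    (case p of enat q \<Rightarrow> group G \<and> (\<exists>n. order G = q ^ n) | \<infinity> \<Rightarrow> group G \<and> solvable G)"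


section \<open>Finite G-lattices and admissible families\<close>

locale finite_G_lattice =
  group_action G "UNIV :: 'l set" act
  for G :: "('a, 'm) monoid_scheme" (structure)
    and act :: "'a \<Rightarrow> 'l::{finite, lattice} \<Rightarrow> 'l" +
  assumes act_mono: "g \<in> carrier G \<Longrightarrow> mono (act g)"

text \<open>
  The values of \<open>L\<close> on sets that are not subgroups are irrelevant. Since the lattice is finite
  and every \<open>L H\<close> is nonempty, the supremum of \<open>L H\<close> is \<^const>\<open>Sup_fin\<close>.
\<close>

locale admissible_family =
  finite_G_lattice G act
  for G :: "('a, 'm) monoid_scheme" (structure)
    and act :: "'a \<Rightarrow> 'l::{finite, lattice} \<Rightarrow> 'l" +
  fixes L :: "'a set \<Rightarrow> 'l set"
  assumes nonempty: "subgroup H G \<Longrightarrow> L H \<noteq> {}"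
    and inf_closed: "\<lbrakk>subgroup H G; s \<in> L H; t \<in> L H\<rbrakk> \<Longrightarrow> inf s t \<in> L H"
    and sup_closed: "\<lbrakk>subgroup H G; s \<in> L H; t \<in> L H\<rbrakk> \<Longrightarrow> sup s t \<in> L H"
    and L_conjugate: "\<lbrakk>subgroup H G; g \<in> carrier G\<rbrakk> \<Longrightarrow> L (conjugate G g H) = {act g s | s. s \<in> L H}"
    and L_fixed: "\<lbrakk>subgroup H G; h \<in> H; s \<in> L H\<rbrakk> \<Longrightarrow> act h s = s"
    and L_restrict: "\<lbrakk>subgroup H G; subgroup K G; K \<subseteq> H; s \<in> L H\<rbrakk> \<Longrightarrow> inf s (Sup_fin (L K)) \<in> L K"
    and L_Sup_mono: "\<lbrakk>subgroup H G; subgroup K G; K \<subseteq> H\<rbrakk> \<Longrightarrow> Sup_fin (L K) \<le> Sup_fin (L H)"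

definition pairs :: "('a, 'm) monoid_scheme \<Rightarrow> ('a set \<Rightarrow> 'l set) \<Rightarrow> ('a set \<times> 'l) set"
  where "pairs G L = {(K, s). subgroup K G \<and> s \<in> L K}"

definition pair_action ::
    "('a, 'm) monoid_scheme \<Rightarrow> ('a \<Rightarrow> 'l \<Rightarrow> 'l) \<Rightarrow> 'a \<Rightarrow> 'a set \<times> 'l \<Rightarrow> 'a set \<times> 'l"
  where "pair_action G act g = (\<lambda>(K, s). (conjugate G g K, act g s))"

definition N_pair ::
    "('a, 'm) monoid_scheme \<Rightarrow> ('a \<Rightarrow> 'l \<Rightarrow> 'l) \<Rightarrow> 'a set \<Rightarrow> 'l \<Rightarrow> 'a set"
  where "N_pair G act K s = stabilizer G (pair_action G act) (K, s)"

definition W_pair ::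
    "('a, 'm) monoid_scheme \<Rightarrow> ('a \<Rightarrow> 'l \<Rightarrow> 'l) \<Rightarrow> 'a set \<Rightarrow> 'l \<Rightarrow> 'a set monoid"
  where "W_pair G act K s = (G\<lparr>carrier := N_pair G act K s\<rparr>) Mod K"

definition covers_in :: "'l::order set \<Rightarrow> 'l \<Rightarrow> 'l \<Rightarrow> bool"
  where "covers_in A s t \<longleftrightarrow> s \<in> A \<and> t \<in> A \<and> t < s \<and> \<not> (\<exists>t'\<in>A. t < t' \<and> t' < s)"


section \<open>The lattice Burnside ring\<close>

definition pair_orbits ::
    "('a, 'm) monoid_scheme \<Rightarrow> ('a \<Rightarrow> 'l \<Rightarrow> 'l) \<Rightarrow> ('a set \<Rightarrow> 'l set) \<Rightarrow> ('a set \<times> 'l) set set"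
  where "pair_orbits G act L = orbits G (pairs G L) (pair_action G act)"

text \<open>The symbol \<open>[(G/K)\<^sub>s]\<close> as an element of the free module on the orbits of pairs.\<close>

definition symbol ::
    "('a, 'm) monoid_scheme \<Rightarrow> ('a \<Rightarrow> 'l \<Rightarrow> 'l) \<Rightarrow> 'a set \<Rightarrow> 'l \<Rightarrow> ('a set \<times> 'l) set \<Rightarrow>\<^sub>0 rat"
  where "symbol G act K s = Poly_Mapping.single (orbit G (pair_action G act) (K, s)) 1"

definition rscale :: "rat \<Rightarrow> ('b \<Rightarrow>\<^sub>0 rat) \<Rightarrow> ('b \<Rightarrow>\<^sub>0 rat)"
  where "rscale c x = Poly_Mapping.map ((*) c) x"

text \<open>
  The product of two symbols given by orbits \<open>a\<close>, \<open>b\<close>. Representatives of the orbits and of the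
  double cosets are picked by choice; independence of the choices is \<open>symbol_mult\<close> below.
\<close>

definition orbit_mult ::
    "('a, 'm) monoid_scheme \<Rightarrow> ('a \<Rightarrow> 'l::lattice \<Rightarrow> 'l) \<Rightarrow> ('a set \<Rightarrow> 'l set) \<Rightarrow>
     ('a set \<times> 'l) set \<Rightarrow> ('a set \<times> 'l) set \<Rightarrow> ('a set \<times> 'l) set \<Rightarrow>\<^sub>0 rat"
  where "orbit_mult G act L a b =
    (let (K, s) = (SOME x. x \<in> a); (U, t) = (SOME y. y \<in> b) in
     \<Sum>D \<in> double_cosets G K U.
       let h = (SOME h. h \<in> D); V = K \<inter> conjugate G h U in
       symbol G act V (inf (inf s (act h t)) (Sup_fin (L V))))"

text \<open>
  The lattice Burnside ring with coefficients in a subring \<open>R\<close> of the rationals: the free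
  \<open>R\<close>-module on the orbits of pairs, with the bilinear extension of the product of symbols.
\<close>

definition burnside_ring ::
    "rat set \<Rightarrow> ('a, 'm) monoid_scheme \<Rightarrow> ('a \<Rightarrow> 'l::lattice \<Rightarrow> 'l) \<Rightarrow> ('a set \<Rightarrow> 'l set) \<Rightarrow>
     (('a set \<times> 'l) set \<Rightarrow>\<^sub>0 rat) ring"
  where "burnside_ring R G act L =
    \<lparr>carrier = {x. Poly_Mapping.keys x \<subseteq> pair_orbits G act L \<and> (\<forall>a. Poly_Mapping.lookup x a \<in> R)},
     monoid.mult = (\<lambda>x y. \<Sum>a \<in> Poly_Mapping.keys x. \<Sum>b \<in> Poly_Mapping.keys y.
               rscale (Poly_Mapping.lookup x a * Poly_Mapping.lookup y b) (orbit_mult G act L a b)),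
     one = symbol G act (carrier G) (Sup_fin (L (carrier G))),
     zero = 0,
     add = (+)\<rparr>"

definition Z_at :: "enat \<Rightarrow> rat set"
  where "Z_at p = (case p of
      enat q \<Rightarrow> {of_int m / of_int n | m n. \<not> int q dvd n}
    | \<infinity> \<Rightarrow> \<int>)"

text \<open>
  The case \<open>p = \<infinity>\<close> is the lattice Burnside ring itself. For a prime \<open>p\<close>, extension of
  scalars of a free module is realised as the free module over the localized integers on the same
  basis; \<open>Omega_at_tensor\<close> and \<open>rscale_mult\<close> below show that this is the tensor product, with
  \<open>rscale c x\<close> as the pure tensor of \<open>c\<close> and \<open>x\<close>.
\<close>

definition Omega_at ::
    "enat \<Rightarrow> ('a, 'm) monoid_scheme \<Rightarrow> ('a \<Rightarrow> 'l::lattice \<Rightarrow> 'l) \<Rightarrow> ('a set \<Rightarrow> 'l set) \<Rightarrow>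
     (('a set \<times> 'l) set \<Rightarrow>\<^sub>0 rat) ring"
  where "Omega_at p G act L = burnside_ring (Z_at p) G act L"


section \<open>The prime spectrum\<close>

definition Spec :: "('a, 'm) ring_scheme \<Rightarrow> 'a set set"
  where "Spec R = {P. primeideal P R}"

definition zariski_closed :: "('a, 'm) ring_scheme \<Rightarrow> 'a set \<Rightarrow> 'a set set"
  where "zariski_closed R E = {P \<in> Spec R. E \<subseteq> P}"

definition zariski :: "('a, 'm) ring_scheme \<Rightarrow> 'a set topology"
  where "zariski R = topology (\<lambda>A. \<exists>E \<subseteq> carrier R. A = Spec R - zariski_closed R E)"

definition idempotents :: "('a, 'm) ring_scheme \<Rightarrow> 'a set"
  where "idempotents R = {e \<in> carrier R. e \<otimes>\<^bsub>R\<^esub> e = e}"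

lemma openin_zariski:
  "openin (zariski R) A \<longleftrightarrow> (\<exists>E \<subseteq> carrier R. A = Spec R - zariski_closed R E)"
proof -
  let ?op = "\<lambda>A. \<exists>E \<subseteq> carrier R. A = Spec R - zariski_closed R E"
  have "?op (A \<inter> B)" if AB: "?op A" "?op B" for A B
  proof -
    from AB obtain E F where E: "E \<subseteq> carrier R" "A = Spec R - zariski_closed R E"
      and F: "F \<subseteq> carrier R" "B = Spec R - zariski_closed R F" by auto
    let ?EF = "{e \<otimes>\<^bsub>R\<^esub> f | e f. e \<in> E \<and> f \<in> F}"
    show ?thesis
    proof (cases "Spec R = {}")
      case True
      then show ?thesis using E F by auto
    next
      case False
      then obtain P where P: "primeideal P R" by (auto simp: Spec_def)
      interpret R: cring R using P by (simp add: primeideal_def)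
      have "E \<subseteq> Q \<or> F \<subseteq> Q \<longleftrightarrow> ?EF \<subseteq> Q" if "primeideal Q R" for Q
      proof -
        interpret Q: primeideal Q R by fact
        show ?thesis
        proof
          assume "E \<subseteq> Q \<or> F \<subseteq> Q"
          then show "?EF \<subseteq> Q"
            using E(1) F(1) Q.I_l_closed Q.I_r_closed by blast
        next
          assume *: "?EF \<subseteq> Q"
          show "E \<subseteq> Q \<or> F \<subseteq> Q"
          proof (rule ccontr)
            assume "\<not> ?thesis"
            then obtain e f where "e \<in> E" "f \<in> F" "e \<notin> Q" "f \<notin> Q" by blast
            then show False using * E(1) F(1) Q.I_prime[of e f] by blast
          qed
        qed
      qed
      then have "A \<inter> B = Spec R - zariski_closed R ?EF"
        unfolding E(2) F(2) zariski_closed_def Spec_def by blast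
      moreover have "?EF \<subseteq> carrier R" using E(1) F(1) by blast
      ultimately show ?thesis by blast
    qed
  qed
  moreover have "?op (\<Union>\<A>)" if A: "\<forall>A\<in>\<A>. ?op A" for \<A>
  proof -
    from A obtain E where E: "\<And>A. A \<in> \<A> \<Longrightarrow> E A \<subseteq> carrier R \<and> A = Spec R - zariski_closed R (E A)"
      by metis
    have "\<Union>\<A> = Spec R - zariski_closed R (\<Union>(E ` \<A>))"
    proof (rule Set.set_eqI)
      fix P
      have "P \<in> \<Union>\<A> \<longleftrightarrow> (\<exists>A\<in>\<A>. P \<in> Spec R - zariski_closed R (E A))"
        using E by blast
      also have "\<dots> \<longleftrightarrow> P \<in> Spec R - zariski_closed R (\<Union>(E ` \<A>))"
        by (auto simp: zariski_closed_def)
      finally show "P \<in> \<Union>\<A> \<longleftrightarrow> P \<in> Spec R - zariski_closed R (\<Union>(E ` \<A>))" .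
    qed
    moreover have "\<Union>(E ` \<A>) \<subseteq> carrier R" using E by blast
    ultimately show ?thesis by blast
  qed
  ultimately have "istopology ?op"
    unfolding istopology_def by blast
  then show ?thesis by (simp add: zariski_def topology_inverse')
qed


section \<open>Extension of scalars\<close>

lemma lookup_rscale [simp]: "Poly_Mapping.lookup (rscale c x) a = c * Poly_Mapping.lookup x a"
  by (simp add: rscale_def Poly_Mapping.map.rep_eq when_def)

lemma rscale_add_left: "rscale (a + b) x = rscale a x + rscale b x"
  and rscale_add_right: "rscale a (x + y) = rscale a x + rscale a y"
  and rscale_scale: "rscale a (rscale b x) = rscale (a * b) x"
  and rscale_zero [simp]: "rscale 0 x = 0" "rscale a 0 = 0"
  and rscale_single [simp]: "rscale a (Poly_Mapping.single k b) = Poly_Mapping.single k (a * b)"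
  by (rule poly_mapping_eqI; simp add: lookup_add algebra_simps lookup_single when_def)+

lemma rscale_sum: "rscale a (sum f A) = (\<Sum>i\<in>A. rscale a (f i))"
  by (induction A rule: infinite_finite_induct) (auto simp: rscale_add_right)

lemma poly_mapping_expand:
  assumes "finite A" "Poly_Mapping.keys x \<subseteq> A"
  shows "x = (\<Sum>a\<in>A. Poly_Mapping.single a (Poly_Mapping.lookup x a :: rat))"
proof (rule poly_mapping_eqI)
  fix k show "Poly_Mapping.lookup x k = Poly_Mapping.lookup (\<Sum>a\<in>A. Poly_Mapping.single a (Poly_Mapping.lookup x a)) k"
    using assms by (auto simp: lookup_sum lookup_single when_def in_keys_iff subset_eq)
qed

lemma rscale_mult:
  "rscale c x \<otimes>\<^bsub>burnside_ring R G act L\<^esub> rscale d y = rscale (c * d) (x \<otimes>\<^bsub>burnside_ring R G act L\<^esub> y)"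
proof (cases "c = 0 \<or> d = 0")
  case True
  then show ?thesis by (auto simp: burnside_ring_def)
next
  case False
  then have "Poly_Mapping.keys (rscale c x) = Poly_Mapping.keys x" "Poly_Mapping.keys (rscale d y) = Poly_Mapping.keys y"
    by (auto simp: in_keys_iff)
  then show ?thesis
    by (simp add: burnside_ring_def rscale_sum rscale_scale mult.assoc mult.left_commute)
qed

lemma Z_at_subring:
  assumes "prime_or_infinity p"
  shows "\<int> \<subseteq> Z_at p" "a \<in> Z_at p \<Longrightarrow> b \<in> Z_at p \<Longrightarrow> a + b \<in> Z_at p"
    "a \<in> Z_at p \<Longrightarrow> b \<in> Z_at p \<Longrightarrow> a * b \<in> Z_at p"
proof -
  have "\<int> \<subseteq> Z_at p \<and> (a \<in> Z_at p \<longrightarrow> b \<in> Z_at p \<longrightarrow> a + b \<in> Z_at p \<and> a * b \<in> Z_at p)" for a b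
  proof (cases p)
    case (enat q)
    then have q: "prime (int q)" using assms by (auto simp: prime_or_infinity_def)
    have "of_int m \<in> Z_at p" for m
    proof -
      have "\<not> int q dvd 1" using q not_prime_unit by blast
      then have "\<exists>m' n. of_int m = (of_int m' / of_int n :: rat) \<and> \<not> int q dvd n"
        by (intro exI[of _ m] exI[of _ 1]) simp
      then show ?thesis by (simp add: Z_at_def enat)
    qed
    moreover have "a + b \<in> Z_at p \<and> a * b \<in> Z_at p" if ab: "a \<in> Z_at p" "b \<in> Z_at p"
    proof -
      from ab enat obtain m n m' n' where mn: "a = of_int m / of_int n"
        "b = of_int m' / of_int n'" and ndvd: "\<not> int q dvd n" "\<not> int q dvd n'"
        by (auto simp: Z_at_def)
      then have "n \<noteq> 0" "n' \<noteq> 0" by auto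
      then have "a + b = of_int (m * n' + m' * n) / of_int (n * n')" "a * b = of_int (m * m') / of_int (n * n')"
        unfolding mn by (simp_all add: field_simps)
      moreover have "\<not> int q dvd n * n'" using q ndvd by (simp add: prime_dvd_mult_iff)
      ultimately show ?thesis unfolding Z_at_def enat by (simp del: of_int_mult of_int_add) blast
    qed
    ultimately show ?thesis by (auto elim!: Ints_cases)
  qed (auto simp: Z_at_def)
  then show "\<int> \<subseteq> Z_at p" "a \<in> Z_at p \<Longrightarrow> b \<in> Z_at p \<Longrightarrow> a + b \<in> Z_at p"
    "a \<in> Z_at p \<Longrightarrow> b \<in> Z_at p \<Longrightarrow> a * b \<in> Z_at p" by auto
qed

text \<open>
  Universality among biadditive maps; extensionality makes the induced map unique outside the
  carrier as well.
\<close>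

lemma Omega_at_tensor:
  fixes f :: "rat \<Rightarrow> (('a set \<times> 'l::lattice) set \<Rightarrow>\<^sub>0 rat) \<Rightarrow> 'c::ab_group_add"
  assumes p: "prime_or_infinity p"
    and add_l: "\<And>a b x. \<lbrakk>a \<in> Z_at p; b \<in> Z_at p; x \<in> carrier (Omega_at \<infinity> G act L)\<rbrakk> \<Longrightarrow> f (a + b) x = f a x + f b x"
    and add_r: "\<And>a x y. \<lbrakk>a \<in> Z_at p; x \<in> carrier (Omega_at \<infinity> G act L); y \<in> carrier (Omega_at \<infinity> G act L)\<rbrakk>
       \<Longrightarrow> f a (x + y) = f a x + f a y"
  shows "\<exists>!F. F \<in> extensional (carrier (Omega_at p G act L)) \<and>
    (\<forall>x \<in> carrier (Omega_at p G act L). \<forall>y \<in> carrier (Omega_at p G act L). F (x + y) = F x + F y) \<and>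
    (\<forall>a \<in> Z_at p. \<forall>x \<in> carrier (Omega_at \<infinity> G act L). F (rscale a x) = f a x)"
proof -
  let ?B = "pair_orbits G act L"
  let ?e = "\<lambda>b. Poly_Mapping.single b (1::rat)"
  let ?O = "carrier (Omega_at \<infinity> G act L)" and ?P = "carrier (Omega_at p G act L)"
  have O: "?O = {x. Poly_Mapping.keys x \<subseteq> ?B \<and> (\<forall>a. Poly_Mapping.lookup x a \<in> \<int>)}"
    by (simp add: Omega_at_def burnside_ring_def Z_at_def)
  have P: "?P = {x. Poly_Mapping.keys x \<subseteq> ?B \<and> (\<forall>a. Poly_Mapping.lookup x a \<in> Z_at p)}"
    by (simp add: Omega_at_def burnside_ring_def)
  note Z = Z_at_subring[OF p]
  have Z0: "0 \<in> Z_at p" using Z(1) by auto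
  have single_O: "Poly_Mapping.single b n \<in> ?O" if "b \<in> ?B" "n \<in> \<int>" for b n
    using that by (auto simp: O lookup_single when_def split: if_splits)
  have e: "?e b \<in> ?O" if "b \<in> ?B" for b using that by (simp add: single_O)
  have O0: "0 \<in> ?O" by (simp add: O)
  have f0 [simp]: "f 0 x = 0" if "x \<in> ?O" for x using add_l[of 0 0 x] Z0 that by simp
  have f0' [simp]: "f a 0 = 0" if "a \<in> Z_at p" for a using add_r[of a 0 0] O0 that by simp
  have aZ: "a * of_int i \<in> Z_at p" if "a \<in> Z_at p" for a i
    by (rule Z(3)[OF that]) (use Z(1) in auto)
  have fbal: "f (a * of_int n) (?e b) = f a (Poly_Mapping.single b (of_int n))"
    if "a \<in> Z_at p" "b \<in> ?B" for a b n
  proof (induction n rule: int_induct[where k = 0])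
    case base then show ?case using that e by simp
  next
    case (step1 i)
    have "f (a * of_int (i + 1)) (?e b) = f (a * of_int i) (?e b) + f a (?e b)"
      using add_l[OF aZ[OF that(1), of i] that(1) e[OF that(2)]] by (simp add: algebra_simps)
    also have "\<dots> = f a (Poly_Mapping.single b (of_int i) + ?e b)"
      using add_r[of a "Poly_Mapping.single b (of_int i)" "?e b"] step1 that e single_O by simp
    finally show ?case by (simp add: single_add)
  next
    case (step2 i)
    have "f (a * of_int i) (?e b) = f (a * of_int (i - 1)) (?e b) + f a (?e b)"
      using add_l[OF aZ[OF that(1), of "i - 1"] that(1) e[OF that(2)]] by (simp add: algebra_simps)
    moreover have "f a (Poly_Mapping.single b (of_int i)) =
        f a (Poly_Mapping.single b (of_int (i-1))) + f a (?e b)"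
      using add_r[of a "Poly_Mapping.single b (of_int (i-1))" "?e b"] that e single_O
      by (simp flip: single_add)
    ultimately show ?case using step2 by simp
  qed
  have f_sum: "f a (sum g A) = (\<Sum>i\<in>A. f a (g i))"
    if "a \<in> Z_at p" "finite A" "\<And>i. i \<in> A \<Longrightarrow> g i \<in> ?O" for a A and g :: "_ \<Rightarrow> _"
  proof -
    have "sum g A \<in> ?O \<and> f a (sum g A) = (\<Sum>i\<in>A. f a (g i))"
      using that(2,3)
    proof (induction A)
      case (insert i A)
      have "u + v \<in> ?O" if "u \<in> ?O" "v \<in> ?O" for u v
        using that Poly_Mapping.keys_add[of u v] by (auto simp: O lookup_add)
      then show ?case using insert that(1) add_r by auto
    qed (use that O0 in auto)
    then show ?thesis by simp
  qed
  define F where "F = (\<lambda>x\<in>?P. \<Sum>b\<in>Poly_Mapping.keys x. f (Poly_Mapping.lookup x b) (?e b))"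
  have F_eq: "F x = (\<Sum>b\<in>A. f (Poly_Mapping.lookup x b) (?e b))"
    if "x \<in> ?P" "finite A" "Poly_Mapping.keys x \<subseteq> A" "A \<subseteq> ?B" for x A
    using that e by (auto simp: F_def in_keys_iff intro!: sum.mono_neutral_left)
  have P_add: "x + y \<in> ?P" if "x \<in> ?P" "y \<in> ?P" for x y
    using that Poly_Mapping.keys_add[of x y] by (auto simp: P lookup_add Z(2))
  have rscale_P: "rscale a x \<in> ?P" if "a \<in> Z_at p" "x \<in> ?O" for a x
    using that Z(1) by (auto simp: O P in_keys_iff Z(3) subset_eq)
  have F1: "F (x + y) = F x + F y" if "x \<in> ?P" "y \<in> ?P" for x y
  proof -
    let ?A = "Poly_Mapping.keys x \<union> Poly_Mapping.keys y"
    have A: "finite ?A" "?A \<subseteq> ?B" using that by (auto simp: P)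
    show ?thesis
      using that A(2) Poly_Mapping.keys_add[of x y] P_add[OF that]
      by (simp add: F_eq[OF _ A(1) _ A(2)] lookup_add flip: sum.distrib)
        (rule sum.cong, auto simp: P intro!: add_l e)
  qed
  have F2: "F (rscale a x) = f a x" if "a \<in> Z_at p" "x \<in> ?O" for a x
  proof -
    let ?A = "Poly_Mapping.keys x"
    have A: "finite ?A" "?A \<subseteq> ?B" using that by (auto simp: O)
    have "F (rscale a x) = (\<Sum>b\<in>?A. f (a * Poly_Mapping.lookup x b) (?e b))"
    proof -
      have "Poly_Mapping.keys (rscale a x) \<subseteq> ?A" by (auto simp: in_keys_iff)
      from F_eq[OF rscale_P[OF that] A(1) this A(2)] show ?thesis by simp
    qed
    also have "\<dots> = (\<Sum>b\<in>?A. f a (Poly_Mapping.single b (Poly_Mapping.lookup x b)))"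
    proof (rule sum.cong[OF refl])
      fix b assume "b \<in> ?A"
      moreover have "Poly_Mapping.lookup x b \<in> \<int>" using that(2) by (simp add: O)
      then obtain n where "Poly_Mapping.lookup x b = of_int n" by (auto elim: Ints_cases)
      ultimately show "f (a * Poly_Mapping.lookup x b) (?e b) = f a (Poly_Mapping.single b (Poly_Mapping.lookup x b))"
        using fbal[of a b n] that A by auto
    qed
    also have "\<dots> = f a (\<Sum>b\<in>?A. Poly_Mapping.single b (Poly_Mapping.lookup x b))"
      using that A by (intro f_sum[symmetric] single_O) (auto simp: O)
    also have "\<dots> = f a x" using poly_mapping_expand[of ?A x] by simp
    finally show ?thesis .
  qed
  have uniq: "F' = F" if F': "F' \<in> extensional ?P" "\<forall>x\<in>?P. \<forall>y\<in>?P. F' (x + y) = F' x + F' y"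
     "\<forall>a\<in>Z_at p. \<forall>x\<in>?O. F' (rscale a x) = f a x" for F'
  proof
    fix x show "F' x = F x"
    proof (cases "x \<in> ?P")
      case False
      then show ?thesis using F' by (simp add: F_def extensional_def)
    next
      case True
      have "(\<Sum>b\<in>A. rscale (Poly_Mapping.lookup x b) (?e b)) \<in> ?P \<and>
         F' (\<Sum>b\<in>A. rscale (Poly_Mapping.lookup x b) (?e b)) = (\<Sum>b\<in>A. f (Poly_Mapping.lookup x b) (?e b))"
        if "finite A" "A \<subseteq> ?B" for A
        using that
      proof (induction A)
        case empty
        have "F' 0 = 0" using F'(3)[rule_format, OF Z0 O0] O0 by simp
        then show ?case using Z0 by (simp add: P)
      next
        case (insert b A)
        have lk: "Poly_Mapping.lookup x b \<in> Z_at p" using True by (simp add: P)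
        have "rscale (Poly_Mapping.lookup x b) (?e b) \<in> ?P" using rscale_P[OF lk e] insert by simp
        then show ?case using insert F'(2,3) lk e P_add by (simp del: rscale_single)
      qed
      from this[of "Poly_Mapping.keys x"] show ?thesis
        using True poly_mapping_expand[of "Poly_Mapping.keys x" x] by (simp add: F_def P)
    qed
  qed
  show ?thesis
    by (rule ex1I[of _ F]) (use F1 F2 uniq in \<open>auto simp: F_def\<close>)
qed


section \<open>The product of symbols does not depend on the choices\<close>

context admissible_family
begin

sublocale group G using group_hom by (simp add: group_hom_def)

lemma mem_conjugate: "\<lbrakk>g \<in> carrier G; H \<subseteq> carrier G\<rbrakk> \<Longrightarrow> conjugate G g H = (\<lambda>h. g \<otimes> h \<otimes> inv g) ` H"
  by (auto simp: conjugate_def l_coset_def r_coset_def)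

lemma conjugate_carrier: "\<lbrakk>g \<in> carrier G; H \<subseteq> carrier G\<rbrakk> \<Longrightarrow> conjugate G g H \<subseteq> carrier G"
  by (auto simp: mem_conjugate)

lemma conjugate_mult:
  "\<lbrakk>g \<in> carrier G; h \<in> carrier G; H \<subseteq> carrier G\<rbrakk> \<Longrightarrow> conjugate G (g \<otimes> h) H = conjugate G g (conjugate G h H)"
  unfolding mem_conjugate[OF _ conjugate_carrier]
  by (simp add: mem_conjugate image_image)
     (rule image_cong, auto simp: m_assoc inv_mult_group subset_eq)

lemma inj_conjugate: "g \<in> carrier G \<Longrightarrow> inj_on (\<lambda>h. g \<otimes> h \<otimes> inv g) (carrier G)"
  by (rule inj_onI) (auto)

lemma conjugate_Int: "\<lbrakk>g \<in> carrier G; H \<subseteq> carrier G; K \<subseteq> carrier G\<rbrakk> \<Longrightarrow>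
    conjugate G g (H \<inter> K) = conjugate G g H \<inter> conjugate G g K"
  by (simp add: mem_conjugate le_infI1 inj_on_image_Int[OF inj_conjugate])

lemma conjugate_subgroup: "\<lbrakk>subgroup H G; g \<in> carrier G\<rbrakk> \<Longrightarrow> subgroup (conjugate G g H) G"
proof -
  assume H: "subgroup H G" and g: "g \<in> carrier G"
  interpret H: subgroup H G by fact
  have c: "inv g \<otimes> (g \<otimes> z) = z" if "z \<in> carrier G" for z
    using that g by (simp flip: m_assoc)
  have 1: "(g \<otimes> a \<otimes> inv g) \<otimes> (g \<otimes> b \<otimes> inv g) = g \<otimes> (a \<otimes> b) \<otimes> inv g" if "a \<in> H" "b \<in> H" for a b
    using that g by (simp add: m_assoc c)
  have 2: "inv (g \<otimes> a \<otimes> inv g) = g \<otimes> inv a \<otimes> inv g" if "a \<in> H" for a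
    using that g by (simp add: inv_mult_group m_assoc)
  show ?thesis
  proof (rule subgroupI)
    show "conjugate G g H \<subseteq> carrier G" using g H.subset by (rule conjugate_carrier)
    show "conjugate G g H \<noteq> {}" using g H.one_closed H.subset by (auto simp only: mem_conjugate image_is_empty)
  next
    fix a assume "a \<in> conjugate G g H"
    then show "inv a \<in> conjugate G g H" using g 2 by (auto simp: mem_conjugate H.subset)
  next
    fix a b assume "a \<in> conjugate G g H" "b \<in> conjugate G g H"
    then show "a \<otimes> b \<in> conjugate G g H" using g 1 by (auto simp: mem_conjugate H.subset)
  qed
qed

lemma conjugate_self: 
  assumes "subgroup K G" "k \<in> K" shows "conjugate G k K = K"
proof -
  interpret K: subgroup K G by fact
  have "x \<in> conjugate G k K" if "x \<in> K" for x
  proof -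
    have "x = k \<otimes> (inv k \<otimes> x \<otimes> k) \<otimes> inv k"
      using that assms K.mem_carrier[OF that] K.mem_carrier[OF assms(2)]
      by (metis inv_closed inv_solve_right m_closed r_inv l_one m_assoc)
    moreover have "inv k \<otimes> x \<otimes> k \<in> K" using that assms by simp
    ultimately show ?thesis using assms by (auto simp: mem_conjugate K.subset)
  qed
  then show ?thesis using assms by (auto simp: mem_conjugate K.subset)
qed

lemma act_mult: "\<lbrakk>g \<in> carrier G; h \<in> carrier G\<rbrakk> \<Longrightarrow> act (g \<otimes> h) s = act g (act h s)"
  using composition_rule by simp

lemma act_one [simp]: "act \<one> s = s"
  using fun_cong[OF id_eq_one, of s] by simp

lemma act_inv [simp]: "g \<in> carrier G \<Longrightarrow> act (inv g) (act g s) = s"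
  "g \<in> carrier G \<Longrightarrow> act g (act (inv g) s) = s"
  using act_mult[of "inv g" g s] act_mult[of g "inv g" s]
  by simp_all

lemma act_le: "g \<in> carrier G \<Longrightarrow> act g s \<le> act g t \<longleftrightarrow> s \<le> t"
  by (metis act_inv(1) act_mono inv_closed monoD)

lemma act_inf: assumes "g \<in> carrier G" shows "act g (inf s t) = inf (act g s) (act g t)"
proof (rule antisym)
  show "inf (act g s) (act g t) \<le> act g (inf s t)"
    using act_le[of "inv g" "inf (act g s) (act g t)" "act g (inf s t)"] assms
    by simp (metis act_inv(1) act_le inf_le1 inf_le2 inv_closed)
qed (use assms in \<open>simp add: act_le\<close>)

lemma act_Sup_fin:
  assumes "g \<in> carrier G" "A \<noteq> {}" shows "act g (Sup_fin A) = Sup_fin (act g ` A)"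
proof (rule antisym)
  show "Sup_fin (act g ` A) \<le> act g (Sup_fin A)"
    using assms by (auto intro!: Sup_fin.boundedI simp: act_le Sup_fin.coboundedI)
  have "Sup_fin A \<le> act (inv g) (Sup_fin (act g ` A))"
    using assms
    by (auto intro!: Sup_fin.boundedI)
      (metis Sup_fin.coboundedI act_inv(2) act_le finite imageI inv_closed)
  then have "act g (Sup_fin A) \<le> act g (act (inv g) (Sup_fin (act g ` A)))"
    using assms(1) act_le by blast
  then show "act g (Sup_fin A) \<le> Sup_fin (act g ` A)"
    using assms(1) by simp
qed

lemma orbit_pair_action:
  assumes "x \<in> carrier G" "K \<subseteq> carrier G"
  shows "orbit G (pair_action G act) (conjugate G x K, act x s) = orbit G (pair_action G act) (K, s)"
proof -
  have *: "pair_action G act g (conjugate G x K, act x s) = pair_action G act (g \<otimes> x) (K, s)"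
    if "g \<in> carrier G" for g
    using that assms by (simp add: pair_action_def conjugate_mult act_mult)
  have **: "pair_action G act g (K, s) = pair_action G act (g \<otimes> inv x) (conjugate G x K, act x s)"
    if "g \<in> carrier G" for g
  proof -
    have "g \<otimes> inv x \<otimes> x = g" using that assms by (simp add: m_assoc)
    then show ?thesis using *[of "g \<otimes> inv x"] that assms(1) by simp
  qed
  show ?thesis
  proof
    show "orbit G (pair_action G act) (conjugate G x K, act x s) \<subseteq> orbit G (pair_action G act) (K, s)"
      unfolding orbit_def using * m_closed[OF _ assms(1)] by blast
    show "orbit G (pair_action G act) (K, s) \<subseteq> orbit G (pair_action G act) (conjugate G x K, act x s)"
      unfolding orbit_def using ** m_closed[OF _ inv_closed[OF assms(1)]] by blast
  qed
qed

definition term_at where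
  "term_at K s U t h = (let V = K \<inter> conjugate G h U in
       symbol G act V (inf (inf s (act h t)) (Sup_fin (L V))))"

lemma term_at_conj:
  assumes "subgroup K G" "subgroup U G" "x \<in> carrier G" "y \<in> carrier G" "h \<in> carrier G"
  shows "term_at (conjugate G x K) (act x s) (conjugate G y U) (act y t) (x \<otimes> h \<otimes> inv y) = term_at K s U t h"
proof -
  have KU: "K \<subseteq> carrier G" "U \<subseteq> carrier G" using assms subgroup.subset by auto
  define V where "V = K \<inter> conjugate G h U"
  have V: "subgroup V G" using assms by (simp add: V_def conjugate_subgroup subgroups_Inter_pair)
  have "(x \<otimes> h \<otimes> inv y) \<otimes> y = x \<otimes> h" using assms by (simp add: m_assoc)
  then have "conjugate G (x \<otimes> h \<otimes> inv y) (conjugate G y U) = conjugate G x (conjugate G h U)"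
    using assms KU by (simp flip: conjugate_mult)
  then have 1: "conjugate G x K \<inter> conjugate G (x \<otimes> h \<otimes> inv y) (conjugate G y U) = conjugate G x V"
    using assms KU by (simp add: V_def conjugate_Int conjugate_carrier)
  have 2: "act (x \<otimes> h \<otimes> inv y) (act y t) = act x (act h t)"
    using assms by (simp add: act_mult)
  have 3: "Sup_fin (L (conjugate G x V)) = act x (Sup_fin (L V))"
    using V assms by (simp add: L_conjugate act_Sup_fin nonempty Setcompr_eq_image)
  show ?thesis
    unfolding term_at_def Let_def 1 2 3 V_def[symmetric]
    using assms V by (simp add: symbol_def orbit_pair_action subgroup.subset flip: act_inf)
qed

lemma double_coset_memD:
  assumes "subgroup K G" "subgroup U G" "h \<in> carrier G" "d \<in> K <#> (h <# U)"
  obtains k u where "k \<in> K" "u \<in> U" "d = k \<otimes> h \<otimes> u"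
  using assms by (force simp: set_mult_def l_coset_def m_assoc subgroup.mem_carrier)

lemma term_at_double_coset:
  assumes "(K, s) \<in> pairs G L" "(U, t) \<in> pairs G L" "D \<in> double_cosets G K U" "d \<in> D" "e \<in> D"
  shows "term_at K s U t d = term_at K s U t e"
proof -
  have sg: "subgroup K G" "subgroup U G" "s \<in> L K" "t \<in> L U" using assms by (auto simp: pairs_def)
  obtain h where h: "h \<in> carrier G" "D = K <#> (h <# U)" using assms by (auto simp: double_cosets_def)
  have "term_at K s U t d = term_at K s U t h" if "d \<in> D" for d
  proof -
    have "d \<in> K <#> (h <# U)" using that h by simp
    then obtain k u where ku: "k \<in> K" "u \<in> U" "d = k \<otimes> h \<otimes> u"
      by (rule double_coset_memD[OF sg(1,2) h(1)])
    note c = subgroup.mem_carrier[OF sg(1) ku(1)] subgroup.mem_carrier[OF sg(2) ku(2)]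
    note iu = subgroup.m_inv_closed[OF sg(2) ku(2)]
    show ?thesis
      using term_at_conj[of K U k "inv u" h s t] sg c h ku iu
      by (simp add: conjugate_self L_fixed)
  qed
  then show ?thesis using assms by simp
qed

lemma double_cosets_conj:
  assumes "subgroup K G" "subgroup U G" "x \<in> carrier G" "y \<in> carrier G"
  shows "bij_betw ((`) (\<lambda>d. x \<otimes> d \<otimes> inv y)) (double_cosets G K U)
     (double_cosets G (conjugate G x K) (conjugate G y U))"
proof -
  have KU: "K \<subseteq> carrier G" "U \<subseteq> carrier G" using assms subgroup.subset by auto
  have inj: "inj_on (\<lambda>d. x \<otimes> d \<otimes> inv y) (carrier G)"
    using assms by (intro inj_onI) simp
  have sub: "D \<subseteq> carrier G" if "D \<in> double_cosets G K U" for D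
    using that KU by (auto simp: double_cosets_def set_mult_def l_coset_def)
  have im: "(\<lambda>d. x \<otimes> d \<otimes> inv y) ` (K <#> (h <# U)) =
      conjugate G x K <#> ((x \<otimes> h \<otimes> inv y) <# conjugate G y U)" if h: "h \<in> carrier G" for h
  proof -
    have *: "x \<otimes> (k \<otimes> (h \<otimes> u)) \<otimes> inv y = (x \<otimes> k \<otimes> inv x) \<otimes> ((x \<otimes> h \<otimes> inv y) \<otimes> (y \<otimes> u \<otimes> inv y))"
      if "k \<in> K" "u \<in> U" for k u
    proof -
      have [simp]: "k \<in> carrier G" "u \<in> carrier G" using that KU by auto
      have "inv x \<otimes> (x \<otimes> z) = z" "inv y \<otimes> (y \<otimes> z) = z" if "z \<in> carrier G" for z
        using that assms by (simp_all flip: m_assoc)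
      then show ?thesis using assms h by (simp add: m_assoc)
    qed
    have "(\<lambda>d. x \<otimes> d \<otimes> inv y) ` (K <#> (h <# U)) = (\<Union>k\<in>K. \<Union>u\<in>U. {x \<otimes> (k \<otimes> (h \<otimes> u)) \<otimes> inv y})"
      unfolding set_mult_def l_coset_def by blast
    also have "\<dots> = (\<Union>k\<in>K. \<Union>u\<in>U. {(x \<otimes> k \<otimes> inv x) \<otimes> ((x \<otimes> h \<otimes> inv y) \<otimes> (y \<otimes> u \<otimes> inv y))})"
      using * by (intro SUP_cong refl) metis
    also have "\<dots> = conjugate G x K <#> ((x \<otimes> h \<otimes> inv y) <# conjugate G y U)"
      unfolding set_mult_def l_coset_def mem_conjugate[OF assms(3) KU(1)] mem_conjugate[OF assms(4) KU(2)]
      by blast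
    finally show ?thesis .
  qed
  have "((`) (\<lambda>d. x \<otimes> d \<otimes> inv y)) ` double_cosets G K U = double_cosets G (conjugate G x K) (conjugate G y U)"
    (is "?A = ?B")
  proof
    show "?A \<subseteq> ?B" using im assms by (fastforce simp: double_cosets_def)
    show "?B \<subseteq> ?A"
    proof
      fix D assume "D \<in> ?B"
      then obtain h where h: "h \<in> carrier G" "D = conjugate G x K <#> (h <# conjugate G y U)"
        by (auto simp: double_cosets_def)
      have "x \<otimes> (inv x \<otimes> h \<otimes> y) \<otimes> inv y = h"
        using h assms by (metis inv_closed inv_solve_right m_closed r_inv l_one m_assoc)
      then have "D = (\<lambda>d. x \<otimes> d \<otimes> inv y) ` (K <#> ((inv x \<otimes> h \<otimes> y) <# U))"
        using im[of "inv x \<otimes> h \<otimes> y"] h assms by simp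
      then show "D \<in> ?A" using h assms by (fastforce simp: double_cosets_def)
    qed
  qed
  moreover have "inj_on ((`) (\<lambda>d. x \<otimes> d \<otimes> inv y)) (double_cosets G K U)"
    using inj_on_image_eq_iff[OF inj] sub by (auto intro!: inj_onI)
  ultimately show ?thesis by (simp add: bij_betw_def)
qed

lemma double_coset_nonempty:
  assumes "subgroup K G" "subgroup U G" "D \<in> double_cosets G K U" 
  shows "D \<noteq> {}" "D \<subseteq> carrier G"
  using assms subgroup.one_closed subgroup.subset[OF assms(1)] subgroup.subset[OF assms(2)]
  by (fastforce simp: double_cosets_def set_mult_def l_coset_def)+

lemma orbit_some:
  assumes "K \<subseteq> carrier G"
  obtains x where "x \<in> carrier G" "(SOME z. z \<in> orbit G (pair_action G act) (K, s)) = (conjugate G x K, act x s)"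
proof -
  have "pair_action G act \<one> (K, s) \<in> orbit G (pair_action G act) (K, s)"
    unfolding orbit_def by blast
  then have "(SOME z. z \<in> orbit G (pair_action G act) (K, s)) \<in> orbit G (pair_action G act) (K, s)"
    by (metis someI)
  then show ?thesis using that by (auto simp: orbit_def pair_action_def)
qed

lemma orbit_mult_eq:
  assumes K: "(K, s) \<in> pairs G L" and U: "(U, t) \<in> pairs G L"
    and h: "\<And>D. D \<in> double_cosets G K U \<Longrightarrow> h D \<in> D"
  shows "orbit_mult G act L (orbit G (pair_action G act) (K, s)) (orbit G (pair_action G act) (U, t)) =
    (\<Sum>D \<in> double_cosets G K U. term_at K s U t (h D))"
proof -
  have sg: "subgroup K G" "subgroup U G" "s \<in> L K" "t \<in> L U" using assms by (auto simp: pairs_def)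
  note KU = sg(1,2)[THEN subgroup.subset]
  obtain x where x: "x \<in> carrier G" "(SOME z. z \<in> orbit G (pair_action G act) (K, s)) = (conjugate G x K, act x s)"
    using orbit_some KU by metis
  obtain y where y: "y \<in> carrier G" "(SOME z. z \<in> orbit G (pair_action G act) (U, t)) = (conjugate G y U, act y t)"
    using orbit_some KU by metis
  let ?f = "\<lambda>d. x \<otimes> d \<otimes> inv y"
  let ?K = "conjugate G x K" and ?s = "act x s" and ?U = "conjugate G y U" and ?t = "act y t"
  have p: "(?K, ?s) \<in> pairs G L" "(?U, ?t) \<in> pairs G L"
    using sg x y by (auto simp: pairs_def conjugate_subgroup L_conjugate)
  note bij = double_cosets_conj[OF sg(1,2) x(1) y(1)]
  have "orbit_mult G act L (orbit G (pair_action G act) (K, s)) (orbit G (pair_action G act) (U, t)) =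
    (\<Sum>D \<in> double_cosets G ?K ?U. term_at ?K ?s ?U ?t (SOME h. h \<in> D))"
    by (simp add: orbit_mult_def x y term_at_def Let_def)
  also have "\<dots> = (\<Sum>D \<in> double_cosets G K U. term_at ?K ?s ?U ?t (SOME h. h \<in> ?f ` D))"
    by (rule sum.reindex_bij_betw[OF bij, symmetric])
  also have "\<dots> = (\<Sum>D \<in> double_cosets G K U. term_at K s U t (h D))"
  proof (rule sum.cong[OF refl])
    fix D assume D: "D \<in> double_cosets G K U"
    have fD: "?f ` D \<in> double_cosets G ?K ?U" using bij D by (auto simp: bij_betw_def)
    have "h D \<in> carrier G" using h D double_coset_nonempty sg by blast
    have "(SOME h. h \<in> ?f ` D) \<in> ?f ` D" using h[OF D] by (metis imageI someI)
    then have "term_at ?K ?s ?U ?t (SOME h. h \<in> ?f ` D) = term_at ?K ?s ?U ?t (?f (h D))"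
      using h[OF D] by (intro term_at_double_coset[OF p fD]) auto
    also have "\<dots> = term_at K s U t (h D)"
      by (rule term_at_conj) (use sg x y \<open>h D \<in> carrier G\<close> in auto)
    finally show "term_at ?K ?s ?U ?t (SOME h. h \<in> ?f ` D) = term_at K s U t (h D)" .
  qed
  finally show ?thesis .
qed

lemma rscale_one [simp]: "rscale 1 x = x"
  by (rule poly_mapping_eqI) simp

theorem symbol_mult:
  assumes "(K, s) \<in> pairs G L" "(U, t) \<in> pairs G L"
    and "\<And>D. D \<in> double_cosets G K U \<Longrightarrow> h D \<in> D"
  shows "symbol G act K s \<otimes>\<^bsub>burnside_ring R G act L\<^esub> symbol G act U t =
    (\<Sum>D \<in> double_cosets G K U. let V = K \<inter> conjugate G (h D) U in
       symbol G act V (inf (inf s (act (h D) t)) (Sup_fin (L V))))"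
  using orbit_mult_eq[OF assms]
  by (simp add: burnside_ring_def symbol_def[of G act K s] symbol_def[of G act U t] term_at_def)

end

end

theory Submission
  imports
    Defs
    "HOL-Algebra.Zassenhaus"
    "HOL-Algebra.Sylow"
    "HOL-Algebra.Multiplicative_Group"
begin

text \<open>
  The lattice Burnside ring is studied through its marks. A symbol \<open>(G/K)\<^sub>s\<close> is the transitive
  \<open>G\<close>-set \<open>G/K\<close> whose point \<open>gK\<close> has the label \<open>act g s\<close>, and the mark at a pair \<open>(U, t)\<close> counts
  the points that are fixed by \<open>U\<close> and have a label \<open>\<ge> t\<close>. The suprema of the lattices \<open>L H\<close>
  increase with \<open>H\<close>, which makes the marks ring homomorphisms (\<open>mark_mult\<close>), and triangularity
  of the table of marks makes them jointly injective (\<open>marks_separate\<close>). The three properties in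
  the theorem are proved equivalent in a cycle.

  If \<open>G\<close> is a \<open>p\<close>-group, then the spectrum is connected. Let \<open>V\<close> be normal in \<open>P\<close> with index a
  power of a prime \<open>r\<close>, and let \<open>P\<close> fix \<open>t \<in> L V\<close>. Counting the points fixed by the \<open>r\<close>-group
  \<open>P/V\<close> shows that the mark at \<open>(V, t)\<close> is congruent modulo \<open>r\<close> to the mark at \<open>(P, t')\<close>, where
  \<open>t'\<close> is the least element of \<open>L P\<close> above \<open>t\<close> (\<open>linked_closure_at\<close>). If \<open>r\<close> is not invertible
  in the coefficients, then the kernels of these two marks lie in a common prime ideal and hence
  in the same part of any separation of the spectrum. Since subgroups of a \<open>p\<close>-group have enough
  normal subgroups, the hypotheses on intervals of subgroups and on coverings chain every pair
  to the pair of the trivial subgroup and the least element of its lattice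
  (\<open>linked_to_least_pair\<close>). Every prime ideal contains the kernel of a mark, because the product
  of all these kernels is zero; so the spectrum has only one part.

  If the spectrum is connected, the only idempotents are \<open>0\<close> and \<open>1\<close>
  (\<open>idempotents_if_connected\<close>).

  If the only idempotents are \<open>0\<close> and \<open>1\<close>, then \<open>G\<close> is a \<open>p\<close>-group. This is the argument of
  Dress for the Burnside ring of \<open>G\<close>, which sits in the lattice Burnside ring as the span of the
  symbols with maximal label. By Burnside's congruences there is an idempotent whose mark at
  \<open>(U, t)\<close> is \<open>1\<close> if \<open>U\<close> is a \<open>p\<close>-group and \<open>0\<close> otherwise (\<open>exists_p_idempotent\<close>). Its mark at
  the trivial subgroup is \<open>1\<close>, so it is the unit, and its mark at \<open>G\<close> is \<open>1\<close> as well.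
\<close>

(* Left cosets are written with the same infix as strict inclusion of multisets. *)
no_notation subset_mset (infix "<#" 50)


section \<open>Double cosets\<close>

context group
begin

lemma inv_cancel:
  assumes "x \<in> carrier G" "y \<in> carrier G"
  shows "inv x \<otimes> (x \<otimes> y) = y" "x \<otimes> (inv x \<otimes> y) = y"
  using assms by (simp_all flip: m_assoc)

lemma mem_conjugate_iff:
  assumes "g \<in> carrier G" "H \<subseteq> carrier G"
  shows "x \<in> conjugate G g H \<longleftrightarrow> x \<in> carrier G \<and> inv g \<otimes> x \<otimes> g \<in> H"
proof
  assume "x \<in> conjugate G g H"
  then obtain h where "h \<in> H" "x = g \<otimes> h \<otimes> inv g"
    by (auto simp: conjugate_def l_coset_def r_coset_def)
  then show "x \<in> carrier G \<and> inv g \<otimes> x \<otimes> g \<in> H"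
    using assms by (auto simp: m_assoc subset_eq inv_cancel)
next
  assume x: "x \<in> carrier G \<and> inv g \<otimes> x \<otimes> g \<in> H"
  then have "x = g \<otimes> (inv g \<otimes> x \<otimes> g) \<otimes> inv g"
    using assms by (simp add: m_assoc inv_cancel)
  with x show "x \<in> conjugate G g H"
    by (auto simp: conjugate_def l_coset_def r_coset_def)
qed

lemma mem_double_coset_iff:
  "x \<in> S <#> (h <# K) \<longleftrightarrow> (\<exists>s\<in>S. \<exists>k\<in>K. x = s \<otimes> (h \<otimes> k))"
  by (auto simp: set_mult_def l_coset_def)

lemma double_coset_self:
  assumes "subgroup S G" "subgroup K G" "h \<in> carrier G"
  shows "h \<in> S <#> (h <# K)"
proof -
  have "\<one> \<otimes> (h \<otimes> \<one>) \<in> S <#> (h <# K)"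
    using assms subgroup.one_closed mem_double_coset_iff by metis
  with assms show ?thesis by simp
qed

lemma double_coset_eq:
  assumes S: "subgroup S G" and K: "subgroup K G" and h: "h \<in> carrier G"
    and d: "d \<in> S <#> (h <# K)"
  shows "S <#> (d <# K) = S <#> (h <# K)"
proof -
  interpret S: subgroup S G by fact
  interpret K: subgroup K G by fact
  from d obtain a b where ab: "a \<in> S" "b \<in> K" "d = a \<otimes> (h \<otimes> b)"
    by (auto simp: mem_double_coset_iff)
  have "s \<otimes> (d \<otimes> k) \<in> S <#> (h <# K)" if sk: "s \<in> S" "k \<in> K" for s k
  proof -
    have "s \<otimes> (d \<otimes> k) = (s \<otimes> a) \<otimes> (h \<otimes> (b \<otimes> k))"
      using sk ab h by (simp add: m_assoc)
    moreover have "s \<otimes> a \<in> S" "b \<otimes> k \<in> K" using sk ab by simp_all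
    ultimately show ?thesis unfolding mem_double_coset_iff by blast
  qed
  moreover have "s \<otimes> (h \<otimes> k) \<in> S <#> (d <# K)" if sk: "s \<in> S" "k \<in> K" for s k
  proof -
    have "(s \<otimes> inv a) \<otimes> (d \<otimes> (inv b \<otimes> k)) = s \<otimes> (h \<otimes> k)"
      using sk ab h by (simp add: m_assoc inv_cancel)
    moreover have "s \<otimes> inv a \<in> S" "inv b \<otimes> k \<in> K" using sk ab by simp_all
    ultimately show ?thesis unfolding mem_double_coset_iff by metis
  qed
  ultimately have "S <#> (d <# K) \<subseteq> S <#> (h <# K)" "S <#> (h <# K) \<subseteq> S <#> (d <# K)"
    unfolding subset_iff mem_double_coset_iff[of _ S d K] mem_double_coset_iff[of _ S h K] by blast+
  then show ?thesis by (rule equalityI)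
qed

lemma mem_double_cosets_eq:
  assumes "subgroup S G" "subgroup K G" "D \<in> double_cosets G S K" "d \<in> D"
  shows "d \<in> carrier G" "D = S <#> (d <# K)"
proof -
  obtain h where h: "h \<in> carrier G" "D = S <#> (h <# K)"
    using assms(3) unfolding double_cosets_def by blast
  then show "D = S <#> (d <# K)" using double_coset_eq assms by simp
  obtain s k where sk: "s \<in> S" "k \<in> K" "d = s \<otimes> (h \<otimes> k)"
    using assms(4) unfolding h(2) mem_double_coset_iff by blast
  then show "d \<in> carrier G"
    using h(1) subgroup.mem_carrier[OF assms(1) sk(1)] subgroup.mem_carrier[OF assms(2) sk(2)] by simp
qed

text \<open>
  If \<open>s h k\<close> and \<open>a h b\<close> are factorizations of the same \<open>d\<close>, then \<open>v = s a\<^sup>-\<^sup>1\<close> lies in \<open>S \<inter> d K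
  d\<^sup>-\<^sup>1\<close>, and \<open>v\<close> determines \<open>s\<close> and hence \<open>k\<close>; so the factorizations correspond to the elements
  of that intersection.
\<close>

lemma card_double_coset_factorizations:
  assumes S: "subgroup S G" and K: "subgroup K G" and h: "h \<in> carrier G" and d: "d \<in> S <#> (h <# K)"
  shows "card {(s, k). s \<in> S \<and> k \<in> K \<and> s \<otimes> (h \<otimes> k) = d} = card (S \<inter> conjugate G d K)"
proof -
  interpret S: subgroup S G by fact
  interpret K: subgroup K G by fact
  from d obtain a b where ab: "a \<in> S" "b \<in> K" "d = a \<otimes> (h \<otimes> b)"
    by (auto simp: mem_double_coset_iff)
  have dc: "d \<in> carrier G" using ab h by simp
  have "bij_betw (\<lambda>v. (v \<otimes> a, b \<otimes> (inv d \<otimes> inv v \<otimes> d))) (S \<inter> conjugate G d K)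
      {(s, k). s \<in> S \<and> k \<in> K \<and> s \<otimes> (h \<otimes> k) = d}"
  proof (rule bij_betwI[where g = "\<lambda>(s, k). s \<otimes> inv a"])
    show "(\<lambda>v. (v \<otimes> a, b \<otimes> (inv d \<otimes> inv v \<otimes> d))) \<in> S \<inter> conjugate G d K \<rightarrow> {(s, k). s \<in> S \<and> k \<in> K \<and> s \<otimes> (h \<otimes> k) = d}"
    proof
      fix v assume v: "v \<in> S \<inter> conjugate G d K"
      then have vc: "v \<in> carrier G" "inv d \<otimes> v \<otimes> d \<in> K" using mem_conjugate_iff[OF dc K.subset] by auto
      have "inv (inv d \<otimes> v \<otimes> d) = inv d \<otimes> inv v \<otimes> d" using vc dc by (simp add: inv_mult_group m_assoc)
      then have "inv d \<otimes> inv v \<otimes> d \<in> K" using vc by (metis K.m_inv_closed)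
      moreover have "v \<otimes> a \<otimes> (h \<otimes> (b \<otimes> (inv d \<otimes> inv v \<otimes> d))) = v \<otimes> d \<otimes> (inv d \<otimes> inv v \<otimes> d)"
        using vc dc ab h by (simp add: m_assoc)
      moreover have "\<dots> = d" using vc dc by (simp add: m_assoc inv_cancel)
      ultimately show "(v \<otimes> a, b \<otimes> (inv d \<otimes> inv v \<otimes> d)) \<in> {(s, k). s \<in> S \<and> k \<in> K \<and> s \<otimes> (h \<otimes> k) = d}"
        using v ab by simp
    qed
    show "(\<lambda>(s, k). s \<otimes> inv a) \<in> {(s, k). s \<in> S \<and> k \<in> K \<and> s \<otimes> (h \<otimes> k) = d} \<rightarrow> S \<inter> conjugate G d K"
    proof clarify
      fix s k assume sk: "s \<in> S" "k \<in> K" "d = s \<otimes> (h \<otimes> k)"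
      have "inv d \<otimes> s \<otimes> h = inv k" using sk h by (simp add: inv_mult_group m_assoc inv_cancel)
      moreover have "inv a \<otimes> d = h \<otimes> b" using ab h by (simp add: m_assoc inv_cancel)
      moreover have "inv d \<otimes> (s \<otimes> inv a) \<otimes> d = inv d \<otimes> s \<otimes> (inv a \<otimes> d)" using sk ab h dc by (simp add: m_assoc)
      ultimately have "inv d \<otimes> (s \<otimes> inv a) \<otimes> d = inv k \<otimes> b"
        using sk ab h dc by (simp flip: m_assoc)
      then show "s \<otimes> inv a \<in> S \<inter> conjugate G (s \<otimes> (h \<otimes> k)) K"
        using mem_conjugate_iff[OF dc K.subset] sk ab by simp
    qed
  next
    fix v assume "v \<in> S \<inter> conjugate G d K"
    then show "(case (v \<otimes> a, b \<otimes> (inv d \<otimes> inv v \<otimes> d)) of (s, k) \<Rightarrow> s \<otimes> inv a) = v"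
      using ab by (simp add: m_assoc)
  next
    fix y assume "y \<in> {(s, k). s \<in> S \<and> k \<in> K \<and> s \<otimes> (h \<otimes> k) = d}"
    then obtain s k where sk: "y = (s, k)" "s \<in> S" "k \<in> K" "d = s \<otimes> (h \<otimes> k)" by auto
    have "inv s \<otimes> d = h \<otimes> k" using sk h by (simp add: m_assoc inv_cancel)
    then have 1: "inv (s \<otimes> inv a) \<otimes> d = a \<otimes> (h \<otimes> k)" using sk ab h dc by (simp add: inv_mult_group m_assoc)
    have "b \<otimes> inv d = inv h \<otimes> inv a" using ab h by (simp add: inv_mult_group m_assoc inv_cancel)
    then have "b \<otimes> (inv d \<otimes> inv (s \<otimes> inv a) \<otimes> d) = inv h \<otimes> inv a \<otimes> (inv (s \<otimes> inv a) \<otimes> d)"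
      using sk ab h dc by (simp add: m_assoc[symmetric])
    also have "\<dots> = k" unfolding 1 using sk ab h by (simp add: m_assoc inv_cancel)
    finally show "((case y of (s, k) \<Rightarrow> s \<otimes> inv a) \<otimes> a, b \<otimes> (inv d \<otimes> inv (case y of (s, k) \<Rightarrow> s \<otimes> inv a) \<otimes> d)) = y"
      using sk ab by (simp add: m_assoc)
  qed
  then show ?thesis by (simp add: bij_betw_same_card)
qed

text \<open>
  The weight of \<open>h\<close> is the number of its factorizations through a representative of its double
  coset. Hence every double coset has total weight \<open>card S * card K\<close>, whatever its size. Several
  counting arguments below are instances of this formula and differ in the choice of \<open>S\<close> and \<open>f\<close>
  only: the integrality and the multiplicativity of marks, the congruence of marks modulo a
  prime, and the congruences of Burnside.
\<close>

lemma sum_double_cosets: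
  fixes f :: "'a \<Rightarrow> 'c::comm_semiring_1"
  assumes fin: "finite (carrier G)" and S: "subgroup S G" and K: "subgroup K G"
    and r: "\<And>D. D \<in> double_cosets G S K \<Longrightarrow> r D \<in> D"
    and f: "\<And>h s k. \<lbrakk>h \<in> carrier G; s \<in> S; k \<in> K\<rbrakk> \<Longrightarrow> f (s \<otimes> h \<otimes> k) = f h"
  shows "(\<Sum>h\<in>carrier G. of_nat (card (S \<inter> conjugate G h K)) * f h) =
    of_nat (card S * card K) * (\<Sum>D\<in>double_cosets G S K. f (r D))"
proof -
  interpret S: subgroup S G by fact
  interpret K: subgroup K G by fact
  let ?DC = "double_cosets G S K"
  have sub: "D \<subseteq> carrier G" if "D \<in> ?DC" for D
    using mem_double_cosets_eq(1)[OF S K that] by blast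
  have cov: "carrier G = \<Union>?DC"
  proof
    show "carrier G \<subseteq> \<Union>?DC"
    proof
      fix h assume h: "h \<in> carrier G"
      then have "S <#> (h <# K) \<in> ?DC" unfolding double_cosets_def by blast
      with double_coset_self[OF S K h] show "h \<in> \<Union>?DC" by (rule UnionI[rotated])
    qed
  qed (use sub in blast)
  have disj: "D = D'" if "D \<in> ?DC" "D' \<in> ?DC" "x \<in> D" "x \<in> D'" for D D' x
    using mem_double_cosets_eq(2)[OF S K] that by metis
  have const: "f h = f (r D)" if D: "D \<in> ?DC" "h \<in> D" for D h
  proof -
    have rD: "r D \<in> carrier G" using r D sub by blast
    have "h \<in> S <#> (r D <# K)" using mem_double_cosets_eq(2)[OF S K D(1) r[OF D(1)]] D by simp
    then obtain s k where "s \<in> S" "k \<in> K" "h = s \<otimes> (r D \<otimes> k)"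
      by (auto simp: mem_double_coset_iff)
    then show ?thesis using f[OF rD, of s k] rD by (simp add: m_assoc)
  qed
  have count: "(\<Sum>h\<in>D. card (S \<inter> conjugate G h K)) = card S * card K" if D: "D \<in> ?DC" for D
  proof -
    obtain d where d: "d \<in> D" using r[OF D] by blast
    have dc: "d \<in> carrier G" using d sub[OF D] by blast
    have De: "D = S <#> (d <# K)" using mem_double_cosets_eq(2)[OF S K D d] .
    have finD: "finite D" using sub[OF D] fin finite_subset by blast
    have finSK: "finite (S \<times> K)" using fin S.subset K.subset finite_subset by blast
    let ?F = "\<lambda>h. {(s, k). s \<in> S \<and> k \<in> K \<and> s \<otimes> (d \<otimes> k) = h}"
    have "(\<Sum>h\<in>D. card (S \<inter> conjugate G h K)) = (\<Sum>h\<in>D. card (?F h))"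
      using De by (intro sum.cong refl card_double_coset_factorizations[OF S K dc, symmetric]) simp
    also have "\<dots> = card (\<Union>h\<in>D. ?F h)"
    proof -
      have "\<forall>h\<in>D. finite (?F h)" by (auto intro: finite_subset[OF _ finSK])
      moreover have "\<forall>i\<in>D. \<forall>j\<in>D. i \<noteq> j \<longrightarrow> ?F i \<inter> ?F j = {}" by auto
      ultimately show ?thesis using card_UN_disjoint[OF finD, of ?F] by simp
    qed
    also have "(\<Union>h\<in>D. ?F h) = S \<times> K"
    proof
      show "S \<times> K \<subseteq> (\<Union>h\<in>D. ?F h)"
      proof clarify
        fix s k assume "s \<in> S" "k \<in> K"
        moreover from this have "s \<otimes> (d \<otimes> k) \<in> D" unfolding De mem_double_coset_iff by blast
        ultimately show "(s, k) \<in> (\<Union>h\<in>D. ?F h)" by simp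
      qed
    qed auto
    finally show ?thesis by (simp add: card_cartesian_product)
  qed
  have "(\<Sum>h\<in>carrier G. of_nat (card (S \<inter> conjugate G h K)) * f h) =
      (\<Sum>D\<in>?DC. \<Sum>h\<in>D. of_nat (card (S \<inter> conjugate G h K)) * f h)"
  proof -
    have "\<forall>D\<in>?DC. finite D" using finite_subset[OF sub fin] by simp
    moreover have "\<forall>D\<in>?DC. \<forall>D'\<in>?DC. D \<noteq> D' \<longrightarrow> D \<inter> D' = {}"
      using disj by (meson disjoint_iff)
    ultimately show ?thesis
      unfolding cov by (simp only: sum.Union_disjoint comp_def)
  qed
  also have "\<dots> = (\<Sum>D\<in>?DC. of_nat (\<Sum>h\<in>D. card (S \<inter> conjugate G h K)) * f (r D))"
    by (intro sum.cong refl) (simp add: sum_distrib_right const)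
  also have "\<dots> = of_nat (card S * card K) * (\<Sum>D\<in>?DC. f (r D))"
    by (simp add: count sum_distrib_left)
  finally show ?thesis .
qed

end

section \<open>Solvable groups and groups of prime power order\<close>

text \<open>
  The phrase "\<open>H\<close> is a \<open>p\<close>-group" for subgroups \<open>H\<close> of \<open>G\<close>, stated inside \<open>G\<close> in order not to
  pass to the restricted group.
\<close>

definition p_subgroup :: "enat \<Rightarrow> ('a, 'm) monoid_scheme \<Rightarrow> 'a set \<Rightarrow> bool"
  where "p_subgroup p G H =
    (case p of enat q \<Rightarrow> \<exists>n. card H = q ^ n | \<infinity> \<Rightarrow> solvable_seq G H)"

text \<open>
  The residue characteristics of the coefficient ring: the primes that are not invertible in
  \<^term>\<open>Z_at p\<close>.
\<close>

definition residue_prime :: "enat \<Rightarrow> nat \<Rightarrow> bool"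
  where "residue_prime p r \<longleftrightarrow> prime r \<and> (p = enat r \<or> p = \<infinity>)"

context group
begin

lemma p_group_iff_p_subgroup: "p_group p G \<longleftrightarrow> p_subgroup p G (carrier G)"
  using is_group by (simp add: p_group_def p_subgroup_def order_def solvable_def split: enat.split)

lemma solvable_seq_mono:
  assumes "subgroup H G" "H \<subseteq> K" "solvable_seq G K"
  shows "solvable_seq G H"
proof -
  obtain n where "(derived G ^^ n) K = {\<one>}"
    using solvable_imp_trivial_derived_seq assms by blast
  then have "(derived G ^^ n) H \<subseteq> {\<one>}" using mono_exp_of_derived[OF assms(2), of n] by simp
  then have "(derived G ^^ n) H = {\<one>}"
    using subgroup.one_closed[OF exp_of_derived_is_subgroup[OF assms(1)], of n] by blast
  then show ?thesis by (rule trivial_derived_seq_imp_solvable[OF assms(1)])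
qed

lemma card_subgroup_dvd:
  assumes "subgroup H G" "subgroup K G" "H \<subseteq> K"
  shows "card H dvd card K"
proof -
  interpret K: group "G\<lparr>carrier := K\<rparr>" using assms subgroup_imp_group by blast
  have "subgroup H (G\<lparr>carrier := K\<rparr>)" using assms subgroup_incl by blast
  have "order (G\<lparr>carrier := K\<rparr>) = card K" by (simp add: order_def)
  then show ?thesis using K.lagrange[OF \<open>subgroup H (G\<lparr>carrier := K\<rparr>)\<close>] dvd_triv_right by metis
qed

lemma p_subgroup_mono:
  assumes "prime_or_infinity p" "subgroup H G" "subgroup K G" "H \<subseteq> K" "p_subgroup p G K"
  shows "p_subgroup p G H"
proof (cases p)
  case (enat q)
  then have q: "prime q" using assms(1) by (auto simp: prime_or_infinity_def)
  obtain n where "card K = q ^ n" using assms enat by (auto simp: p_subgroup_def)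
  then have "card H dvd q ^ n" using card_subgroup_dvd[OF assms(2-4)] by simp
  then show ?thesis using q enat by (auto simp: p_subgroup_def divides_primepow_nat)
next
  case infinity
  then show ?thesis using assms solvable_seq_mono by (auto simp: p_subgroup_def)
qed

lemma p_subgroup_trivial: "p_subgroup p G {\<one>}"
proof (cases p)
  case (enat q)
  have "card {\<one>} = q ^ 0" by simp
  then show ?thesis unfolding enat p_subgroup_def enat.case by blast
qed (simp add: p_subgroup_def solvable_seq.unity)

lemma mem_normalizer_iff:
  "V \<subseteq> carrier G \<Longrightarrow> g \<in> normalizer G V \<longleftrightarrow> g \<in> carrier G \<and> conjugate G g V = V"
  by (auto simp: normalizer_def stabilizer_def conjugate_def)

lemma normal_in_subgroup_of_normalizer:
  assumes V: "subgroup V G" and P: "subgroup P G" and VP: "V \<subseteq> P" "P \<subseteq> normalizer G V"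
  shows "V \<lhd> G\<lparr>carrier := P\<rparr>"
proof -
  interpret P: group "G\<lparr>carrier := P\<rparr>" using P subgroup_imp_group by blast
  show ?thesis
  proof (rule P.normal_invI)
    show "subgroup V (G\<lparr>carrier := P\<rparr>)" using subgroup_incl V P VP by blast
  next
    fix x h assume "x \<in> carrier (G\<lparr>carrier := P\<rparr>)" and h: "h \<in> V"
    then have x: "x \<in> P" by simp
    then have "x \<in> normalizer G V" using VP by blast
    then have "conjugate G x V = V" using mem_normalizer_iff[OF subgroup.subset[OF V]] by blast
    moreover have "x \<otimes> h \<otimes> inv x \<in> conjugate G x V"
      using h by (auto simp: conjugate_def l_coset_def r_coset_def)
    ultimately show "x \<otimes>\<^bsub>G\<lparr>carrier := P\<rparr>\<^esub> h \<otimes>\<^bsub>G\<lparr>carrier := P\<rparr>\<^esub> inv\<^bsub>G\<lparr>carrier := P\<rparr>\<^esub> x \<in> V"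
      using x P by (simp add: m_inv_consistent)
  qed
qed

lemma conjugate_eqI:
  assumes V: "subgroup V G" and x: "x \<in> carrier G"
    and "\<And>h. h \<in> V \<Longrightarrow> x \<otimes> h \<otimes> inv x \<in> V" "\<And>h. h \<in> V \<Longrightarrow> inv x \<otimes> h \<otimes> x \<in> V"
  shows "conjugate G x V = V"
proof
  show "conjugate G x V \<subseteq> V" using assms(3) by (auto simp: conjugate_def l_coset_def r_coset_def)
  show "V \<subseteq> conjugate G x V" using mem_conjugate_iff[OF x subgroup.subset[OF V]] assms(4)
    subgroup.mem_carrier[OF V] by blast
qed

lemma subgroup_of_normalizer_if_normal:
  assumes P: "subgroup P G" and N: "V \<lhd> G\<lparr>carrier := P\<rparr>"
  shows "subgroup V G" "V \<subseteq> P" "P \<subseteq> normalizer G V"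
proof -
  interpret N: normal V "G\<lparr>carrier := P\<rparr>" by fact
  show V: "subgroup V G" using incl_subgroup[OF P] N normal_imp_subgroup by blast
  show "V \<subseteq> P" using N.subset by simp
  show "P \<subseteq> normalizer G V"
  proof
    fix x assume x: "x \<in> P"
    have xc: "x \<in> carrier G" using subgroup.mem_carrier[OF P x] .
    have ix: "inv x \<in> P" using subgroup.m_inv_closed[OF P x] .
    have "y \<otimes> h \<otimes> inv y \<in> V" if "h \<in> V" "y \<in> P" for h y
      using N.inv_op_closed2[of y h] that P by (simp add: m_inv_consistent)
    from this[OF _ x] this[OF _ ix] have "conjugate G x V = V" using xc by (intro conjugate_eqI[OF V xc]) simp_all
    then show "x \<in> normalizer G V" using mem_normalizer_iff[OF subgroup.subset[OF V]] xc by blast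
  qed
qed

text \<open>
  The derived subgroup is a proper normal subgroup, hence trivial. In an abelian group without
  proper nontrivial subgroups an element of prime order generates everything.
\<close>

lemma solvable_simple_prime_order:
  assumes fin: "finite (carrier G)" and solv: "solvable G" and nontriv: "carrier G \<noteq> {\<one>}"
    and simple: "\<And>N. N \<lhd> G \<Longrightarrow> N = {\<one>} \<or> N = carrier G"
  shows "prime (order G)"
proof -
  have "derived G (carrier G) \<noteq> carrier G"
  proof
    assume "derived G (carrier G) = carrier G"
    then have "(derived G ^^ n) (carrier G) = carrier G" for n by (induction n) auto
    then show False using solv nontriv solvable_iff_trivial_derived_seq by simp
  qed
  then have der: "derived G (carrier G) = {\<one>}" using simple[OF derived_self_is_normal] by blast
  have comm: "comm_group G"
  proof (rule group_comm_groupI)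
    fix x y assume xy: "x \<in> carrier G" "y \<in> carrier G"
    then have "x \<otimes> y \<otimes> inv x \<otimes> inv y \<in> derived G (carrier G)"
      unfolding derived_def by (intro generate.incl) blast
    then have "x \<otimes> y \<otimes> inv x \<otimes> inv y = \<one>" using der by simp
    then show "x \<otimes> y = y \<otimes> x"
      using xy by (metis inv_closed inv_equality inv_inv inv_solve_right l_one m_closed)
  qed
  then interpret comm_group G .
  obtain x where x: "x \<in> carrier G" "x \<noteq> \<one>" using nontriv one_closed by blast
  have "ord x \<noteq> 1" using x ord_eq_1 by blast
  then obtain r where r: "prime r" "r dvd ord x" by (metis prime_factor_nat)
  have ordpos: "ord x > 0" using ord_ge_1[OF fin x(1)] by simp
  define y where "y = x [^] (ord x div r)"
  have y: "y \<in> carrier G" using x by (simp add: y_def)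
  have "ord y = ord x div (ord x div r)"
    unfolding y_def using x r ordpos
    by (intro ord_pow) (auto simp: dvd_div_eq_0_iff elim!: dvdE)
  then have ord_y: "ord y = r" using r ordpos by auto
  have sg: "subgroup (generate G {y}) G" using y by (intro generate_is_subgroup) simp
  then have "generate G {y} = {\<one>} \<or> generate G {y} = carrier G"
    using simple subgroup_imp_normal by blast
  moreover have "card (generate G {y}) = r" using generate_pow_card[OF y] ord_y by simp
  ultimately show ?thesis using r by (auto simp: order_def)
qed

text \<open>
  The quotient by a maximal proper normal subgroup above \<open>N\<close> is solvable and simple.
\<close>

lemma solvable_normal_prime_index:
  assumes fin: "finite (carrier G)" and solv: "solvable G" and N: "N \<lhd> G" "N \<noteq> carrier G"
  obtains M where "M \<lhd> G" "N \<subseteq> M" "M \<noteq> carrier G" "\<exists>r. prime r \<and> order G = card M * r"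
proof -
  let ?A = "{M. M \<lhd> G \<and> N \<subseteq> M \<and> M \<noteq> carrier G}"
  have "?A \<subseteq> Pow (carrier G)" using normal_imp_subgroup subgroup.subset by blast
  then have "finite ?A" using fin finite_subset by blast
  moreover have "?A \<noteq> {}" using N by blast
  ultimately have "\<exists>M\<in>?A. \<forall>M'\<in>?A. M \<subseteq> M' \<longrightarrow> M = M'" by (rule finite_has_maximal)
  then obtain M where M: "M \<in> ?A" and maximal: "\<forall>M'\<in>?A. M \<subseteq> M' \<longrightarrow> M = M'" by (rule bexE)
  then interpret M: normal M G by simp
  interpret Q: group "G Mod M" by (rule M.factorgroup_is_group)
  have finQ: "finite (carrier (G Mod M))" using fin by (simp add: carrier_FactGroup)
  have surj: "(\<lambda>x. M #> x) ` carrier G = carrier (G Mod M)" by (simp add: carrier_FactGroup)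
  have "group_hom G (G Mod M) (\<lambda>x. M #> x)"
    by (intro group_hom.intro group_hom_axioms.intro is_group Q.is_group M.r_coset_hom_Mod)
  then have solvQ: "solvable (G Mod M)" by (rule group_hom.surj_hom_imp_solvable[OF _ surj solv])
  have nontriv: "carrier (G Mod M) \<noteq> {\<one>\<^bsub>G Mod M\<^esub>}" using M M.fact_group_trivial_iff[OF fin] by simp
  have simple: "A = {\<one>\<^bsub>G Mod M\<^esub>} \<or> A = carrier (G Mod M)" if A: "A \<lhd> G Mod M" for A
  proof -
    have sgA: "subgroup A (G Mod M)" using A normal_imp_subgroup by blast
    have UA: "\<Union>A = {x \<in> carrier G. M #> x \<in> A}" using M.factgroup_subgroup_union_char[OF sgA] .
    have AU: "A = (\<lambda>x. M #> x) ` (\<Union>A)"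
    proof
      show "A \<subseteq> (\<lambda>x. M #> x) ` (\<Union>A)"
      proof
        fix X assume X: "X \<in> A"
        then have "X \<in> carrier (G Mod M)" using subgroup.subset[OF sgA] by blast
        then obtain x where "x \<in> carrier G" "X = M #> x" unfolding carrier_FactGroup by (rule imageE)
        then show "X \<in> (\<lambda>x. M #> x) ` (\<Union>A)" using UA X by simp
      qed
    qed (simp add: UA image_subset_iff)
    have MA: "M \<subseteq> \<Union>A" using subgroup.one_closed[OF sgA] by auto
    show ?thesis
    proof (cases "\<Union>A = carrier G")
      case True then show ?thesis using AU surj by simp
    next
      case False
      with MA M M.factgroup_subgroup_union_normal[OF A] have "\<Union>A \<in> ?A" by auto
      then have "M = \<Union>A" using maximal MA by simp
      then have "A = (\<lambda>x. M #> x) ` M" using AU by metis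
      also have "\<dots> = (\<lambda>x. M) ` M" by (rule image_cong[OF refl]) (rule M.rcos_const[OF is_group])
      also have "\<dots> = {M}" using M.one_closed by (rule image_constant)
      finally show ?thesis by simp
    qed
  qed
  have "prime (order (G Mod M))" by (rule Q.solvable_simple_prime_order[OF finQ solvQ nontriv simple])
  moreover have "order G = card M * order (G Mod M)"
    using lagrange[OF M.is_subgroup] by (simp add: order_def FactGroup_def mult.commute)
  ultimately have "\<exists>r. prime r \<and> order G = card M * r" by blast
  with M show ?thesis by (intro that[of M]) simp_all
qed

text \<open>
  The step of the descent from \<open>P\<close> to \<open>V\<close>: a proper subgroup between them that is normal in \<open>P\<close>,
  of index a power of a residue characteristic. If \<open>p\<close> is a prime, then \<open>V\<close> itself will do; if
  \<open>P\<close> is merely solvable, then the index of \<open>V\<close> may involve several primes, and a subgroup of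
  prime index is chosen.
\<close>

lemma p_subgroup_normal_step:
  assumes p: "prime_or_infinity p" and fin: "finite (carrier G)"
    and V: "subgroup V G" and P: "subgroup P G" and VP: "V \<subseteq> P" "P \<subseteq> normalizer G V" "V \<noteq> P"
    and pP: "p_subgroup p G P"
  obtains M r k where "subgroup M G" "V \<subseteq> M" "M \<subset> P" "P \<subseteq> normalizer G M"
    "residue_prime p r" "card P = card M * r ^ k"
proof (cases p)
  case (enat q)
  then have q: "prime q" using p by (auto simp: prime_or_infinity_def)
  obtain n where n: "card P = q ^ n" using pP enat by (auto simp: p_subgroup_def)
  then have "card V dvd q ^ n" using card_subgroup_dvd[OF V P VP(1)] by simp
  then obtain i where i: "i \<le> n" "card V = q ^ i" using q by (auto simp: divides_primepow_nat)
  then have "card P = card V * q ^ (n - i)" using n by (simp flip: power_add)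
  then show ?thesis using that[of V q "n - i"] V VP enat q by (auto simp: residue_prime_def)
next
  case infinity
  interpret P: group "G\<lparr>carrier := P\<rparr>" using P subgroup_imp_group by blast
  have "group_hom (G\<lparr>carrier := P\<rparr>) G (\<lambda>x. x)"
    using subgroup.subset[OF P] by unfold_locales (auto simp: hom_def)
  moreover have "solvable_seq G P" using pP infinity by (simp add: p_subgroup_def)
  ultimately have solv: "solvable (G\<lparr>carrier := P\<rparr>)"
    unfolding solvable_def
    using group_hom.solvable_img_imp_solvable[of "G\<lparr>carrier := P\<rparr>" G "\<lambda>x. x" P] P.subgroup_self by simp
  have finP: "finite (carrier (G\<lparr>carrier := P\<rparr>))" using fin subgroup.subset[OF P] finite_subset by auto
  obtain M where M: "M \<lhd> G\<lparr>carrier := P\<rparr>" "V \<subseteq> M" "M \<noteq> P"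
      "\<exists>r. prime r \<and> order (G\<lparr>carrier := P\<rparr>) = card M * r"
    using P.solvable_normal_prime_index[OF finP solv normal_in_subgroup_of_normalizer[OF V P VP(1,2)]] VP(3)
    by auto
  then obtain r where r: "prime r" "card P = card M * r ^ 1" by (auto simp: order_def)
  show ?thesis
    using that[OF _ M(2) _ _ _ r(2)] subgroup_of_normalizer_if_normal[OF P M(1)] M(3) r infinity
    by (auto simp: residue_prime_def)
qed

text \<open>
  The coset of \<open>g\<close> generates the quotient of \<open>\<langle>g\<rangle>U\<close> by \<open>U\<close>. So this quotient is cyclic of order
  dividing the order of \<open>g\<close>, which gives the last two claims.
\<close>

lemma generate_mult_subgroup:
  assumes fin: "finite (carrier G)" and U: "subgroup U G" and g: "g \<in> normalizer G U"
  shows "subgroup (generate G {g} <#> U) G" "U \<subseteq> generate G {g} <#> U" "g \<in> generate G {g} <#> U"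
    "generate G {g} <#> U \<subseteq> normalizer G U"
    "\<exists>k. card (generate G {g} <#> U) = card U * k \<and> k dvd ord g"
    "solvable_seq G U \<Longrightarrow> solvable_seq G (generate G {g} <#> U)"
proof -
  have Uc: "U \<subseteq> carrier G" using subgroup.subset[OF U] .
  have gc: "g \<in> carrier G" using g mem_normalizer_iff[OF Uc] by blast
  let ?C = "generate G {g}" and ?N = "normalizer G U"
  let ?V = "?C <#> U"
  have N: "subgroup ?N G" by (rule normalizer_imp_subgroup[OF Uc])
  interpret N: group "G\<lparr>carrier := ?N\<rparr>" using N subgroup_imp_group by blast
  have UN: "U \<lhd> G\<lparr>carrier := ?N\<rparr>" by (rule subgroup_in_normalizer[OF U])
  have C: "subgroup ?C G" using gc by (intro generate_is_subgroup) simp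
  have CN: "?C \<subseteq> ?N" using generate_subgroup_incl[OF _ N, of "{g}"] g by simp
  then have CN': "subgroup ?C (G\<lparr>carrier := ?N\<rparr>)" using subgroup_incl C N by blast
  have "subgroup (U <#>\<^bsub>G\<lparr>carrier := ?N\<rparr>\<^esub> ?C) (G\<lparr>carrier := ?N\<rparr>)"
    by (rule N.mult_norm_subgroup[OF UN CN'])
  moreover have "U <#>\<^bsub>G\<lparr>carrier := ?N\<rparr>\<^esub> ?C = ?V"
    using N.commut_normal[OF CN' UN] by simp
  ultimately have V': "subgroup ?V (G\<lparr>carrier := ?N\<rparr>)" by simp
  then show V: "subgroup ?V G" using incl_subgroup[OF N] by blast
  show VN: "?V \<subseteq> ?N" using subgroup.subset[OF V'] by simp
  have "\<one> \<in> ?C" "\<one> \<in> U" using C U subgroup.one_closed by blast+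
  moreover have "g \<in> ?C" by (simp add: generate.incl)
  moreover have "u = \<one> \<otimes> u" if "u \<in> U" for u using that Uc by auto
  ultimately show UV: "U \<subseteq> ?V" and gV: "g \<in> ?V" unfolding set_mult_def using gc by (blast, force)
  let ?H = "G\<lparr>carrier := ?V\<rparr>"
  interpret U: normal U ?H by (rule normal_in_subgroup_of_normalizer[OF U V UV VN])
  interpret Q: group "?H Mod U" by (rule U.factorgroup_is_group)
  define c where "c = U #> g"
  have c: "c \<in> carrier (?H Mod U)" using gV by (auto simp: c_def carrier_FactGroup)
  have pow: "c [^]\<^bsub>?H Mod U\<^esub> k = U #> (g [^] k)" for k :: nat
    using U.FactGroup_pow[of g k] gV by (simp add: c_def flip: nat_pow_consistent)
  have gen: "carrier (?H Mod U) = {c [^]\<^bsub>?H Mod U\<^esub> k | k. k \<in> (UNIV :: nat set)}"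
  proof
    show "carrier (?H Mod U) \<subseteq> {c [^]\<^bsub>?H Mod U\<^esub> k | k. k \<in> (UNIV :: nat set)}"
    proof
      fix X assume "X \<in> carrier (?H Mod U)"
      then obtain x where x: "x \<in> ?V" "X = U #> x" by (auto simp: carrier_FactGroup)
      have "?V = U <#> ?C" using N.commut_normal[OF CN' UN] by simp
      then obtain u h where uh: "u \<in> U" "h \<in> ?C" "x = u \<otimes> h" using x by (auto simp: set_mult_def)
      then obtain k :: nat where k: "h = g [^] k" using generate_pow_on_finite_carrier[OF fin gc] by auto
      have "X = U #> (g [^] k)"
        using x uh k Uc gc coset_mult_assoc[OF Uc, of u "g [^] k"] coset_join2[OF _ U uh(1)] by auto
      then show "X \<in> {c [^]\<^bsub>?H Mod U\<^esub> k | k. k \<in> (UNIV :: nat set)}" using pow by auto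
    qed
  qed (use c in auto)
  have "finite ?V" using subgroup.subset[OF V] fin finite_subset by blast
  then have finQ: "finite (carrier (?H Mod U))" by (simp add: carrier_FactGroup)
  have "Q.ord c = order (?H Mod U)"
    using Q.generate_pow_card[OF c] Q.generate_pow_on_finite_carrier[OF finQ c] gen by (simp add: order_def)
  moreover have "Q.ord c dvd ord g"
    using pow[of "ord g"] Q.pow_eq_id[OF c, of "ord g"] gc Uc by simp
  moreover have "card ?V = card U * order (?H Mod U)"
    using U.lagrange[OF U.is_subgroup] by (simp add: order_def FactGroup_def mult.commute)
  ultimately show "\<exists>k. card ?V = card U * k \<and> k dvd ord g" by metis
  have "comm_group (?H Mod U)"
  proof (rule Q.group_comm_groupI)
    fix x y assume "x \<in> carrier (?H Mod U)" "y \<in> carrier (?H Mod U)"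
    then obtain j k :: nat where "x = c [^]\<^bsub>?H Mod U\<^esub> j" "y = c [^]\<^bsub>?H Mod U\<^esub> k" using gen by auto
    then show "x \<otimes>\<^bsub>?H Mod U\<^esub> y = y \<otimes>\<^bsub>?H Mod U\<^esub> x" using Q.nat_pow_comm[OF c] by simp
  qed
  then show "solvable_seq G ?V" if "solvable_seq G U"
    using solvable_seq.extension[OF that _ V] U.normal_axioms by blast
qed

end

section \<open>Marks\<close>

locale finite_admissible_family =
  admissible_family G act L
  for G :: "('a, 'm) monoid_scheme" (structure)
    and act :: "'a \<Rightarrow> 'l::{finite, lattice} \<Rightarrow> 'l"
    and L :: "'a set \<Rightarrow> 'l set" +
  assumes finite_carrier: "finite (carrier G)"
begin

text \<open>
  The symbol \<open>(G/K)\<^sub>s\<close> is the transitive \<open>G\<close>-set \<open>G/K\<close> whose point \<open>gK\<close> carries the label \<open>act g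
  s\<close>. The mark at \<open>(U, t)\<close> is the number of points that are fixed by \<open>U\<close> and have a label above
  \<open>t\<close>; it is computed with group elements instead of cosets and then divided by \<open>card K\<close>.
\<close>

definition above :: "'a set \<Rightarrow> 'l \<Rightarrow> 'a set \<Rightarrow> 'l \<Rightarrow> 'a set"
  where "above U t K s = {g \<in> carrier G. U \<subseteq> conjugate G g K \<and> t \<le> act g s}"

definition pair_mark :: "'a set \<Rightarrow> 'l \<Rightarrow> 'a set \<Rightarrow> 'l \<Rightarrow> rat"
  where "pair_mark U t K s = of_nat (card (above U t K s)) / of_nat (card K)"

definition orbit_mark :: "'a set \<Rightarrow> 'l \<Rightarrow> ('a set \<times> 'l) set \<Rightarrow> rat"
  where "orbit_mark U t a = (let (K, s) = (SOME x. x \<in> a) in pair_mark U t K s)"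

definition mark :: "'a set \<Rightarrow> 'l \<Rightarrow> (('a set \<times> 'l) set \<Rightarrow>\<^sub>0 rat) \<Rightarrow> rat"
  where "mark U t x = (\<Sum>a\<in>Poly_Mapping.keys x. Poly_Mapping.lookup x a * orbit_mark U t a)"

lemma pairsD: "(K, s) \<in> pairs G L \<Longrightarrow> subgroup K G" "(K, s) \<in> pairs G L \<Longrightarrow> s \<in> L K"
  by (auto simp: pairs_def)

lemma finite_subgroup: "subgroup K G \<Longrightarrow> finite K"
  using finite_carrier subgroup.subset finite_subset by blast

lemma card_subgroup_pos: "subgroup K G \<Longrightarrow> card K > 0"
  using finite_subgroup subgroup.one_closed card_gt_0_iff by blast

lemma finite_pairs: "finite (pairs G L)"
proof -
  have "pairs G L \<subseteq> Pow (carrier G) \<times> UNIV"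
    using subgroup.subset by (auto simp: pairs_def)
  then show ?thesis using finite_carrier by (meson finite finite_Pow_iff finite_SigmaI finite_subset)
qed

lemma finite_above: "finite (above U t K s)"
  using finite_carrier by (auto simp: above_def)

lemma conjugate_one: "K \<subseteq> carrier G \<Longrightarrow> conjugate G \<one> K = K"
  by (simp add: conjugate_def lcos_mult_one)

lemma card_conjugate:
  assumes "g \<in> carrier G" "K \<subseteq> carrier G"
  shows "card (conjugate G g K) = card K"
  using mem_conjugate[OF assms] card_image[OF inj_on_subset[OF inj_conjugate[OF assms(1)] assms(2)]] by simp

lemma conjugate_mono:
  assumes "g \<in> carrier G" "H \<subseteq> carrier G" "K \<subseteq> carrier G"
  shows "conjugate G g H \<subseteq> conjugate G g K \<longleftrightarrow> H \<subseteq> K"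
proof
  assume "conjugate G g H \<subseteq> conjugate G g K"
  then show "H \<subseteq> K"
    using inj_on_image_mem_iff[OF inj_conjugate[OF assms(1)] _ assms(3)] assms(2)
    unfolding mem_conjugate[OF assms(1,2)] mem_conjugate[OF assms(1,3)] by blast
qed (auto simp: mem_conjugate assms)

lemma above_left:
  assumes "x \<in> carrier G" "g \<in> carrier G" "U \<subseteq> carrier G" "K \<subseteq> carrier G"
  shows "x \<otimes> g \<in> above (conjugate G x U) (act x t) K s \<longleftrightarrow> g \<in> above U t K s"
  using assms by (simp add: above_def conjugate_mult conjugate_mono conjugate_carrier act_mult act_le)

lemma above_right:
  assumes "x \<in> carrier G" "g \<in> carrier G" "K \<subseteq> carrier G"
  shows "g \<in> above U t (conjugate G x K) (act x s) \<longleftrightarrow> g \<otimes> x \<in> above U t K s"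
  using assms by (simp add: above_def conjugate_mult act_mult)

lemma above_right_stable:
  assumes "(K, s) \<in> pairs G L" "k \<in> K" "g \<in> carrier G"
  shows "g \<otimes> k \<in> above U t K s \<longleftrightarrow> g \<in> above U t K s"
proof -
  note K = pairsD[OF assms(1)]
  have "k \<in> carrier G" using subgroup.mem_carrier[OF K(1) assms(2)] .
  from above_right[OF this assms(3) subgroup.subset[OF K(1)], of U t s]
  show ?thesis using conjugate_self[OF K(1) assms(2)] L_fixed[OF K(1) assms(2) K(2)] by simp
qed

lemma card_above_right:
  assumes "x \<in> carrier G" "K \<subseteq> carrier G"
  shows "card (above U t (conjugate G x K) (act x s)) = card (above U t K s)"
proof (rule bij_betw_same_card[OF bij_betwI[where f = "\<lambda>g. g \<otimes> x" and g = "\<lambda>g. g \<otimes> inv x"]])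
  show "(\<lambda>g. g \<otimes> x) \<in> above U t (conjugate G x K) (act x s) \<rightarrow> above U t K s"
  proof
    fix g assume g: "g \<in> above U t (conjugate G x K) (act x s)"
    then have "g \<in> carrier G" by (simp add: above_def)
    then show "g \<otimes> x \<in> above U t K s" using above_right[OF assms(1) _ assms(2)] g by simp
  qed
  show "(\<lambda>g. g \<otimes> inv x) \<in> above U t K s \<rightarrow> above U t (conjugate G x K) (act x s)"
  proof
    fix g assume g: "g \<in> above U t K s"
    then have gc: "g \<in> carrier G" by (simp add: above_def)
    then have "g \<otimes> inv x \<otimes> x = g" using assms(1) by (simp add: m_assoc)
    then show "g \<otimes> inv x \<in> above U t (conjugate G x K) (act x s)"
      using above_right[OF assms(1) _ assms(2), of "g \<otimes> inv x"] g gc assms(1) by simp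
  qed
qed (use assms in \<open>auto simp: above_def m_assoc\<close>)

lemma card_above_left:
  assumes "x \<in> carrier G" "U \<subseteq> carrier G" "K \<subseteq> carrier G"
  shows "card (above (conjugate G x U) (act x t) K s) = card (above U t K s)"
proof (rule sym, rule bij_betw_same_card[OF bij_betwI[where f = "\<lambda>g. x \<otimes> g" and g = "\<lambda>g. inv x \<otimes> g"]])
  show "(\<lambda>g. x \<otimes> g) \<in> above U t K s \<rightarrow> above (conjugate G x U) (act x t) K s"
  proof
    fix g assume g: "g \<in> above U t K s"
    then have "g \<in> carrier G" by (simp add: above_def)
    then show "x \<otimes> g \<in> above (conjugate G x U) (act x t) K s"
      using above_left[OF assms(1) _ assms(2,3)] g by simp
  qed
  show "(\<lambda>g. inv x \<otimes> g) \<in> above (conjugate G x U) (act x t) K s \<rightarrow> above U t K s"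
  proof
    fix g assume g: "g \<in> above (conjugate G x U) (act x t) K s"
    then have gc: "g \<in> carrier G" by (simp add: above_def)
    then have "x \<otimes> (inv x \<otimes> g) = g" using assms(1) by (simp add: inv_cancel)
    then show "inv x \<otimes> g \<in> above U t K s"
      using above_left[OF assms(1) _ assms(2,3), of "inv x \<otimes> g"] g gc assms(1) by simp
  qed
qed (use assms in \<open>auto simp: above_def inv_cancel\<close>)

lemma pair_mark_right:
  "\<lbrakk>x \<in> carrier G; K \<subseteq> carrier G\<rbrakk> \<Longrightarrow> pair_mark U t (conjugate G x K) (act x s) = pair_mark U t K s"
  by (simp add: pair_mark_def card_above_right card_conjugate)

lemma pair_mark_left:
  "\<lbrakk>x \<in> carrier G; U \<subseteq> carrier G; K \<subseteq> carrier G\<rbrakk> \<Longrightarrow> pair_mark (conjugate G x U) (act x t) K s = pair_mark U t K s"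
  by (simp add: pair_mark_def card_above_left)

lemma orbit_mark_orbit:
  assumes "K \<subseteq> carrier G"
  shows "orbit_mark U t (orbit G (pair_action G act) (K, s)) = pair_mark U t K s"
proof -
  obtain x where "x \<in> carrier G" "(SOME z. z \<in> orbit G (pair_action G act) (K, s)) = (conjugate G x K, act x s)"
    using orbit_some[OF assms] by metis
  then show ?thesis using assms by (simp add: orbit_mark_def pair_mark_right)
qed

lemma mark_eq:
  assumes "finite A" "Poly_Mapping.keys x \<subseteq> A"
  shows "mark U t x = (\<Sum>a\<in>A. Poly_Mapping.lookup x a * orbit_mark U t a)"
  unfolding mark_def using assms by (intro sum.mono_neutral_left) (auto simp: in_keys_iff)

lemma mark_zero [simp]: "mark U t 0 = 0"
  by (simp add: mark_def)

lemma mark_add: "mark U t (x + y) = mark U t x + mark U t y"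
proof -
  let ?A = "Poly_Mapping.keys x \<union> Poly_Mapping.keys y"
  have "mark U t (x + y) = (\<Sum>a\<in>?A. Poly_Mapping.lookup (x + y) a * orbit_mark U t a)"
    using Poly_Mapping.keys_add[of x y] by (intro mark_eq) auto
  also have "\<dots> = mark U t x + mark U t y"
    by (subst (1 2) mark_eq[of ?A]) (auto simp: lookup_add distrib_right sum.distrib)
  finally show ?thesis .
qed

lemma mark_rscale: "mark U t (rscale c x) = c * mark U t x"
proof -
  have "mark U t (rscale c x) = (\<Sum>a\<in>Poly_Mapping.keys x. Poly_Mapping.lookup (rscale c x) a * orbit_mark U t a)"
    by (intro mark_eq) (auto simp: in_keys_iff)
  then show ?thesis by (simp add: mark_def sum_distrib_left mult.assoc)
qed

lemma mark_sum: "mark U t (sum f A) = (\<Sum>i\<in>A. mark U t (f i))"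
  by (induction A rule: infinite_finite_induct) (auto simp: mark_add)

lemma mark_symbol:
  "K \<subseteq> carrier G \<Longrightarrow> mark U t (symbol G act K s) = pair_mark U t K s"
  by (simp add: mark_def symbol_def orbit_mark_orbit)

lemma Sup_L_mem: assumes "subgroup H G" shows "Sup_fin (L H) \<in> L H"
proof -
  have "Sup_fin A \<in> L H" if "finite A" "A \<noteq> {}" "A \<subseteq> L H" for A
    using that by (induction A rule: finite_ne_induct) (auto intro: sup_closed[OF assms])
  then show ?thesis using nonempty[OF assms] by simp
qed

lemma Inf_mem: assumes "subgroup H G" "A \<noteq> {}" "A \<subseteq> L H" shows "Inf_fin A \<in> L H"
proof -
  have "finite A" by simp
  then show ?thesis using assms(2,3)
    by (induction A rule: finite_ne_induct) (auto intro: inf_closed[OF assms(1)])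
qed

lemma le_Sup_L: "s \<in> L H \<Longrightarrow> s \<le> Sup_fin (L H)"
  by (simp add: Sup_fin.coboundedI)

lemma act_Sup_L:
  "\<lbrakk>subgroup H G; g \<in> carrier G\<rbrakk> \<Longrightarrow> act g (Sup_fin (L H)) = Sup_fin (L (conjugate G g H))"
  by (simp add: L_conjugate act_Sup_fin nonempty Setcompr_eq_image)

text \<open>
  The suprema increase along inclusions of subgroups. Therefore the marks do not see that the
  labels in a product of two symbols are cut off by the supremum of some \<open>L V\<close>.
\<close>

lemma le_act_Sup_L:
  assumes "(U, t) \<in> pairs G L" "subgroup K G" "g \<in> carrier G" "U \<subseteq> conjugate G g K"
  shows "t \<le> act g (Sup_fin (L K))"
proof -
  note U = pairsD[OF assms(1)]
  have "t \<le> Sup_fin (L U)" using U(2) by (rule le_Sup_L)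
  also have "\<dots> \<le> Sup_fin (L (conjugate G g K))"
    using L_Sup_mono[OF conjugate_subgroup[OF assms(2,3)] U(1) assms(4)] .
  finally show ?thesis using act_Sup_L assms by simp
qed

lemma term_pair:
  assumes "(K, s) \<in> pairs G L" "(U, t) \<in> pairs G L" "h \<in> carrier G"
  shows "(K \<inter> conjugate G h U, inf (inf s (act h t)) (Sup_fin (L (K \<inter> conjugate G h U)))) \<in> pairs G L"
proof -
  note K = pairsD[OF assms(1)] and U = pairsD[OF assms(2)]
  let ?V = "K \<inter> conjugate G h U"
  have hU: "subgroup (conjugate G h U) G" using U(1) assms(3) by (rule conjugate_subgroup)
  have V: "subgroup ?V G" using K(1) hU by (rule subgroups_Inter_pair)
  have "act h t \<in> L (conjugate G h U)" using L_conjugate[OF U(1) assms(3)] U(2) by blast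
  then have "inf (act h t) (Sup_fin (L ?V)) \<in> L ?V" "inf s (Sup_fin (L ?V)) \<in> L ?V"
    using L_restrict[OF hU V] L_restrict[OF K(1) V] K(2) by blast+
  then have "inf (inf s (Sup_fin (L ?V))) (inf (act h t) (Sup_fin (L ?V))) \<in> L ?V"
    using inf_closed[OF V] by blast
  moreover have "inf (inf s (Sup_fin (L ?V))) (inf (act h t) (Sup_fin (L ?V))) =
      inf (inf s (act h t)) (Sup_fin (L ?V))"
    by (simp add: inf_aci)
  ultimately show ?thesis using V by (simp add: pairs_def)
qed

lemma mark_term_at:
  assumes P: "(P, q) \<in> pairs G L" and K: "(K, s) \<in> pairs G L" and U: "(U, t) \<in> pairs G L" and h: "h \<in> carrier G"
  shows "of_nat (card (K \<inter> conjugate G h U)) * mark P q (term_at K s U t h) =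
    of_nat (card {g \<in> above P q K s. g \<otimes> h \<in> above P q U t})"
proof -
  let ?V = "K \<inter> conjugate G h U"
  note sg = pairsD[OF K] pairsD[OF U]
  note sub = subgroup.subset[OF sg(1)] subgroup.subset[OF sg(3)]
  have V: "subgroup ?V G" using pairsD(1)[OF term_pair[OF K U h]] .
  have "above P q ?V (inf (inf s (act h t)) (Sup_fin (L ?V))) = {g \<in> above P q K s. g \<otimes> h \<in> above P q U t}"
  proof (intro Set.set_eqI)
    fix g
    show "g \<in> above P q ?V (inf (inf s (act h t)) (Sup_fin (L ?V))) \<longleftrightarrow> g \<in> {g \<in> above P q K s. g \<otimes> h \<in> above P q U t}"
    proof (cases "g \<in> carrier G \<and> P \<subseteq> conjugate G g ?V")
      case True
      then have "q \<le> act g (Sup_fin (L ?V))" using le_act_Sup_L[OF P V] by blast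
      with True show ?thesis
        using h sub by (auto simp: above_def act_inf conjugate_Int conjugate_mult conjugate_carrier act_mult)
    next
      case False
      then show ?thesis
        using h sub by (auto simp: above_def conjugate_Int conjugate_mult conjugate_carrier)
    qed
  qed
  then show ?thesis
    using card_subgroup_pos[OF V] subgroup.subset[OF V]
    by (simp add: term_at_def Let_def mark_symbol pair_mark_def)
qed

text \<open>
  The marks are multiplicative on symbols because both sides count the pairs \<open>(g, g')\<close> with \<open>g\<close>
  above \<open>(P, q)\<close> in the first symbol and \<open>g'\<close> in the second one; such pairs are sorted by the
  double coset of \<open>g\<^sup>-\<^sup>1g'\<close>.
\<close>

lemma mark_orbit_mult:
  assumes P: "(P, q) \<in> pairs G L" and K: "(K, s) \<in> pairs G L" and U: "(U, t) \<in> pairs G L"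
  shows "mark P q (orbit_mult G act L (orbit G (pair_action G act) (K, s)) (orbit G (pair_action G act) (U, t))) =
    pair_mark P q K s * pair_mark P q U t"
proof -
  note sg = pairsD[OF K] pairsD[OF U]
  let ?A = "above P q K s" and ?B = "above P q U t"
  let ?r = "\<lambda>D. SOME h. h \<in> D"
  have r: "?r D \<in> D" if "D \<in> double_cosets G K U" for D
    using double_coset_nonempty(1)[OF sg(1,3) that] by (simp add: some_in_eq)
  let ?f = "\<lambda>h. mark P q (term_at K s U t h)"
  have f: "?f (k \<otimes> h \<otimes> u) = ?f h" if h: "h \<in> carrier G" "k \<in> K" "u \<in> U" for h k u
  proof -
    have "K <#> (h <# U) \<in> double_cosets G K U" using h unfolding double_cosets_def by blast
    moreover have "k \<otimes> h \<otimes> u \<in> K <#> (h <# U)"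
      using h subgroup.mem_carrier[OF sg(1)] subgroup.mem_carrier[OF sg(3)]
      unfolding mem_double_coset_iff by (metis m_assoc)
    ultimately show ?thesis
      using term_at_double_coset[OF K U] double_coset_self[OF sg(1,3) h(1)] by metis
  qed
  have "of_nat (card K * card U) * (\<Sum>D\<in>double_cosets G K U. ?f (?r D)) =
      (\<Sum>h\<in>carrier G. of_nat (card (K \<inter> conjugate G h U)) * ?f h)"
    by (rule sum_double_cosets[OF finite_carrier sg(1,3) r f, symmetric])
  also have "\<dots> = of_nat (\<Sum>h\<in>carrier G. card {g \<in> ?A. g \<otimes> h \<in> ?B})"
    using mark_term_at[OF P K U] by simp
  also have "(\<Sum>h\<in>carrier G. card {g \<in> ?A. g \<otimes> h \<in> ?B}) = (\<Sum>g\<in>?A. card {h \<in> carrier G. g \<otimes> h \<in> ?B})"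
    using sum.swap_restrict[OF finite_carrier finite_above[of P q K s], of "\<lambda>_ _. 1::nat" "\<lambda>h g. g \<otimes> h \<in> ?B"]
    by simp
  also have "\<dots> = (\<Sum>g\<in>?A. card ?B)"
  proof (rule sum.cong[OF refl])
    fix g assume "g \<in> ?A"
    then have g: "g \<in> carrier G" by (simp add: above_def)
    have "bij_betw (\<lambda>h. g \<otimes> h) {h \<in> carrier G. g \<otimes> h \<in> ?B} ?B"
      by (rule bij_betwI[where g = "\<lambda>b. inv g \<otimes> b"])
        (use g in \<open>auto simp: above_def inv_cancel\<close>)
    then show "card {h \<in> carrier G. g \<otimes> h \<in> ?B} = card ?B" by (rule bij_betw_same_card)
  qed
  finally have "of_nat (card K) * of_nat (card U) * (\<Sum>D\<in>double_cosets G K U. ?f (?r D)) =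
      (of_nat (card ?A) * of_nat (card ?B) :: rat)" by simp
  moreover have "orbit_mult G act L (orbit G (pair_action G act) (K, s)) (orbit G (pair_action G act) (U, t)) =
      (\<Sum>D\<in>double_cosets G K U. term_at K s U t (?r D))"
    by (rule orbit_mult_eq[OF K U r])
  ultimately show ?thesis
    using card_subgroup_pos[OF sg(1)] card_subgroup_pos[OF sg(3)]
    by (simp add: mark_sum pair_mark_def field_simps)
qed

lemma pair_orbitsE:
  assumes "a \<in> pair_orbits G act L"
  obtains K s where "(K, s) \<in> pairs G L" "a = orbit G (pair_action G act) (K, s)"
  using assms unfolding pair_orbits_def orbits_def by auto

lemma mem_orbit_self: "K \<subseteq> carrier G \<Longrightarrow> (K, s) \<in> orbit G (pair_action G act) (K, s)"
  unfolding orbit_def pair_action_def using conjugate_one[of K] by force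

lemma pair_orbit_mem:
  assumes a: "a \<in> pair_orbits G act L" and x: "(K, s) \<in> a"
  shows "(K, s) \<in> pairs G L" "a = orbit G (pair_action G act) (K, s)"
    "\<And>g. g \<in> carrier G \<Longrightarrow> (conjugate G g K, act g s) \<in> a"
proof -
  obtain K' s' where K': "(K', s') \<in> pairs G L" "a = orbit G (pair_action G act) (K', s')"
    using a by (rule pair_orbitsE)
  note sg = pairsD[OF K'(1)]
  obtain g where g: "g \<in> carrier G" "K = conjugate G g K'" "s = act g s'"
    using x K'(2) by (auto simp: orbit_def pair_action_def)
  show "(K, s) \<in> pairs G L"
    using g sg conjugate_subgroup L_conjugate by (auto simp: pairs_def)
  show ax: "a = orbit G (pair_action G act) (K, s)"
    using g K' orbit_pair_action[OF g(1) subgroup.subset[OF sg(1)]] by simp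
  show "(conjugate G g K, act g s) \<in> a" if "g \<in> carrier G" for g
    unfolding ax using that by (auto simp: orbit_def pair_action_def)
qed

lemma orbit_mark_pair_orbit:
  assumes "a \<in> pair_orbits G act L" "(K, s) \<in> a"
  shows "orbit_mark U t a = pair_mark U t K s"
proof -
  have "K \<subseteq> carrier G" using pair_orbit_mem(1)[OF assms] pairsD(1) subgroup.subset by blast
  then show ?thesis using pair_orbit_mem(2)[OF assms] orbit_mark_orbit by simp
qed

lemma orbit_in_pair_orbits: "(K, s) \<in> pairs G L \<Longrightarrow> orbit G (pair_action G act) (K, s) \<in> pair_orbits G act L"
  by (auto simp: pair_orbits_def orbits_def)

text \<open>
  With respect to inclusion of subgroups together with the lattice order, the table of marks is
  triangular with nonzero diagonal: at a maximal pair \<open>(K, s)\<close> among those that occur in \<open>x\<close>,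
  only the orbit of \<open>(K, s)\<close> contributes to the mark of \<open>x\<close>.
\<close>

lemma marks_separate:
  assumes keys: "Poly_Mapping.keys x \<subseteq> pair_orbits G act L"
    and zero: "\<And>U t. (U, t) \<in> pairs G L \<Longrightarrow> mark U t x = 0"
  shows "x = 0"
proof (rule ccontr)
  assume "x \<noteq> 0"
  then have "Poly_Mapping.keys x \<noteq> {}" by simp
  let ?S = "\<Union>(Poly_Mapping.keys x)"
  \<comment> \<open>This weight is strictly monotone in the subgroup and in the lattice element, so a pair of
    maximal weight is maximal in the product order.\<close>
  let ?m = "\<lambda>(K, s). card K + card {l::'l. l \<le> s}"
  have S: "?S \<subseteq> pairs G L" using keys pair_orbit_mem(1) by fastforce
  then have finS: "finite ?S" using finite_pairs finite_subset by blast
  obtain a where a: "a \<in> Poly_Mapping.keys x" using \<open>Poly_Mapping.keys x \<noteq> {}\<close> by blast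
  then obtain K' s' where "(K', s') \<in> pairs G L" "a = orbit G (pair_action G act) (K', s')"
    using keys pair_orbitsE by blast
  then have "(K', s') \<in> ?S" using a mem_orbit_self subgroup.subset pairsD(1) by blast
  then have "?S \<noteq> {}" by blast
  then obtain z where z: "z \<in> ?S" "?m z = Max (?m ` ?S)"
    using Max_in[of "?m ` ?S"] finS by fastforce
  obtain K s where Ks: "z = (K, s)" by (cases z)
  have max: "card K' + card {l::'l. l \<le> s'} \<le> card K + card {l::'l. l \<le> s}" if "(K', s') \<in> ?S" for K' s'
  proof -
    have "?m (K', s') \<le> Max (?m ` ?S)" by (rule Max_ge) (use finS that in auto)
    then show ?thesis using z Ks by simp
  qed
  obtain b where b: "b \<in> Poly_Mapping.keys x" "(K, s) \<in> b" using z Ks by blast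
  have bo: "b \<in> pair_orbits G act L" using b keys by blast
  have Kp: "(K, s) \<in> pairs G L" using pair_orbit_mem(1)[OF bo b(2)] .
  have only: "orbit_mark K s c = 0" if c: "c \<in> Poly_Mapping.keys x" "c \<noteq> b" for c
  proof (rule ccontr)
    assume nz: "orbit_mark K s c \<noteq> 0"
    have co: "c \<in> pair_orbits G act L" using c keys by blast
    then obtain K' s' where "(K', s') \<in> pairs G L" "c = orbit G (pair_action G act) (K', s')"
      by (rule pair_orbitsE)
    then have in_c: "(K', s') \<in> c" and K': "subgroup K' G"
      using mem_orbit_self subgroup.subset pairsD(1) by blast+
    have "pair_mark K s K' s' \<noteq> 0" using nz orbit_mark_pair_orbit[OF co in_c] by simp
    then have "above K s K' s' \<noteq> {}" by (auto simp: pair_mark_def)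
    then obtain g where g: "g \<in> carrier G" "K \<subseteq> conjugate G g K'" "s \<le> act g s'"
      by (auto simp: above_def)
    have gc: "(conjugate G g K', act g s') \<in> c" using pair_orbit_mem(3)[OF co in_c g(1)] .
    then have le: "card (conjugate G g K') + card {l. l \<le> act g s'} \<le> card K + card {l. l \<le> s}"
      using c by (intro max) blast
    have finK': "finite (conjugate G g K')" using conjugate_subgroup[OF K' g(1)] finite_subgroup by blast
    have 1: "card K \<le> card (conjugate G g K')" using card_mono[OF finK' g(2)] .
    have sub: "{l. l \<le> s} \<subseteq> {l. l \<le> act g s'}" using g(3) by auto
    have 2: "card {l. l \<le> s} \<le> card {l. l \<le> act g s'}" using card_mono[OF _ sub] by simp
    have "K = conjugate G g K'" using card_subset_eq[OF finK' g(2)] le 1 2 by linarith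
    moreover have "{l. l \<le> s} = {l. l \<le> act g s'}" using card_subset_eq[OF _ sub] le 1 2 by simp
    then have "s = act g s'" using g(3) by (metis (mono_tags) antisym mem_Collect_eq order_refl)
    ultimately have "(K, s) \<in> c" using gc by simp
    then have "c = b" using pair_orbit_mem(2)[OF co] pair_orbit_mem(2)[OF bo b(2)] by metis
    then show False using c by blast
  qed
  have "mark K s x = Poly_Mapping.lookup x b * orbit_mark K s b"
    unfolding mark_def using sum.remove[OF _ b(1), of "\<lambda>a. Poly_Mapping.lookup x a * orbit_mark K s a"] only
    by simp
  moreover have "Poly_Mapping.lookup x b \<noteq> 0" using b(1) by (simp add: in_keys_iff)
  moreover have "\<one> \<in> above K s K s"
    using conjugate_one[OF subgroup.subset[OF pairsD(1)[OF Kp]]] by (simp add: above_def)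
  then have "card (above K s K s) \<noteq> 0" using finite_above card_0_eq by blast
  then have "orbit_mark K s b \<noteq> 0"
    using orbit_mark_pair_orbit[OF bo b(2)] card_subgroup_pos[OF pairsD(1)[OF Kp]]
    by (simp add: pair_mark_def)
  ultimately show False using zero[OF Kp] by simp
qed

end

section \<open>The lattice Burnside ring and its prime ideals\<close>

locale lattice_burnside_ring =
  finite_admissible_family G act L
  for G :: "('a, 'm) monoid_scheme" (structure)
    and act :: "'a \<Rightarrow> 'l::{finite, lattice} \<Rightarrow> 'l"
    and L :: "'a set \<Rightarrow> 'l set" +
  fixes p :: enat
  assumes prime_or_infinity: "prime_or_infinity p"
begin

abbreviation \<Omega> where "\<Omega> \<equiv> Omega_at p G act L"

lemmas Z_at_closed = Z_at_subring[OF prime_or_infinity]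

lemma of_int_Z_at: "of_int n \<in> Z_at p"
  using Z_at_closed(1) by auto

lemma zero_Z_at: "0 \<in> Z_at p" and one_Z_at: "1 \<in> Z_at p"
  using of_int_Z_at[of 0] of_int_Z_at[of 1] by simp_all

lemma uminus_Z_at: "a \<in> Z_at p \<Longrightarrow> - a \<in> Z_at p"
  using Z_at_closed(3)[OF of_int_Z_at[of "-1"]] by simp

lemma sum_Z_at: "(\<And>i. i \<in> A \<Longrightarrow> f i \<in> Z_at p) \<Longrightarrow> sum f A \<in> Z_at p"
  by (induction A rule: infinite_finite_induct) (auto simp: zero_Z_at Z_at_closed(2))

lemma carrier_Omega:
  "x \<in> carrier \<Omega> \<longleftrightarrow> Poly_Mapping.keys x \<subseteq> pair_orbits G act L \<and> (\<forall>a. Poly_Mapping.lookup x a \<in> Z_at p)"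
  by (simp add: Omega_at_def burnside_ring_def)

lemma zero_Omega [simp]: "\<zero>\<^bsub>\<Omega>\<^esub> = 0"
  and add_Omega [simp]: "x \<oplus>\<^bsub>\<Omega>\<^esub> y = x + y"
  and one_Omega: "\<one>\<^bsub>\<Omega>\<^esub> = symbol G act (carrier G) (Sup_fin (L (carrier G)))"
  and mult_Omega: "x \<otimes>\<^bsub>\<Omega>\<^esub> y = (\<Sum>a\<in>Poly_Mapping.keys x. \<Sum>b\<in>Poly_Mapping.keys y.
     rscale (Poly_Mapping.lookup x a * Poly_Mapping.lookup y b) (orbit_mult G act L a b))"
  by (simp_all add: Omega_at_def burnside_ring_def)

lemma zero_in_Omega: "0 \<in> carrier \<Omega>"
  by (simp add: carrier_Omega zero_Z_at)

lemma add_in_Omega: "\<lbrakk>x \<in> carrier \<Omega>; y \<in> carrier \<Omega>\<rbrakk> \<Longrightarrow> x + y \<in> carrier \<Omega>"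
  using Poly_Mapping.keys_add[of x y] by (auto simp: carrier_Omega lookup_add Z_at_closed(2))

lemma rscale_in_Omega: "\<lbrakk>c \<in> Z_at p; x \<in> carrier \<Omega>\<rbrakk> \<Longrightarrow> rscale c x \<in> carrier \<Omega>"
  by (auto simp: carrier_Omega Z_at_closed(3) in_keys_iff)

lemma sum_in_Omega: "(\<And>i. i \<in> A \<Longrightarrow> f i \<in> carrier \<Omega>) \<Longrightarrow> sum f A \<in> carrier \<Omega>"
  by (induction A rule: infinite_finite_induct) (auto simp: zero_in_Omega add_in_Omega)

lemma symbol_in_Omega: "(K, s) \<in> pairs G L \<Longrightarrow> symbol G act K s \<in> carrier \<Omega>"
  using orbit_in_pair_orbits
  by (auto simp: carrier_Omega symbol_def lookup_single when_def zero_Z_at one_Z_at)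

lemma orbit_mult_in_Omega:
  assumes "a \<in> pair_orbits G act L" "b \<in> pair_orbits G act L"
  shows "orbit_mult G act L a b \<in> carrier \<Omega>"
proof -
  obtain K s where K: "(K, s) \<in> pairs G L" "a = orbit G (pair_action G act) (K, s)"
    using assms(1) by (rule pair_orbitsE)
  obtain U t where U: "(U, t) \<in> pairs G L" "b = orbit G (pair_action G act) (U, t)"
    using assms(2) by (rule pair_orbitsE)
  note sg = pairsD(1)[OF K(1)] pairsD(1)[OF U(1)]
  have r: "(SOME h. h \<in> D) \<in> D" if "D \<in> double_cosets G K U" for D
    using double_coset_nonempty(1)[OF sg that] by (simp add: some_in_eq)
  have "term_at K s U t h \<in> carrier \<Omega>" if "h \<in> carrier G" for h
    using symbol_in_Omega[OF term_pair[OF K(1) U(1) that]] by (simp add: term_at_def Let_def)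
  then have "term_at K s U t (SOME h. h \<in> D) \<in> carrier \<Omega>" if "D \<in> double_cosets G K U" for D
    using r[OF that] double_coset_nonempty(2)[OF sg that] by blast
  then have "(\<Sum>D\<in>double_cosets G K U. term_at K s U t (SOME h. h \<in> D)) \<in> carrier \<Omega>"
    by (rule sum_in_Omega)
  then show ?thesis
    using orbit_mult_eq[OF K(1) U(1) r] K(2) U(2) by simp
qed

lemma mult_in_Omega:
  assumes "x \<in> carrier \<Omega>" "y \<in> carrier \<Omega>"
  shows "x \<otimes>\<^bsub>\<Omega>\<^esub> y \<in> carrier \<Omega>"
  unfolding mult_Omega
proof (intro sum_in_Omega rscale_in_Omega orbit_mult_in_Omega)
  fix a b assume "a \<in> Poly_Mapping.keys x" "b \<in> Poly_Mapping.keys y"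
  then show "a \<in> pair_orbits G act L" "b \<in> pair_orbits G act L"
    "Poly_Mapping.lookup x a * Poly_Mapping.lookup y b \<in> Z_at p"
    using assms Z_at_closed(3) by (auto simp: carrier_Omega)
qed

lemma top_pair: "(carrier G, Sup_fin (L (carrier G))) \<in> pairs G L"
  using Sup_L_mem[OF subgroup_self] subgroup_self by (simp add: pairs_def)

lemma one_in_Omega: "\<one>\<^bsub>\<Omega>\<^esub> \<in> carrier \<Omega>"
  unfolding one_Omega by (rule symbol_in_Omega[OF top_pair])

lemma mark_one:
  assumes "(U, t) \<in> pairs G L" shows "mark U t \<one>\<^bsub>\<Omega>\<^esub> = 1"
proof -
  have "U \<subseteq> conjugate G g (carrier G)" if "g \<in> carrier G" for g
    using conjugate_self[OF subgroup_self that] subgroup.subset[OF pairsD(1)[OF assms]] by simp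
  then have "above U t (carrier G) (Sup_fin (L (carrier G))) = carrier G"
    using le_act_Sup_L[OF assms subgroup_self] by (auto simp: above_def)
  then show ?thesis
    using card_subgroup_pos[OF subgroup_self] by (simp add: one_Omega mark_symbol pair_mark_def)
qed

lemma mark_mult:
  assumes P: "(P, q) \<in> pairs G L" and xy: "x \<in> carrier \<Omega>" "y \<in> carrier \<Omega>"
  shows "mark P q (x \<otimes>\<^bsub>\<Omega>\<^esub> y) = mark P q x * mark P q y"
proof -
  have *: "mark P q (orbit_mult G act L a b) = orbit_mark P q a * orbit_mark P q b"
    if a: "a \<in> pair_orbits G act L" and b: "b \<in> pair_orbits G act L" for a b
  proof -
    obtain K s where K: "(K, s) \<in> pairs G L" "a = orbit G (pair_action G act) (K, s)"
      using a by (rule pair_orbitsE)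
    obtain U t where U: "(U, t) \<in> pairs G L" "b = orbit G (pair_action G act) (U, t)"
      using b by (rule pair_orbitsE)
    show ?thesis
      using mark_orbit_mult[OF P K(1) U(1)] K U orbit_mark_orbit subgroup.subset pairsD(1) by metis
  qed
  have "mark P q (x \<otimes>\<^bsub>\<Omega>\<^esub> y) = (\<Sum>a\<in>Poly_Mapping.keys x. \<Sum>b\<in>Poly_Mapping.keys y.
     (Poly_Mapping.lookup x a * orbit_mark P q a) * (Poly_Mapping.lookup y b * orbit_mark P q b))"
    unfolding mult_Omega mark_sum mark_rscale
  proof (intro sum.cong refl)
    fix a b assume "a \<in> Poly_Mapping.keys x" "b \<in> Poly_Mapping.keys y"
    then have "a \<in> pair_orbits G act L" "b \<in> pair_orbits G act L"
      using xy by (auto simp: carrier_Omega)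
    from *[OF this] show "Poly_Mapping.lookup x a * Poly_Mapping.lookup y b * mark P q (orbit_mult G act L a b) =
        (Poly_Mapping.lookup x a * orbit_mark P q a) * (Poly_Mapping.lookup y b * orbit_mark P q b)"
      by simp
  qed
  also have "\<dots> = mark P q x * mark P q y"
    by (simp add: mark_def sum_product)
  finally show ?thesis .
qed

lemma Omega_eqI:
  assumes xy: "x \<in> carrier \<Omega>" "y \<in> carrier \<Omega>"
    and marks: "\<And>U t. (U, t) \<in> pairs G L \<Longrightarrow> mark U t x = mark U t y"
  shows "x = y"
proof -
  let ?d = "x + rscale (-1) y"
  have "?d \<in> carrier \<Omega>" using xy by (intro add_in_Omega rscale_in_Omega) (simp_all add: one_Z_at uminus_Z_at)
  moreover have "mark U t ?d = 0" if "(U, t) \<in> pairs G L" for U t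
    using marks[OF that] by (simp add: mark_add mark_rscale)
  ultimately have "?d = 0" using marks_separate by (simp add: carrier_Omega)
  moreover have "x = ?d + y"
    by (rule poly_mapping_eqI) (simp add: lookup_add)
  ultimately show ?thesis by simp
qed

text \<open>
  The marks embed the lattice Burnside ring into a ring of rational valued functions, from which
  the ring axioms are inherited.
\<close>

lemma Omega_cring: "cring \<Omega>"
proof (rule cringI)
  show "abelian_group \<Omega>"
  proof (rule abelian_groupI)
    fix x assume x: "x \<in> carrier \<Omega>"
    have "rscale (-1) x + x = 0" by (rule poly_mapping_eqI) (simp add: lookup_add)
    moreover have "rscale (-1) x \<in> carrier \<Omega>" using x by (intro rscale_in_Omega) (simp_all add: one_Z_at uminus_Z_at)
    ultimately show "\<exists>y\<in>carrier \<Omega>. y \<oplus>\<^bsub>\<Omega>\<^esub> x = \<zero>\<^bsub>\<Omega>\<^esub>" by auto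
  qed (simp_all add: add_in_Omega zero_in_Omega add.assoc add.commute)
  show "comm_monoid \<Omega>"
    by (rule comm_monoidI; (rule Omega_eqI)?)
      (simp_all add: mult_in_Omega one_in_Omega mark_mult mark_one)
  show "(x \<oplus>\<^bsub>\<Omega>\<^esub> y) \<otimes>\<^bsub>\<Omega>\<^esub> z = x \<otimes>\<^bsub>\<Omega>\<^esub> z \<oplus>\<^bsub>\<Omega>\<^esub> y \<otimes>\<^bsub>\<Omega>\<^esub> z"
    if "x \<in> carrier \<Omega>" "y \<in> carrier \<Omega>" "z \<in> carrier \<Omega>" for x y z
    using that by (intro Omega_eqI)
      (simp_all add: mult_in_Omega add_in_Omega mark_mult mark_add distrib_right)
qed

sublocale Omega: cring \<Omega> by (rule Omega_cring)

lemma mark_a_minus: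
  assumes "x \<in> carrier \<Omega>" "y \<in> carrier \<Omega>"
  shows "mark U t (x \<ominus>\<^bsub>\<Omega>\<^esub> y) = mark U t x - mark U t y"
proof -
  have "(x \<ominus>\<^bsub>\<Omega>\<^esub> y) \<oplus>\<^bsub>\<Omega>\<^esub> y = x" using assms by (simp add: Omega.minus_eq Omega.a_assoc Omega.l_neg del: add_Omega zero_Omega)
  then have "mark U t ((x \<ominus>\<^bsub>\<Omega>\<^esub> y) + y) = mark U t x" by simp
  then show ?thesis by (simp add: mark_add)
qed

text \<open>
  The set of the elements counted by the mark is a union of left cosets of \<open>K\<close>, that is, of
  double cosets of the trivial subgroup and \<open>K\<close>.
\<close>

lemma pair_mark_Ints:
  assumes "(K, s) \<in> pairs G L"
  shows "pair_mark U t K s \<in> \<int>"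
proof -
  note K = pairsD[OF assms]
  let ?f = "\<lambda>h. of_bool (h \<in> above U t K s) :: nat"
  let ?r = "\<lambda>D. SOME h. h \<in> D"
  have 1: "subgroup {\<one>} G" by (rule triv_subgroup)
  have "(\<Sum>h\<in>carrier G. of_nat (card ({\<one>} \<inter> conjugate G h K)) * ?f h) =
    of_nat (card {\<one>} * card K) * (\<Sum>D\<in>double_cosets G {\<one>} K. ?f (?r D))"
  proof (rule sum_double_cosets[OF finite_carrier 1 K(1)])
    show "?r D \<in> D" if "D \<in> double_cosets G {\<one>} K" for D
      using double_coset_nonempty(1)[OF 1 K(1) that] by (simp add: some_in_eq)
    show "?f (x \<otimes> h \<otimes> k) = ?f h" if "h \<in> carrier G" "x \<in> {\<one>}" "k \<in> K" for h x k
      using above_right_stable[OF assms that(3,1)] that by simp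
  qed
  moreover have "{\<one>} \<inter> conjugate G h K = {\<one>}" if "h \<in> carrier G" for h
    using subgroup.one_closed[OF conjugate_subgroup[OF K(1) that]] by blast
  ultimately have "(\<Sum>h\<in>carrier G. ?f h) = card K * (\<Sum>D\<in>double_cosets G {\<one>} K. ?f (?r D))"
    by simp
  moreover have "(\<Sum>h\<in>carrier G. ?f h) = card (above U t K s)"
    using finite_carrier by (simp add: of_bool_def sum.If_cases Int_def above_def)
  ultimately have "pair_mark U t K s = of_nat (\<Sum>D\<in>double_cosets G {\<one>} K. ?f (?r D))"
    using card_subgroup_pos[OF K(1)] by (simp add: pair_mark_def)
  then show ?thesis by (metis Ints_of_nat)
qed

lemma orbit_mark_Ints: "a \<in> pair_orbits G act L \<Longrightarrow> orbit_mark U t a \<in> \<int>"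
  by (elim pair_orbitsE) (auto simp: orbit_mark_orbit subgroup.subset pairsD pair_mark_Ints)

lemma mark_in_Z_at: "x \<in> carrier \<Omega> \<Longrightarrow> mark U t x \<in> Z_at p"
  unfolding mark_def using orbit_mark_Ints Z_at_closed(1)
  by (intro sum_Z_at Z_at_closed(3)) (auto simp: carrier_Omega subset_iff)

definition mark_preimage :: "'a set \<Rightarrow> 'l \<Rightarrow> rat set \<Rightarrow> (('a set \<times> 'l) set \<Rightarrow>\<^sub>0 rat) set"
  where "mark_preimage U t J = {x \<in> carrier \<Omega>. mark U t x \<in> J}"

lemma primeideal_mark_preimage:
  assumes U: "(U, t) \<in> pairs G L"
    and J: "0 \<in> J" "\<And>a b. \<lbrakk>a \<in> J; b \<in> J\<rbrakk> \<Longrightarrow> a + b \<in> J" "\<And>a b. \<lbrakk>a \<in> J; b \<in> Z_at p\<rbrakk> \<Longrightarrow> a * b \<in> J"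
    and "1 \<notin> J" and prime: "\<And>a b. \<lbrakk>a \<in> Z_at p; b \<in> Z_at p; a * b \<in> J\<rbrakk> \<Longrightarrow> a \<in> J \<or> b \<in> J"
  shows "mark_preimage U t J \<in> Spec \<Omega>"
  unfolding Spec_def
proof (rule CollectI, rule primeidealI[OF idealI])
  show "ring \<Omega>" by unfold_locales
  show "subgroup (mark_preimage U t J) (add_monoid \<Omega>)"
  proof (rule Omega.add.subgroupI)
    show "mark_preimage U t J \<subseteq> carrier \<Omega>" by (auto simp: mark_preimage_def)
    show "mark_preimage U t J \<noteq> {}" using zero_in_Omega J(1) by (auto simp: mark_preimage_def)
  next
    fix x assume x: "x \<in> mark_preimage U t J"
    then have "mark U t (\<zero>\<^bsub>\<Omega>\<^esub> \<ominus>\<^bsub>\<Omega>\<^esub> x) = mark U t x * (-1)"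
      by (subst mark_a_minus) (auto simp: mark_preimage_def zero_in_Omega)
    then have "mark U t (\<ominus>\<^bsub>\<Omega>\<^esub> x) \<in> J"
      using x J(3)[of "mark U t x" "-1"] uminus_Z_at[OF one_Z_at]
      by (simp add: Omega.minus_eq mark_preimage_def del: zero_Omega add_Omega)
    then show "\<ominus>\<^bsub>\<Omega>\<^esub> x \<in> mark_preimage U t J" using x by (simp add: mark_preimage_def)
  qed (simp add: mark_preimage_def add_in_Omega mark_add J(2))
  show "x \<otimes>\<^bsub>\<Omega>\<^esub> a \<in> mark_preimage U t J" "a \<otimes>\<^bsub>\<Omega>\<^esub> x \<in> mark_preimage U t J"
    if "a \<in> mark_preimage U t J" "x \<in> carrier \<Omega>" for a x
  proof -
    have "mark U t a * mark U t x \<in> J"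
      using that mark_in_Z_at by (intro J(3)) (auto simp: mark_preimage_def)
    then show "x \<otimes>\<^bsub>\<Omega>\<^esub> a \<in> mark_preimage U t J" "a \<otimes>\<^bsub>\<Omega>\<^esub> x \<in> mark_preimage U t J"
      using that by (simp_all add: mark_preimage_def mult_in_Omega mark_mult[OF U] mult.commute)
  qed
  show "cring \<Omega>" by (rule Omega_cring)
  show "carrier \<Omega> \<noteq> mark_preimage U t J"
  proof
    assume "carrier \<Omega> = mark_preimage U t J"
    then have "\<one>\<^bsub>\<Omega>\<^esub> \<in> mark_preimage U t J" using one_in_Omega by simp
    then show False using mark_one[OF U] \<open>1 \<notin> J\<close> by (simp add: mark_preimage_def)
  qed
  show "a \<in> mark_preimage U t J \<or> b \<in> mark_preimage U t J"
    if "a \<in> carrier \<Omega>" "b \<in> carrier \<Omega>" "a \<otimes>\<^bsub>\<Omega>\<^esub> b \<in> mark_preimage U t J" for a b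
    using that prime mark_in_Z_at by (simp add: mark_preimage_def mark_mult[OF U])
qed

lemma mark_kernel_prime: "(U, t) \<in> pairs G L \<Longrightarrow> mark_preimage U t {0} \<in> Spec \<Omega>"
  by (rule primeideal_mark_preimage) auto

text \<open>
  Otherwise choose, for each of the finitely many pairs, an element of the kernel outside \<open>P\<close>.
  The product of these elements has all marks zero, so it is \<open>0 \<in> P\<close>, against the primality of
  \<open>P\<close>.
\<close>

lemma prime_contains_mark_kernel:
  assumes "P \<in> Spec \<Omega>"
  shows "\<exists>(U, t)\<in>pairs G L. mark_preimage U t {0} \<subseteq> P"
proof (rule ccontr)
  interpret P: primeideal P \<Omega> using assms by (simp add: Spec_def)
  assume no: "\<not> ?thesis"
  have "\<exists>z\<in>carrier \<Omega> - P. \<forall>(U, t)\<in>F. mark U t z = 0" if "finite F" "F \<subseteq> pairs G L" for F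
    using that
  proof (induction F)
    case empty
    then show ?case using P.I_notcarr P.Icarr by auto
  next
    case (insert u F)
    then obtain z where z: "z \<in> carrier \<Omega>" "z \<notin> P" "\<forall>(U, t)\<in>F. mark U t z = 0" by auto
    obtain U t where u: "u = (U, t)" by (cases u)
    then have "\<not> mark_preimage U t {0} \<subseteq> P" using insert.prems no by blast
    then obtain y where y: "y \<in> carrier \<Omega>" "mark U t y = 0" "y \<notin> P"
      unfolding mark_preimage_def by blast
    have "z \<otimes>\<^bsub>\<Omega>\<^esub> y \<in> carrier \<Omega> - P" using P.I_prime[OF z(1) y(1)] z y by auto
    moreover have "mark U' t' (z \<otimes>\<^bsub>\<Omega>\<^esub> y) = 0" if "(U', t') \<in> insert u F" for U' t'
      using that insert.prems z y u by (subst mark_mult) auto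
    ultimately show ?case by blast
  qed
  from this[OF finite_pairs] obtain z where z: "z \<in> carrier \<Omega>" "z \<notin> P"
    "\<And>U t. (U, t) \<in> pairs G L \<Longrightarrow> mark U t z = 0" by auto
  have "z = 0" by (rule Omega_eqI) (use z zero_in_Omega in auto)
  then show False using z(2) P.zero_closed by simp
qed

end

section \<open>Separations in the Zariski topology\<close>

lemma topspace_zariski:
  assumes "cring R" shows "topspace (zariski R) = Spec R"
proof -
  interpret cring R by fact
  have "P \<in> zariski_closed R {\<one>\<^bsub>R\<^esub>} \<Longrightarrow> False" for P
  proof -
    assume "P \<in> zariski_closed R {\<one>\<^bsub>R\<^esub>}"
    then have P: "primeideal P R" "\<one>\<^bsub>R\<^esub> \<in> P" by (auto simp: zariski_closed_def Spec_def)
    then show False using primeideal.I_notcarr[OF P(1)] ideal.one_imp_carrier primeideal.axioms(1) by blast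
  qed
  then have "openin (zariski R) (Spec R)"
    unfolding openin_zariski by (intro exI[of _ "{\<one>\<^bsub>R\<^esub>}"]) auto
  moreover have "openin (zariski R) A \<Longrightarrow> A \<subseteq> Spec R" for A by (auto simp: openin_zariski)
  ultimately show ?thesis by (meson openin_subset openin_topspace subset_antisym)
qed

text \<open>
  Open sets of the spectrum are closed under passing to smaller primes, and each of \<open>A\<close>, \<open>B\<close> is
  the complement of the other.
\<close>

lemma open_separation_specialization:
  assumes A: "openin (zariski R) A" and B: "openin (zariski R) B" and AB: "Spec R \<subseteq> A \<union> B" "A \<inter> B = {}"
    and PQ: "P \<in> Spec R" "Q \<in> Spec R" "P \<subseteq> Q"
  shows "P \<in> A \<longleftrightarrow> Q \<in> A"
proof -
  have "Q \<in> C \<Longrightarrow> P \<in> C" if "openin (zariski R) C" for C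
    using that PQ by (auto simp: openin_zariski zariski_closed_def)
  from this[OF A] this[OF B] show ?thesis using AB PQ by blast
qed

section \<open>Congruences between marks\<close>

context lattice_burnside_ring
begin

text \<open>
  For \<open>t \<in> L V\<close> and \<open>V \<subseteq> P\<close>, this is the least element of \<open>L P\<close> above \<open>t\<close>. Since restriction to
  \<open>P\<close> maps labels of points fixed by \<open>P\<close> into \<open>L P\<close>, such a label is above \<open>t\<close> if and only if it
  is above the closure; so the points that are fixed by \<open>P\<close> and labelled above \<open>t\<close> are counted
  by a mark again, the one at \<open>(P, closure_at P t)\<close>.
\<close>

definition closure_at :: "'a set \<Rightarrow> 'l \<Rightarrow> 'l"
  where "closure_at P t = Inf_fin {s \<in> L P. t \<le> s}"

lemma closure_at_props:
  assumes V: "(V, t) \<in> pairs G L" and P: "subgroup P G" "V \<subseteq> P"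
  shows "closure_at P t \<in> L P" "t \<le> closure_at P t"
    and "\<And>W x. \<lbrakk>subgroup W G; P \<subseteq> W; x \<in> L W; t \<le> x\<rbrakk> \<Longrightarrow> closure_at P t \<le> x"
proof -
  let ?A = "{s \<in> L P. t \<le> s}"
  have t_le: "t \<le> Sup_fin (L P)"
    using le_Sup_L[OF pairsD(2)[OF V]] L_Sup_mono[OF P(1) pairsD(1)[OF V] P(2)] by (rule order_trans)
  then have ne: "?A \<noteq> {}" using Sup_L_mem[OF P(1)] by blast
  then show "closure_at P t \<in> L P" unfolding closure_at_def by (intro Inf_mem[OF P(1)]) auto
  show "t \<le> closure_at P t" unfolding closure_at_def using ne by (simp add: Inf_fin.bounded_iff)
  show "closure_at P t \<le> x" if W: "subgroup W G" "P \<subseteq> W" and x: "x \<in> L W" "t \<le> x" for W x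
  proof -
    have "inf x (Sup_fin (L P)) \<in> ?A" using L_restrict[OF W(1) P(1) W(2) x(1)] x(2) t_le by simp
    then have "closure_at P t \<le> inf x (Sup_fin (L P))"
      unfolding closure_at_def by (intro Inf_fin.coboundedI) simp_all
    then show ?thesis by simp
  qed
qed

lemma closure_at_self:
  assumes "(V, t) \<in> pairs G L" shows "closure_at V t = t"
  using closure_at_props(2)[OF assms pairsD(1)[OF assms] order_refl]
    closure_at_props(3)[OF assms pairsD(1)[OF assms] order_refl pairsD(1)[OF assms] order_refl pairsD(2)[OF assms]]
  by simp

lemma closure_at_closure_at:
  assumes V: "(V, t) \<in> pairs G L" and W: "subgroup W G" "V \<subseteq> W" and P: "subgroup P G" "W \<subseteq> P"
  shows "closure_at P (closure_at W t) = closure_at P t"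
proof -
  have "closure_at W t \<le> s \<longleftrightarrow> t \<le> s" if "s \<in> L P" for s
    using closure_at_props(2)[OF V W] closure_at_props(3)[OF V W P that] order_trans by blast
  then have "{s \<in> L P. closure_at W t \<le> s} = {s \<in> L P. t \<le> s}" by blast
  then show ?thesis by (simp add: closure_at_def)
qed

lemma act_in_L: "\<lbrakk>subgroup K G; g \<in> carrier G; s \<in> L K\<rbrakk> \<Longrightarrow> act g s \<in> L (conjugate G g K)"
  by (subst L_conjugate) blast+

lemma act_closure_at:
  assumes V: "(V, t) \<in> pairs G L" and W: "subgroup W G" "V \<subseteq> W"
    and g: "g \<in> normalizer G W" "act g t = t"
  shows "act g (closure_at W t) = closure_at W t"
proof -
  note Wc = subgroup.subset[OF W(1)]
  have *: "closure_at W t \<le> act x (closure_at W t)" if x: "x \<in> normalizer G W" "act x t = t" for x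
  proof -
    have xc: "x \<in> carrier G" "conjugate G x W = W" using x mem_normalizer_iff[OF Wc] by blast+
    then have "act x (closure_at W t) \<in> L W"
      using act_in_L[OF W(1) xc(1) closure_at_props(1)[OF V W]] by simp
    moreover have "t \<le> act x (closure_at W t)"
      using act_le[OF xc(1), of t "closure_at W t"] x(2) closure_at_props(2)[OF V W] by simp
    ultimately show ?thesis using closure_at_props(3)[OF V W W(1) order_refl] by blast
  qed
  have gc: "g \<in> carrier G" using g mem_normalizer_iff[OF Wc] by blast
  have ig: "inv g \<in> normalizer G W"
    by (rule subgroup.m_inv_closed[OF normalizer_imp_subgroup[OF Wc] g(1)])
  have "act (inv g) t = t" using g(2) gc act_inv(1)[OF gc, of t] by simp
  from *[OF ig this] have "act g (closure_at W t) \<le> act g (act (inv g) (closure_at W t))"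
    by (simp only: act_le[OF gc])
  then show ?thesis using *[OF g] gc by (intro antisym) simp_all
qed

lemma above_closure_at:
  assumes V: "(V, t) \<in> pairs G L" and P: "subgroup P G" "V \<subseteq> P" and K: "(K, s) \<in> pairs G L"
  shows "above P (closure_at P t) K s = {g \<in> above V t K s. P \<subseteq> conjugate G g K}"
proof -
  have "closure_at P t \<le> act g s \<longleftrightarrow> t \<le> act g s" if g: "g \<in> carrier G" "P \<subseteq> conjugate G g K" for g
  proof -
    have "subgroup (conjugate G g K) G" "act g s \<in> L (conjugate G g K)"
      using conjugate_subgroup act_in_L pairsD[OF K] g(1) by simp_all
    then show ?thesis
      using closure_at_props(2)[OF V P] closure_at_props(3)[OF V P _ g(2)] order_trans by blast
  qed
  then show ?thesis using P(2) by (auto simp: above_def)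
qed

definition congruent_marks :: "nat \<Rightarrow> 'a set \<times> 'l \<Rightarrow> 'a set \<times> 'l \<Rightarrow> bool"
  where "congruent_marks r x y \<longleftrightarrow> (\<forall>(K, s)\<in>pairs G L. \<exists>k.
    pair_mark (fst x) (snd x) K s - pair_mark (fst y) (snd y) K s = of_int (int r * k))"

definition linked :: "(('a set \<times> 'l) \<times> ('a set \<times> 'l)) set"
  where "linked = {(x, y). x \<in> pairs G L \<and> y \<in> pairs G L \<and> (\<exists>r. residue_prime p r \<and> congruent_marks r x y)}"

lemma congruent_marksD:
  assumes "congruent_marks r (U, t) (V, v)" "(K, s) \<in> pairs G L"
  obtains k where "pair_mark U t K s - pair_mark V v K s = of_int (int r * k)"
proof -
  have "\<exists>k. pair_mark U t K s - pair_mark V v K s = of_int (int r * k)"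
    using assms unfolding congruent_marks_def fst_conv snd_conv by blast
  then show ?thesis using that by blast
qed

lemma congruent_marks_sym:
  assumes "congruent_marks r x y" shows "congruent_marks r y x"
  unfolding congruent_marks_def
proof clarify
  fix K s assume K: "(K, s) \<in> pairs G L"
  obtain k where "pair_mark (fst x) (snd x) K s - pair_mark (fst y) (snd y) K s = of_int (int r * k)"
    using congruent_marksD[of r "fst x" "snd x" "fst y" "snd y", OF _ K] assms by auto
  then have "pair_mark (fst y) (snd y) K s - pair_mark (fst x) (snd x) K s = of_int (int r * (- k))"
    by simp
  then show "\<exists>k. pair_mark (fst y) (snd y) K s - pair_mark (fst x) (snd x) K s = of_int (int r * k)" ..
qed

lemma sym_linked: "sym linked"
  using congruent_marks_sym by (auto simp: linked_def intro!: symI)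

text \<open>
  The quotient of \<open>P\<close> by \<open>V\<close> acts on the points that are fixed by \<open>V\<close> and have a label above
  \<open>t\<close>. Its order is a power of \<open>r\<close>, so the number of these points is congruent modulo \<open>r\<close> to the
  number of points fixed by \<open>P\<close>. In terms of group elements: the set \<open>?A - ?B\<close> of the elements
  that count for \<open>(V, t)\<close> but not for \<open>(P, closure_at P t)\<close> is a union of double cosets of \<open>P\<close>
  and \<open>K\<close>, each consisting of a multiple of \<open>r\<close> left cosets of \<open>K\<close>.
\<close>

lemma linked_closure_at:
  assumes V: "(V, t) \<in> pairs G L" and P: "subgroup P G" "V \<subseteq> P" "P \<subseteq> normalizer G V"
    and fix_t: "\<And>g. g \<in> P \<Longrightarrow> act g t = t"
    and r: "residue_prime p r" and index: "card P = card V * r ^ k"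
  shows "((V, t), (P, closure_at P t)) \<in> linked"
proof -
  let ?v = "closure_at P t"
  have r0: "prime r" using r by (simp add: residue_prime_def)
  have vP: "?v \<in> L P" by (rule closure_at_props(1)[OF V P(1,2)])
  have Vs: "subgroup V G" using pairsD(1)[OF V] .
  note Vc = subgroup.subset[OF Vs] and Pc = subgroup.subset[OF P(1)]
  have "congruent_marks r (V, t) (P, ?v)"
    unfolding congruent_marks_def fst_conv snd_conv
  proof clarify
    fix K s assume K: "(K, s) \<in> pairs G L"
    have Ks: "subgroup K G" using pairsD(1)[OF K] .
    note Kc = subgroup.subset[OF Ks]
    let ?A = "above V t K s" and ?B = "above P ?v K s"
    let ?W = "\<lambda>h. P \<inter> conjugate G h K"
    have BA: "?B = {g \<in> ?A. P \<subseteq> conjugate G g K}" by (rule above_closure_at[OF V P(1,2) K])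
    have W: "subgroup (?W h) G" if "h \<in> carrier G" for h
      using subgroups_Inter_pair[OF P(1) conjugate_subgroup[OF Ks that]] .
    \<comment> \<open>The denominator cancels the weights in the summation formula for double cosets.\<close>
    let ?f = "\<lambda>h. of_bool (h \<in> ?A - ?B) / of_nat (card (?W h)) :: rat"
    let ?r = "\<lambda>D. SOME h. h \<in> D"
    have rep: "?r D \<in> D" if "D \<in> double_cosets G P K" for D
      using double_coset_nonempty(1)[OF P(1) Ks that] by (simp add: some_in_eq)
    have f: "?f (x \<otimes> h \<otimes> y) = ?f h" if h: "h \<in> carrier G" "x \<in> P" "y \<in> K" for h x y
    proof -
      have xc: "x \<in> carrier G" and yc: "y \<in> carrier G" using h Pc Kc by auto
      have xV: "conjugate G x V = V" using P(3) h(2) mem_normalizer_iff[OF Vc] by blast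
      have xP: "conjugate G x P = P" using conjugate_self[OF P(1) h(2)] .
      have yK: "conjugate G y K = K" using conjugate_self[OF Ks h(3)] .
      have "x \<otimes> h \<otimes> y \<in> ?A \<longleftrightarrow> h \<in> ?A"
        using above_right_stable[OF K h(3), of "x \<otimes> h" V t] above_left[OF xc h(1) Vc Kc, of t s]
          xV fix_t[OF h(2)] xc h(1) by simp
      moreover have "x \<otimes> h \<otimes> y \<in> ?B \<longleftrightarrow> h \<in> ?B"
        using above_right_stable[OF K h(3), of "x \<otimes> h" P ?v] above_left[OF xc h(1) Pc Kc, of ?v s]
          xP L_fixed[OF P(1) h(2) vP] xc h(1) by simp
      moreover have "?W (x \<otimes> h \<otimes> y) = conjugate G x (?W h)"
        using xc yc h(1) Kc Pc xP yK conjugate_carrier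
        by (simp add: conjugate_mult conjugate_Int)
      then have "card (?W (x \<otimes> h \<otimes> y)) = card (?W h)"
        using card_conjugate[OF xc subgroup.subset[OF W[OF h(1)]]] by simp
      ultimately show ?thesis by simp
    qed
    have "(\<Sum>h\<in>carrier G. of_nat (card (?W h)) * ?f h) = (\<Sum>h\<in>carrier G. of_bool (h \<in> ?A - ?B))"
    proof (rule sum.cong[OF refl])
      fix h assume "h \<in> carrier G"
      then show "of_nat (card (?W h)) * ?f h = of_bool (h \<in> ?A - ?B)"
        using card_subgroup_pos[OF W] by simp
    qed
    also have "\<dots> = of_nat (card (?A - ?B))"
    proof -
      have "carrier G \<inter> {h. h \<in> ?A - ?B} = ?A - ?B" by (auto simp: above_def)
      then show ?thesis using finite_carrier by (simp add: of_bool_def sum.If_cases)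
    qed
    also have "card (?A - ?B) = card ?A - card ?B"
      using BA finite_above by (intro card_Diff_subset) auto
    finally have "of_nat (card P * card K) * (\<Sum>D\<in>double_cosets G P K. ?f (?r D)) =
        of_nat (card ?A - card ?B)"
      using sum_double_cosets[OF finite_carrier P(1) Ks rep f] by simp
    moreover have "card ?B \<le> card ?A" using BA finite_above by (intro card_mono) auto
    ultimately have *: "pair_mark V t K s - pair_mark P ?v K s =
        (\<Sum>D\<in>double_cosets G P K. of_nat (card P) * ?f (?r D))"
      using card_subgroup_pos[OF Ks]
      by (simp add: pair_mark_def of_nat_diff field_simps sum_distrib_left)
    have "\<exists>i. of_nat (card P) * ?f h = of_int (int r * i)" if h: "h \<in> carrier G" for h
    proof (cases "h \<in> ?A - ?B")
      case True
      then have VW: "V \<subseteq> ?W h" "?W h \<noteq> P" using P(2) BA by (auto simp: above_def)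
      obtain j where j: "card (?W h) = card V * j" using card_subgroup_dvd[OF Vs W[OF h] VW(1)] by (elim dvdE)
      obtain i where i: "card P = card (?W h) * i" using card_subgroup_dvd[OF W[OF h] P(1)] by (auto elim: dvdE)
      have "card V * (j * i) = card V * r ^ k" by (metis i j index mult.assoc)
      then have "j * i = r ^ k" using nat_mult_eq_cancel1[OF card_subgroup_pos[OF Vs]] by blast
      then have "i dvd r ^ k" by (metis dvd_triv_right)
      then obtain l where l: "i = r ^ l" using r0 by (auto simp: divides_primepow_nat)
      have "i \<noteq> 1"
      proof
        assume "i = 1"
        then have "card (?W h) = card P" using i by simp
        then show False using card_subset_eq[OF finite_subgroup[OF P(1)], of "?W h"] VW(2) by blast
      qed
      then obtain m where "i = r * m" using l by (cases l) auto
      moreover have "of_nat (card P) * ?f h = (of_nat i :: rat)"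
        using True i card_subgroup_pos[OF W[OF h]] by simp
      ultimately have "of_nat (card P) * ?f h = of_int (int r * int m)" by simp
      then show ?thesis by blast
    next
      case False
      then have "of_nat (card P) * ?f h = of_int (int r * 0)" by simp
      then show ?thesis by blast
    qed
    then obtain i where i: "\<And>h. h \<in> carrier G \<Longrightarrow> of_nat (card P) * ?f h = of_int (int r * i h)" by metis
    have "(\<Sum>D\<in>double_cosets G P K. of_nat (card P) * ?f (?r D)) =
        (\<Sum>D\<in>double_cosets G P K. of_int (int r * i (?r D)))"
    proof (rule sum.cong[OF refl])
      fix D assume D: "D \<in> double_cosets G P K"
      show "of_nat (card P) * ?f (?r D) = of_int (int r * i (?r D))"
        using i rep[OF D] double_coset_nonempty(2)[OF P(1) Ks D] by blast
    qed
    also have "\<dots> = of_int (int r * (\<Sum>D\<in>double_cosets G P K. i (?r D)))"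
      by (simp add: sum_distrib_left)
    finally have "pair_mark V t K s - pair_mark P ?v K s = of_int (int r * (\<Sum>D\<in>double_cosets G P K. i (?r D)))"
      using * by simp
    then show "\<exists>k. pair_mark V t K s - pair_mark P ?v K s = of_int (int r * k)" ..
  qed
  moreover have "(P, ?v) \<in> pairs G L" using P(1) vP by (simp add: pairs_def)
  ultimately show ?thesis using V r by (auto simp: linked_def)
qed

text \<open>
  A descending chain of normal steps from \<open>P\<close> to \<open>V\<close> gives a chain of links. The closures along
  the chain stay fixed under the larger subgroups, and closing up in several steps amounts to
  closing up at once.
\<close>

lemma linked_rtrancl_closure_at:
  assumes V: "(V, t) \<in> pairs G L" and P: "subgroup P G" "V \<subseteq> P" "P \<subseteq> normalizer G V"
    and fix_t: "\<And>g. g \<in> P \<Longrightarrow> act g t = t"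
    and pP: "p_subgroup p G P"
  shows "((V, t), (P, closure_at P t)) \<in> linked\<^sup>*"
  using P fix_t pP
proof (induction "card P" arbitrary: P rule: less_induct)
  case less
  have Vs: "subgroup V G" using pairsD(1)[OF V] .
  show ?case
  proof (cases "V = P")
    case True
    then show ?thesis using closure_at_self V by auto
  next
    case False
    obtain M r k where M: "subgroup M G" "V \<subseteq> M" "M \<subset> P" "P \<subseteq> normalizer G M"
      and r: "residue_prime p r" "card P = card M * r ^ k"
      using p_subgroup_normal_step[OF prime_or_infinity finite_carrier Vs less.prems(1,2,3) False less.prems(5)]
      by metis
    have MP: "M \<subseteq> P" using M(3) by blast
    have "((V, t), (M, closure_at M t)) \<in> linked\<^sup>*"
    proof (rule less.hyps)
      show "card M < card P" using M(3) finite_subgroup[OF less.prems(1)] by (rule psubset_card_mono[rotated])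
      show "p_subgroup p G M" using p_subgroup_mono[OF prime_or_infinity M(1) less.prems(1) MP less.prems(5)] .
    qed (use M MP less.prems in auto)
    moreover have "((M, closure_at M t), (P, closure_at P (closure_at M t))) \<in> linked"
    proof (rule linked_closure_at[OF _ less.prems(1) MP M(4) _ r])
      show "(M, closure_at M t) \<in> pairs G L"
        using closure_at_props(1)[OF V M(1,2)] M(1) by (simp add: pairs_def)
      show "act g (closure_at M t) = closure_at M t" if "g \<in> P" for g
        using act_closure_at[OF V M(1,2)] that M(4) less.prems(4) by blast
    qed
    ultimately show ?thesis
      unfolding closure_at_closure_at[OF V M(1,2) less.prems(1) MP] by (rule rtrancl_into_rtrancl)
  qed
qed

section \<open>For p-groups the spectrum is connected\<close>

definition least_pair :: "'a set \<times> 'l"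
  where "least_pair = ({\<one>}, Inf_fin (L {\<one>}))"

lemma least_pair_in_pairs: "least_pair \<in> pairs G L"
  using Inf_mem[OF triv_subgroup] nonempty[OF triv_subgroup] triv_subgroup
  by (simp add: least_pair_def pairs_def)

text \<open>
  Every element of \<open>L U\<close> is above the least element of \<open>L {\<one>}\<close>, so the closure of the latter in
  \<open>L U\<close> is the least element of \<open>L U\<close>.
\<close>

lemma linked_least_pair:
  assumes G: "p_group p G" and U: "subgroup U G"
  shows "(least_pair, (U, Inf_fin (L U))) \<in> linked\<^sup>*"
proof -
  let ?m = "Inf_fin (L {\<one>})"
  have m: "({\<one>}, ?m) \<in> pairs G L" using least_pair_in_pairs by (simp add: least_pair_def)
  have 1: "{\<one>} \<subseteq> U" using subgroup.one_closed[OF U] by simp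
  note Uc = subgroup.subset[OF U]
  have conj1: "conjugate G g {\<one>} = {\<one>}" if "g \<in> carrier G" for g
    using that by (simp add: mem_conjugate)
  have least: "?m \<le> s" if s: "s \<in> L U" for s
  proof -
    have "inf s (Sup_fin (L {\<one>})) \<in> L {\<one>}" using L_restrict[OF U triv_subgroup 1 s] .
    then have "?m \<le> inf s (Sup_fin (L {\<one>}))" by (intro Inf_fin.coboundedI) simp_all
    then show ?thesis by simp
  qed
  then have "{s \<in> L U. ?m \<le> s} = L U" by blast
  then have "closure_at U ?m = Inf_fin (L U)" by (simp add: closure_at_def)
  moreover have "U \<subseteq> normalizer G {\<one>}"
    using mem_normalizer_iff[of "{\<one>}"] conj1 Uc by auto
  moreover have "act g ?m = ?m" if "g \<in> U" for g
  proof -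
    have *: "?m \<le> act x ?m" if x: "x \<in> carrier G" for x
    proof -
      have "act x ?m \<in> L {\<one>}" using act_in_L[OF triv_subgroup x pairsD(2)[OF m]] conj1[OF x] by simp
      then show ?thesis by (simp add: Inf_fin.coboundedI)
    qed
    have gc: "g \<in> carrier G" using that Uc by blast
    have "act g ?m \<le> act g (act (inv g) ?m)" using *[OF inv_closed[OF gc]] by (simp only: act_le[OF gc])
    then show ?thesis using *[OF gc] gc by (intro antisym) simp_all
  qed
  moreover have "p_subgroup p G U"
    using p_subgroup_mono[OF prime_or_infinity U subgroup_self Uc] G p_group_iff_p_subgroup by blast
  ultimately show ?thesis
    using linked_rtrancl_closure_at[OF m U 1] by (simp add: least_pair_def)
qed

text \<open>
  Descent along the lattice. All pairs \<open>(K, s)\<close> with the same \<open>s\<close> are linked to \<open>(U, s)\<close>,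
  because these subgroups \<open>K\<close> form an interval above \<open>U\<close> inside the normalizer of \<open>U\<close>. If \<open>s\<close> is
  not the least element of \<open>L U\<close>, it covers some \<open>t\<close>, and the covering hypothesis says that \<open>s\<close>
  is the closure of \<open>t\<close> at \<open>P = \<langle>g\<rangle>U\<close>. Then \<open>(U, t)\<close> is linked to \<open>(P, s)\<close>, hence to \<open>(U, s)\<close>,
  and \<open>t < s\<close>.
\<close>

lemma linked_to_least_pair:
  assumes G: "p_group p G"
    and cover: "\<And>K s. (K, s) \<in> pairs G L \<Longrightarrow>
      \<exists>H U. subgroup H G \<and> subgroup U G \<and> U \<subseteq> H \<and> H \<subseteq> normalizer G U \<and>
        {K. subgroup K G \<and> K \<subseteq> H \<and> U \<subseteq> K} = {K. subgroup K G \<and> s \<in> L K} \<and>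
        (\<forall>t. covers_in (L U) s t \<longrightarrow>
          (\<exists>g \<in> N_pair G act U t. s = Inf_fin {s' \<in> L (generate G {g} <#> U). t \<le> s'}))"
    and Ks: "(K, s) \<in> pairs G L"
  shows "(least_pair, (K, s)) \<in> linked\<^sup>*"
  using Ks
proof (induction "card {l. l < s}" arbitrary: K s rule: less_induct)
  case less
  note K = pairsD[OF less.prems]
  have p_sub: "p_subgroup p G P" if "subgroup P G" for P
    using p_subgroup_mono[OF prime_or_infinity that subgroup_self subgroup.subset[OF that]] G
      p_group_iff_p_subgroup by blast
  have sym: "(x, y) \<in> linked\<^sup>* \<Longrightarrow> (y, x) \<in> linked\<^sup>*" for x y
    using sym_rtrancl[OF sym_linked] by (rule symD)
  from cover[OF less.prems] obtain H U
    where *: "subgroup H G \<and> subgroup U G \<and> U \<subseteq> H \<and> H \<subseteq> normalizer G U \<and>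
        {K. subgroup K G \<and> K \<subseteq> H \<and> U \<subseteq> K} = {K. subgroup K G \<and> s \<in> L K} \<and>
        (\<forall>t. covers_in (L U) s t \<longrightarrow>
          (\<exists>g \<in> N_pair G act U t. s = Inf_fin {s' \<in> L (generate G {g} <#> U). t \<le> s'}))"
    by (elim exE)
  then have HU: "subgroup H G" "subgroup U G" "U \<subseteq> H" "H \<subseteq> normalizer G U"
    and interval: "{K. subgroup K G \<and> K \<subseteq> H \<and> U \<subseteq> K} = {K. subgroup K G \<and> s \<in> L K}"
    by simp_all
  have cov: "\<exists>g \<in> N_pair G act U t. s = Inf_fin {s' \<in> L (generate G {g} <#> U). t \<le> s'}"
    if "covers_in (L U) s t" for t using * that by simp
  have "U \<in> {K. subgroup K G \<and> K \<subseteq> H \<and> U \<subseteq> K}" using HU by simp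
  then have sU: "(U, s) \<in> pairs G L" unfolding interval by (simp add: pairs_def)
  have up: "((U, s), (P, s)) \<in> linked\<^sup>*" if P: "(P, s) \<in> pairs G L" for P
  proof -
    note Ps = pairsD[OF P]
    have "P \<in> {K. subgroup K G \<and> s \<in> L K}" using Ps by simp
    then have UP: "U \<subseteq> P" "P \<subseteq> H" unfolding interval[symmetric] by simp_all
    then have PN: "P \<subseteq> normalizer G U" using HU(4) by blast
    have "closure_at P s = s"
      using closure_at_props(2)[OF sU Ps(1) UP(1)]
        closure_at_props(3)[OF sU Ps(1) UP(1) Ps(1) order_refl Ps(2) order_refl] by simp
    then show ?thesis
      using linked_rtrancl_closure_at[OF sU Ps(1) UP(1) PN _ p_sub[OF Ps(1)]] L_fixed[OF Ps(1) _ Ps(2)]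
      by simp
  qed
  have "(least_pair, (U, s)) \<in> linked\<^sup>*"
  proof (cases "s = Inf_fin (L U)")
    case True
    then show ?thesis using linked_least_pair[OF G HU(2)] by simp
  next
    case False
    let ?T = "{t \<in> L U. t < s}"
    have "Inf_fin (L U) \<le> s" using pairsD(2)[OF sU] by (simp add: Inf_fin.coboundedI)
    then have "Inf_fin (L U) \<in> ?T"
      using False Inf_mem[OF HU(2) nonempty[OF HU(2)] order_refl] by (simp add: less_le)
    then have "?T \<noteq> {}" by blast
    then have "\<exists>t\<in>?T. \<forall>t'\<in>?T. t \<le> t' \<longrightarrow> t = t'" by (intro finite_has_maximal) simp_all
    then obtain t where t: "t \<in> ?T" and maximal: "\<forall>t'\<in>?T. t \<le> t' \<longrightarrow> t = t'" by (rule bexE)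
    have tU: "(U, t) \<in> pairs G L" using t HU(2) by (simp add: pairs_def)
    have "covers_in (L U) s t"
      unfolding covers_in_def
    proof (intro conjI notI)
      assume "\<exists>t'\<in>L U. t < t' \<and> t' < s"
      then obtain t' where t': "t' \<in> L U" "t < t'" "t' < s" by blast
      then have "t' \<in> ?T" by simp
      then have "t = t'" using maximal t'(2) less_imp_le by blast
      then show False using t'(2) by simp
    qed (use t pairsD(2)[OF sU] in simp_all)
    then obtain g where g: "g \<in> N_pair G act U t"
      and s: "s = Inf_fin {s' \<in> L (generate G {g} <#> U). t \<le> s'}" using cov by blast
    let ?P = "generate G {g} <#> U"
    have gN: "g \<in> normalizer G U" "act g t = t" "g \<in> carrier G"
      using g mem_normalizer_iff[OF subgroup.subset[OF HU(2)]]
      by (auto simp: N_pair_def stabilizer_def pair_action_def)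
    note P = generate_mult_subgroup[OF finite_carrier HU(2) gN(1)]
    have s': "s = closure_at ?P t" using s by (simp add: closure_at_def)
    have sP: "s \<in> L ?P" unfolding s' by (rule closure_at_props(1)[OF tU P(1,2)])
    have fix_t: "act x t = t" if x: "x \<in> ?P" for x
    proof -
      obtain c u where cu: "c \<in> generate G {g}" "u \<in> U" "x = c \<otimes> u" using x by (auto simp: set_mult_def)
      have "c \<in> stabilizer G act t"
        using generate_subgroup_incl[OF _ stabilizer_subgroup[of t], of "{g}"] gN cu(1)
        by (auto simp: stabilizer_def)
      then have "c \<in> carrier G" "act c t = t" by (simp_all add: stabilizer_def)
      moreover have "u \<in> carrier G" using subgroup.mem_carrier[OF HU(2) cu(2)] .
      moreover have "act u t = t" using L_fixed[OF HU(2) cu(2)] t by simp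
      ultimately show ?thesis using cu(3) by (simp add: act_mult)
    qed
    have "((U, t), (?P, s)) \<in> linked\<^sup>*"
      using linked_rtrancl_closure_at[OF tU P(1,2,4) fix_t p_sub[OF P(1)]] s' by simp
    moreover have "((?P, s), (U, s)) \<in> linked\<^sup>*"
      by (rule sym, rule up) (use P(1) sP in \<open>simp add: pairs_def\<close>)
    moreover have "(least_pair, (U, t)) \<in> linked\<^sup>*"
    proof (rule less.hyps[OF _ tU])
      have "{l. l < t} \<subset> {l. l < s}" using t(1) by auto
      then show "card {l. l < t} < card {l. l < s}" by (intro psubset_card_mono) simp_all
    qed
    ultimately show ?thesis by (meson rtrancl_trans)
  qed
  then show ?case using up[OF less.prems] by (rule rtrancl_trans)
qed

lemma Z_at_iff:
  "a \<in> Z_at p \<longleftrightarrow> (\<exists>m n. a = of_int m / of_int n \<and> (case p of enat q \<Rightarrow> \<not> int q dvd n | \<infinity> \<Rightarrow> n = 1))"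
  by (cases p) (auto simp: Z_at_def elim: Ints_cases)

definition residue_ideal :: "nat \<Rightarrow> rat set"
  where "residue_ideal r = {of_nat r * c | c. c \<in> Z_at p}"

lemma residue_ideal_prime:
  assumes r: "residue_prime p r"
  shows "1 \<notin> residue_ideal r"
    and "\<lbrakk>a \<in> Z_at p; b \<in> Z_at p; a * b \<in> residue_ideal r\<rbrakk> \<Longrightarrow> a \<in> residue_ideal r \<or> b \<in> residue_ideal r"
proof -
  let ?D = "\<lambda>n. case p of enat q \<Rightarrow> \<not> int q dvd n | \<infinity> \<Rightarrow> n = 1"
  have pr: "prime (int r)" using r by (simp add: residue_prime_def)
  have D: "\<not> int r dvd n" "n \<noteq> 0" if "?D n" for n :: int
    using that r prime_gt_1_nat[of r] by (auto simp: residue_prime_def split: enat.splits)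
  show "1 \<notin> residue_ideal r"
  proof
    assume "1 \<in> residue_ideal r"
    then obtain m n where "1 = of_nat r * (of_int m / of_int n :: rat)" and n: "?D n"
      by (auto simp: residue_ideal_def Z_at_iff)
    then have "(of_int n :: rat) = of_int (int r * m)" using D(2)[OF n] by (simp add: field_simps)
    then have "n = int r * m" by (simp only: of_int_eq_iff)
    then show False using D(1)[OF n] by simp
  qed
  show "a \<in> residue_ideal r \<or> b \<in> residue_ideal r"
    if ab: "a \<in> Z_at p" "b \<in> Z_at p" "a * b \<in> residue_ideal r"
  proof -
    obtain m n where a: "a = of_int m / of_int n" "?D n" using ab(1) unfolding Z_at_iff by blast
    obtain m' n' where b: "b = of_int m' / of_int n'" "?D n'" using ab(2) unfolding Z_at_iff by blast
    obtain m'' n'' where c: "a * b = of_nat r * (of_int m'' / of_int n'')" "?D n''"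
      using ab(3) unfolding residue_ideal_def Z_at_iff by blast
    have "(of_int (m * m' * n'') :: rat) = of_int (int r * (m'' * n * n'))"
      using c(1) D(2)[OF a(2)] D(2)[OF b(2)] D(2)[OF c(2)] by (simp add: a(1) b(1) field_simps)
    then have "m * m' * n'' = int r * (m'' * n * n')" by (simp only: of_int_eq_iff)
    then have "int r dvd m * m' * n''" by simp
    then have "int r dvd m \<or> int r dvd m'" using pr D(1)[OF c(2)] by (simp add: prime_dvd_mult_iff)
    moreover have "of_int k / of_int l \<in> residue_ideal r" if kl: "int r dvd k" "?D l" for k l
    proof -
      obtain k' where "k = int r * k'" using kl(1) by (rule dvdE)
      then have "of_int k / of_int l = of_nat r * (of_int k' / of_int l :: rat)" by simp
      then show ?thesis using kl(2) unfolding residue_ideal_def Z_at_iff by blast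
    qed
    ultimately show ?thesis using a b by blast
  qed
qed

lemma residue_ideal_prime_preimage:
  assumes "residue_prime p r" "(U, t) \<in> pairs G L"
  shows "mark_preimage U t (residue_ideal r) \<in> Spec \<Omega>"
proof (rule primeideal_mark_preimage[OF assms(2)])
  show "0 \<in> residue_ideal r" using zero_Z_at by (force simp: residue_ideal_def)
  show "a + b \<in> residue_ideal r" if "a \<in> residue_ideal r" "b \<in> residue_ideal r" for a b
    using that Z_at_closed(2) by (auto simp: residue_ideal_def simp flip: distrib_left)
  show "a * b \<in> residue_ideal r" if "a \<in> residue_ideal r" "b \<in> Z_at p" for a b
    using that Z_at_closed(3) by (auto simp: residue_ideal_def mult.assoc)
qed (use residue_ideal_prime[OF assms(1)] in auto)

lemma linked_preimage_eq:
  assumes "((U, t), (V, v)) \<in> linked"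
  obtains r where "residue_prime p r" "mark_preimage U t (residue_ideal r) = mark_preimage V v (residue_ideal r)"
proof -
  obtain r where r: "residue_prime p r" and cong: "congruent_marks r (U, t) (V, v)"
    using assms by (auto simp: linked_def)
  have "\<exists>k. orbit_mark U t a - orbit_mark V v a = of_int (int r * k)" if a: "a \<in> pair_orbits G act L" for a
    using a
  proof (rule pair_orbitsE)
    fix K s assume "(K, s) \<in> pairs G L" "a = orbit G (pair_action G act) (K, s)"
    then show ?thesis
      using congruent_marksD[OF cong, of K s] orbit_mark_orbit subgroup.subset pairsD(1) by metis
  qed
  then obtain k where k: "\<And>a. a \<in> pair_orbits G act L \<Longrightarrow> orbit_mark U t a - orbit_mark V v a = of_int (int r * k a)"
    by metis
  have "\<exists>c\<in>Z_at p. mark U t x - mark V v x = of_nat r * c" if x: "x \<in> carrier \<Omega>" for x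
  proof
    have "mark U t x - mark V v x = (\<Sum>a\<in>Poly_Mapping.keys x. Poly_Mapping.lookup x a * of_int (int r * k a))"
      unfolding mark_def sum_subtractf[symmetric]
      by (rule sum.cong[OF refl]) (use x k in \<open>auto simp: carrier_Omega simp flip: right_diff_distrib\<close>)
    then show "mark U t x - mark V v x = of_nat r * (\<Sum>a\<in>Poly_Mapping.keys x. Poly_Mapping.lookup x a * of_int (k a))"
      by (simp add: sum_distrib_left algebra_simps)
    show "(\<Sum>a\<in>Poly_Mapping.keys x. Poly_Mapping.lookup x a * of_int (k a)) \<in> Z_at p"
      using x of_int_Z_at by (intro sum_Z_at Z_at_closed(3)) (auto simp: carrier_Omega)
  qed
  then obtain c where c: "\<And>x. x \<in> carrier \<Omega> \<Longrightarrow> c x \<in> Z_at p \<and> mark U t x - mark V v x = of_nat r * c x"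
    by metis
  have 1: "mark U t x \<in> residue_ideal r \<longleftrightarrow> mark V v x \<in> residue_ideal r" if x: "x \<in> carrier \<Omega>" for x
  proof -
    have m: "mark U t x = mark V v x + of_nat r * c x" "c x \<in> Z_at p" using c[OF x] by simp_all
    show ?thesis
    proof
      assume "mark U t x \<in> residue_ideal r"
      then obtain d where d: "mark U t x = of_nat r * d" "d \<in> Z_at p" by (auto simp: residue_ideal_def)
      have "mark V v x = of_nat r * (d + - c x)" using m d by (simp add: algebra_simps)
      then show "mark V v x \<in> residue_ideal r"
        unfolding residue_ideal_def using Z_at_closed(2)[OF d(2) uminus_Z_at[OF m(2)]] by blast
    next
      assume "mark V v x \<in> residue_ideal r"
      then obtain d where d: "mark V v x = of_nat r * d" "d \<in> Z_at p" by (auto simp: residue_ideal_def)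
      have "mark U t x = of_nat r * (d + c x)" using m d by (simp add: algebra_simps)
      then show "mark U t x \<in> residue_ideal r"
        unfolding residue_ideal_def using Z_at_closed(2)[OF d(2) m(2)] by blast
    qed
  qed
  have "mark_preimage U t (residue_ideal r) = mark_preimage V v (residue_ideal r)"
    using 1 by (auto simp: mark_preimage_def)
  with r show ?thesis by (rule that)
qed

text \<open>
  If two pairs are linked at the prime \<open>r\<close>, the kernels of both marks lie in one and the same
  prime ideal, formed by the elements whose mark is divisible by \<open>r\<close>. So no separation of the
  spectrum can tell the two kernels apart; and every prime ideal contains a kernel.
\<close>

lemma connected_if_linked:
  assumes linked: "\<And>K s. (K, s) \<in> pairs G L \<Longrightarrow> (least_pair, (K, s)) \<in> linked\<^sup>*"
  shows "connected_space (zariski \<Omega>)"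
  unfolding connected_space_def
proof clarify
  fix A B
  assume A: "openin (zariski \<Omega>) A" and B: "openin (zariski \<Omega>) B"
    and "topspace (zariski \<Omega>) \<subseteq> A \<union> B" and AB: "A \<inter> B = {}" and ne: "A \<noteq> {}" "B \<noteq> {}"
  then have cover: "Spec \<Omega> \<subseteq> A \<union> B" using topspace_zariski[OF Omega_cring] by simp
  note up = open_separation_specialization[OF A B cover AB]
  let ?k = "\<lambda>(U, t). mark_preimage U t {0}"
  have mono: "mark_preimage U t {0} \<subseteq> mark_preimage U t (residue_ideal r)" for U t r
    using zero_Z_at by (force simp: mark_preimage_def residue_ideal_def)
  have step: "?k x \<in> A \<longleftrightarrow> ?k y \<in> A" if l: "(x, y) \<in> linked" for x y
  proof -
    obtain U t V v where xy: "x = (U, t)" "y = (V, v)" by (cases x, cases y)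
    have pr: "(U, t) \<in> pairs G L" "(V, v) \<in> pairs G L" using l xy by (auto simp: linked_def)
    obtain r where r: "residue_prime p r"
      "mark_preimage U t (residue_ideal r) = mark_preimage V v (residue_ideal r)"
      using l unfolding xy by (rule linked_preimage_eq)
    show ?thesis
      using up[OF mark_kernel_prime[OF pr(1)] residue_ideal_prime_preimage[OF r(1) pr(1)] mono]
        up[OF mark_kernel_prime[OF pr(2)] residue_ideal_prime_preimage[OF r(1) pr(2)] mono] r(2) xy
      by simp
  qed
  have "?k least_pair \<in> A \<longleftrightarrow> ?k y \<in> A" if "(least_pair, y) \<in> linked\<^sup>*" for y
    using that by (induction rule: rtrancl_induct) (use step in blast)+
  then have const: "mark_preimage K s {0} \<in> A \<longleftrightarrow> ?k least_pair \<in> A" if "(K, s) \<in> pairs G L" for K s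
    using linked[OF that] by auto
  have all: "P \<in> A \<longleftrightarrow> ?k least_pair \<in> A" if P: "P \<in> Spec \<Omega>" for P
  proof -
    obtain K s where K: "(K, s) \<in> pairs G L" "mark_preimage K s {0} \<subseteq> P"
      using prime_contains_mark_kernel[OF P] by blast
    show ?thesis using up[OF mark_kernel_prime[OF K(1)] P K(2)] const[OF K(1)] by simp
  qed
  have "A \<subseteq> Spec \<Omega>" "B \<subseteq> Spec \<Omega>" using A B by (auto simp: openin_zariski)
  then show False using all ne AB by blast
qed

section \<open>A connected spectrum has only trivial idempotents\<close>

text \<open>
  The marks of an idempotent are \<open>0\<close> or \<open>1\<close>. If both values occur, then the primes avoiding \<open>e\<close>
  and those avoiding \<open>1 - e\<close> separate the spectrum, and kernels of marks show that neither set
  is empty.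
\<close>

lemma idempotents_if_connected:
  assumes conn: "connected_space (zariski \<Omega>)"
  shows "idempotents \<Omega> = {\<zero>\<^bsub>\<Omega>\<^esub>, \<one>\<^bsub>\<Omega>\<^esub>}"
proof
  show "{\<zero>\<^bsub>\<Omega>\<^esub>, \<one>\<^bsub>\<Omega>\<^esub>} \<subseteq> idempotents \<Omega>"
    by (simp add: idempotents_def del: zero_Omega)
  show "idempotents \<Omega> \<subseteq> {\<zero>\<^bsub>\<Omega>\<^esub>, \<one>\<^bsub>\<Omega>\<^esub>}"
  proof (rule subsetI, rule ccontr)
    fix e assume e: "e \<in> idempotents \<Omega>" and nontriv: "e \<notin> {\<zero>\<^bsub>\<Omega>\<^esub>, \<one>\<^bsub>\<Omega>\<^esub>}"
    then have ec: "e \<in> carrier \<Omega>" and ee: "e \<otimes>\<^bsub>\<Omega>\<^esub> e = e" by (auto simp: idempotents_def)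
    define f where "f = \<one>\<^bsub>\<Omega>\<^esub> \<ominus>\<^bsub>\<Omega>\<^esub> e"
    have fc: "f \<in> carrier \<Omega>" using ec by (simp add: f_def)
    have m01: "mark U t e = 0 \<or> mark U t e = 1" if "(U, t) \<in> pairs G L" for U t
    proof -
      have "mark U t e * mark U t e = mark U t e" using mark_mult[OF that ec ec] ee by simp
      then show ?thesis by simp
    qed
    obtain U t where U: "(U, t) \<in> pairs G L" "mark U t e \<noteq> 0"
      using Omega_eqI[OF ec zero_in_Omega] nontriv by auto
    obtain V v where V: "(V, v) \<in> pairs G L" "mark V v e \<noteq> 1"
      using Omega_eqI[OF ec one_in_Omega] nontriv mark_one by auto
    have mf: "mark W w f = 1 - mark W w e" if "(W, w) \<in> pairs G L" for W w
      using mark_a_minus[OF one_in_Omega ec] mark_one[OF that] by (simp add: f_def)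
    let ?A = "Spec \<Omega> - zariski_closed \<Omega> {e}" and ?B = "Spec \<Omega> - zariski_closed \<Omega> {f}"
    have oA: "openin (zariski \<Omega>) ?A" and oB: "openin (zariski \<Omega>) ?B"
      using ec fc unfolding openin_zariski by blast+
    have ef: "e \<otimes>\<^bsub>\<Omega>\<^esub> f = \<zero>\<^bsub>\<Omega>\<^esub>"
    proof (rule Omega_eqI)
      show "mark W w (e \<otimes>\<^bsub>\<Omega>\<^esub> f) = mark W w \<zero>\<^bsub>\<Omega>\<^esub>" if "(W, w) \<in> pairs G L" for W w
        using m01[OF that] mf[OF that] mark_mult[OF that ec fc] by auto
    qed (use ec fc in \<open>simp_all del: zero_Omega\<close>)
    have e_f: "e \<oplus>\<^bsub>\<Omega>\<^esub> f = \<one>\<^bsub>\<Omega>\<^esub>"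
    proof (rule Omega_eqI)
      show "mark W w (e \<oplus>\<^bsub>\<Omega>\<^esub> f) = mark W w \<one>\<^bsub>\<Omega>\<^esub>" if "(W, w) \<in> pairs G L" for W w
        using mf[OF that] mark_one[OF that] by (simp add: mark_add)
    qed (use ec fc in \<open>simp_all del: add_Omega\<close>)
    have sub: "topspace (zariski \<Omega>) \<subseteq> ?A \<union> ?B"
    proof
      fix P assume "P \<in> topspace (zariski \<Omega>)"
      then have P: "P \<in> Spec \<Omega>" using topspace_zariski[OF Omega_cring] by simp
      then interpret P: primeideal P \<Omega> by (simp add: Spec_def)
      have "\<not> (e \<in> P \<and> f \<in> P)"
        using P.a_closed e_f P.one_imp_carrier P.I_notcarr by metis
      then show "P \<in> ?A \<union> ?B" using P by (auto simp: zariski_closed_def)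
    qed
    have disj: "?A \<inter> ?B = {}"
    proof (rule ccontr)
      assume "?A \<inter> ?B \<noteq> {}"
      then obtain P where P: "P \<in> Spec \<Omega>" "e \<notin> P" "f \<notin> P" by (auto simp: zariski_closed_def)
      then interpret P: primeideal P \<Omega> by (simp add: Spec_def)
      show False using P.I_prime[OF ec fc] ef P P.zero_closed by auto
    qed
    have "mark_preimage U t {0} \<in> ?A"
      using mark_kernel_prime[OF U(1)] U(2) by (auto simp: zariski_closed_def mark_preimage_def)
    moreover have "mark_preimage V v {0} \<in> ?B"
      using mark_kernel_prime[OF V(1)] V(2) mf[OF V(1)] by (auto simp: zariski_closed_def mark_preimage_def)
    ultimately show False
      using conn oA oB sub disj unfolding connected_space_def by blast
  qed
qed

end

section \<open>Burnside's congruences\<close>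

context lattice_burnside_ring
begin

text \<open>
  The classical table of marks: the number of points of \<open>G/K\<close> that are fixed by \<open>U\<close>. It occurs
  here as the marks of the symbols with maximal label, which span a copy of the Burnside ring of
  \<open>G\<close>.
\<close>

definition fixed_points :: "'a set \<Rightarrow> 'a set \<Rightarrow> rat"
  where "fixed_points U K = of_nat (card {g \<in> carrier G. U \<subseteq> conjugate G g K}) / of_nat (card K)"

abbreviation subgroups :: "'a set set"
  where "subgroups \<equiv> {K. subgroup K G}"

lemma finite_subgroups: "finite subgroups"
proof -
  have "subgroups \<subseteq> Pow (carrier G)" using subgroup.subset by blast
  then show ?thesis using finite_carrier finite_subset by blast
qed

lemma pair_mark_Sup_L:
  assumes "(U, t) \<in> pairs G L" "subgroup K G"
  shows "pair_mark U t K (Sup_fin (L K)) = fixed_points U K"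
proof -
  have "above U t K (Sup_fin (L K)) = {g \<in> carrier G. U \<subseteq> conjugate G g K}"
    using le_act_Sup_L[OF assms] by (auto simp: above_def)
  then show ?thesis by (simp add: pair_mark_def fixed_points_def)
qed

lemma Sup_L_pair: "subgroup K G \<Longrightarrow> (K, Sup_fin (L K)) \<in> pairs G L"
  using Sup_L_mem by (simp add: pairs_def)

lemma fixed_points_Ints: 
  assumes "subgroup U G" "subgroup K G" shows "fixed_points U K \<in> \<int>"
  using pair_mark_Ints[OF Sup_L_pair[OF assms(2)], of U "Sup_fin (L U)"]
    pair_mark_Sup_L[OF Sup_L_pair[OF assms(1)] assms(2)] by simp

lemma fixed_points_conjugate:
  assumes "subgroup U G" "subgroup K G" "x \<in> carrier G"
  shows "fixed_points (conjugate G x U) K = fixed_points U K"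
proof -
  have "pair_mark (conjugate G x U) (act x (Sup_fin (L U))) K (Sup_fin (L K)) = pair_mark U (Sup_fin (L U)) K (Sup_fin (L K))"
    using pair_mark_left[OF assms(3)] assms subgroup.subset by blast
  then show ?thesis
    using pair_mark_Sup_L[OF Sup_L_pair[OF assms(1)] assms(2)]
      pair_mark_Sup_L[OF Sup_L_pair[OF conjugate_subgroup[OF assms(1,3)]] assms(2)]
    by (simp add: act_Sup_L[OF assms(1,3)])
qed

lemma fixed_points_nonzeroE:
  assumes "fixed_points U K \<noteq> 0"
  obtains g where "g \<in> carrier G" "U \<subseteq> conjugate G g K"
proof -
  have "card {g \<in> carrier G. U \<subseteq> conjugate G g K} \<noteq> 0" using assms by (auto simp: fixed_points_def)
  then have "{g \<in> carrier G. U \<subseteq> conjugate G g K} \<noteq> {}" by (metis card.empty)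
  then show ?thesis using that by blast
qed

lemma fixed_points_self:
  assumes U: "subgroup U G"
  shows "fixed_points U U = of_nat (card (normalizer G U)) / of_nat (card U)"
proof -
  note Uc = subgroup.subset[OF U]
  have "U \<subseteq> conjugate G g U \<longleftrightarrow> conjugate G g U = U" if g: "g \<in> carrier G" for g
    using card_subset_eq[OF finite_subgroup[OF conjugate_subgroup[OF U g]], of U] card_conjugate[OF g Uc] by auto
  then have "{g \<in> carrier G. U \<subseteq> conjugate G g U} = normalizer G U"
    using mem_normalizer_iff[OF Uc] by blast
  then show ?thesis by (simp add: fixed_points_def)
qed

lemma generate_mult_subset_iff:
  assumes U: "subgroup U G" and g: "g \<in> normalizer G U" and H: "subgroup H G"
  shows "generate G {g} <#> U \<subseteq> H \<longleftrightarrow> U \<subseteq> H \<and> g \<in> H"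
proof
  assume "generate G {g} <#> U \<subseteq> H"
  then show "U \<subseteq> H \<and> g \<in> H" using generate_mult_subgroup(2,3)[OF finite_carrier U g] by blast
next
  assume *: "U \<subseteq> H \<and> g \<in> H"
  then have "generate G {g} \<subseteq> H" using generate_subgroup_incl[OF _ H] by simp
  then show "generate G {g} <#> U \<subseteq> H"
    using * subgroup.m_closed[OF H] unfolding set_mult_def by blast
qed

text \<open>
  The lemma of Cauchy, Frobenius and Burnside for the action of \<open>S\<close> on the points of \<open>G/K\<close> that
  are fixed by \<open>U\<close>: the sum of the numbers of fixed points of the elements of \<open>S\<close> is \<open>card S\<close>
  times the number \<open>n\<close> of orbits.
\<close>

lemma burnside_congruence:
  assumes U: "subgroup U G" and K: "subgroup K G" and S: "subgroup S G" "S \<subseteq> normalizer G U"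
  obtains n where "(\<Sum>g\<in>S. fixed_points (generate G {g} <#> U) K) = of_nat (card S * n)"
proof -
  let ?A = "{h \<in> carrier G. U \<subseteq> conjugate G h K}"
  let ?f = "\<lambda>h. of_bool (h \<in> ?A) :: nat"
  let ?r = "\<lambda>D. SOME h. h \<in> D"
  note Uc = subgroup.subset[OF U] and Kc = subgroup.subset[OF K] and Sc = subgroup.subset[OF S(1)]
  have finS: "finite S" using finite_subgroup[OF S(1)] .
  have finA: "finite ?A" using finite_carrier by simp
  have inv: "?f (x \<otimes> h \<otimes> y) = ?f h" if h: "h \<in> carrier G" "x \<in> S" "y \<in> K" for h x y
  proof -
    have xc: "x \<in> carrier G" and yc: "y \<in> carrier G" using h Sc Kc by auto
    have xU: "conjugate G x U = U" using S(2) h(2) mem_normalizer_iff[OF Uc] by blast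
    have "conjugate G (x \<otimes> h \<otimes> y) K = conjugate G x (conjugate G h K)"
      using xc yc h(1) Kc conjugate_self[OF K h(3)] by (simp add: conjugate_mult)
    then have "U \<subseteq> conjugate G (x \<otimes> h \<otimes> y) K \<longleftrightarrow> U \<subseteq> conjugate G h K"
      using conjugate_mono[OF xc Uc conjugate_carrier[OF h(1) Kc]] xU by simp
    then show ?thesis using xc yc h(1) by simp
  qed
  have rep: "?r D \<in> D" if "D \<in> double_cosets G S K" for D
    using double_coset_nonempty(1)[OF S(1) K that] by (simp add: some_in_eq)
  have "(\<Sum>g\<in>S. card {h \<in> ?A. g \<in> conjugate G h K}) = (\<Sum>h\<in>?A. card {g \<in> S. g \<in> conjugate G h K})"
    using sum.swap_restrict[OF finS finA, of "\<lambda>_ _. 1::nat" "\<lambda>g h. g \<in> conjugate G h K"] by simp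
  also have "\<dots> = (\<Sum>h\<in>?A. card (S \<inter> conjugate G h K))" by (simp add: Int_def)
  also have "\<dots> = (\<Sum>h\<in>carrier G. of_nat (card (S \<inter> conjugate G h K)) * ?f h)"
    by (rule sum.mono_neutral_cong_left[OF finite_carrier]) auto
  also have "\<dots> = of_nat (card S * card K) * (\<Sum>D\<in>double_cosets G S K. ?f (?r D))"
    by (rule sum_double_cosets[OF finite_carrier S(1) K rep inv])
  finally have sum: "(\<Sum>g\<in>S. card {h \<in> ?A. g \<in> conjugate G h K}) =
      card S * card K * (\<Sum>D\<in>double_cosets G S K. ?f (?r D))" by simp
  have "fixed_points (generate G {g} <#> U) K = of_nat (card {h \<in> ?A. g \<in> conjugate G h K}) / of_nat (card K)"
    if g: "g \<in> S" for g
  proof -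
    have gN: "g \<in> normalizer G U" using g S(2) by blast
    have "generate G {g} <#> U \<subseteq> conjugate G h K \<longleftrightarrow> U \<subseteq> conjugate G h K \<and> g \<in> conjugate G h K"
      if "h \<in> carrier G" for h
      using generate_mult_subset_iff[OF U gN conjugate_subgroup[OF K that]] .
    then have "{h \<in> carrier G. generate G {g} <#> U \<subseteq> conjugate G h K} = {h \<in> ?A. g \<in> conjugate G h K}"
      by auto
    then show ?thesis by (simp add: fixed_points_def)
  qed
  then have "(\<Sum>g\<in>S. fixed_points (generate G {g} <#> U) K) =
      (\<Sum>g\<in>S. of_nat (card {h \<in> ?A. g \<in> conjugate G h K}) / of_nat (card K))" by simp
  also have "\<dots> = of_nat (\<Sum>g\<in>S. card {h \<in> ?A. g \<in> conjugate G h K}) / of_nat (card K)"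
    by (simp add: sum_divide_distrib)
  also have "\<dots> = of_nat (card S * (\<Sum>D\<in>double_cosets G S K. ?f (?r D)))"
    unfolding sum using card_subgroup_pos[OF K] by simp
  finally show ?thesis using that by blast
qed

text \<open>
  Necessary conditions on a function of the subgroups to be a combination, with coefficients in
  \<^term>\<open>Z_at p\<close>, of the columns of the table of marks. Over the integers \<open>S\<close> is the full normalizer;
  over the integers localized at \<open>q\<close> a Sylow \<open>q\<close>-subgroup of it is enough, which explains the
  condition on the quotient of the orders.
\<close>

definition burnside_congruent :: "('a set \<Rightarrow> rat) \<Rightarrow> bool"
  where "burnside_congruent x \<longleftrightarrow>
    (\<forall>U. subgroup U G \<longrightarrow> x U \<in> Z_at p \<and> (\<forall>g\<in>carrier G. x (conjugate G g U) = x U) \<and>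
      (\<exists>S. subgroup S G \<and> S \<subseteq> normalizer G U \<and> of_nat (card S) / of_nat (card (normalizer G U)) \<in> Z_at p \<and>
        (\<exists>c\<in>Z_at p. (\<Sum>g\<in>S. x (generate G {g} <#> U)) = of_nat (card S) * c)))"

lemma burnside_congruentD:
  assumes "burnside_congruent x" "subgroup U G"
  shows "x U \<in> Z_at p" "g \<in> carrier G \<Longrightarrow> x (conjugate G g U) = x U"
    "\<exists>S c. subgroup S G \<and> S \<subseteq> normalizer G U \<and> of_nat (card S) / of_nat (card (normalizer G U)) \<in> Z_at p \<and>
        c \<in> Z_at p \<and> (\<Sum>g\<in>S. x (generate G {g} <#> U)) = of_nat (card S) * c"
  using assms unfolding burnside_congruent_def by blast+

lemma burnside_congruent_diff:
  assumes x: "burnside_congruent x" and K: "subgroup K G" and a: "a \<in> Z_at p"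
  shows "burnside_congruent (\<lambda>U. x U - a * fixed_points U K)"
  unfolding burnside_congruent_def
proof (intro allI impI conjI ballI)
  fix U assume U: "subgroup U G"
  have "a * fixed_points U K \<in> Z_at p"
    using Z_at_closed(1) fixed_points_Ints[OF U K] by (intro Z_at_closed(3)[OF a]) blast
  from Z_at_closed(2)[OF burnside_congruentD(1)[OF x U] uminus_Z_at[OF this]]
  show "x U - a * fixed_points U K \<in> Z_at p" by simp
  show "x (conjugate G g U) - a * fixed_points (conjugate G g U) K = x U - a * fixed_points U K"
    if "g \<in> carrier G" for g
    using burnside_congruentD(2)[OF x U that] fixed_points_conjugate[OF U K that] by simp
  obtain S c where S: "subgroup S G" "S \<subseteq> normalizer G U"
    "of_nat (card S) / of_nat (card (normalizer G U)) \<in> Z_at p"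
    and c: "c \<in> Z_at p" "(\<Sum>g\<in>S. x (generate G {g} <#> U)) = of_nat (card S) * c"
    using burnside_congruentD(3)[OF x U] by blast
  obtain n where n: "(\<Sum>g\<in>S. fixed_points (generate G {g} <#> U) K) = of_nat (card S * n)"
    by (rule burnside_congruence[OF U K S(1,2)])
  have "(\<Sum>g\<in>S. x (generate G {g} <#> U) - a * fixed_points (generate G {g} <#> U) K) =
      of_nat (card S) * (c + - (a * of_int (int n)))"
    unfolding sum_subtractf sum_distrib_left[symmetric] n c(2) by (simp add: algebra_simps)
  moreover have "c + - (a * of_int (int n)) \<in> Z_at p"
    by (intro Z_at_closed(2) c uminus_Z_at Z_at_closed(3) a of_int_Z_at)
  ultimately show "\<exists>S. subgroup S G \<and> S \<subseteq> normalizer G U \<and>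
      of_nat (card S) / of_nat (card (normalizer G U)) \<in> Z_at p \<and>
        (\<exists>c\<in>Z_at p. (\<Sum>g\<in>S. x (generate G {g} <#> U) - a * fixed_points (generate G {g} <#> U) K) = of_nat (card S) * c)"
    using S by blast
qed

text \<open>
  In the congruence for \<open>U\<close> only the terms with \<open>g \<in> U\<close> survive, since \<open>\<langle>g\<rangle>U\<close> is strictly larger
  than \<open>U\<close> otherwise. It becomes a divisibility of \<open>x U\<close>, which is just what is needed to clear
  \<open>x U\<close> with the diagonal entry \<open>fixed_points U U\<close>.
\<close>

lemma burnside_congruent_leading_coefficient:
  assumes x: "burnside_congruent x" and U: "subgroup U G"
    and above: "\<And>H. \<lbrakk>subgroup H G; U \<subset> H\<rbrakk> \<Longrightarrow> x H = 0"
  shows "x U * of_nat (card U) / of_nat (card (normalizer G U)) \<in> Z_at p"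
proof -
  obtain S c where S: "subgroup S G" "S \<subseteq> normalizer G U"
    "of_nat (card S) / of_nat (card (normalizer G U)) \<in> Z_at p"
    and c: "c \<in> Z_at p" "(\<Sum>g\<in>S. x (generate G {g} <#> U)) = of_nat (card S) * c"
    using burnside_congruentD(3)[OF x U] by blast
  have SU: "subgroup (S \<inter> U) G" using subgroups_Inter_pair[OF S(1) U] .
  have val: "x (generate G {g} <#> U) = (if g \<in> U then x U else 0)" if g: "g \<in> S" for g
  proof -
    have gN: "g \<in> normalizer G U" using g S(2) by blast
    note P = generate_mult_subgroup[OF finite_carrier U gN]
    show ?thesis
    proof (cases "g \<in> U")
      case True
      then have "generate G {g} <#> U \<subseteq> U" using generate_mult_subset_iff[OF U gN U] by simp
      then have "generate G {g} <#> U = U" using P(2) by blast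
      then show ?thesis using True by simp
    next
      case False
      then have "U \<subset> generate G {g} <#> U" using P(2,3) by blast
      then show ?thesis using above[OF P(1)] False by simp
    qed
  qed
  have "(\<Sum>g\<in>S. x (generate G {g} <#> U)) = (\<Sum>g\<in>S. if g \<in> U then x U else 0)"
    using val by simp
  also have "\<dots> = of_nat (card (S \<inter> U)) * x U"
    using finite_subgroup[OF S(1)] by (simp add: sum.If_cases Int_def)
  finally have eq: "of_nat (card (S \<inter> U)) * x U = of_nat (card S) * c" using c(2) by simp
  obtain m where m: "card U = card (S \<inter> U) * m" using card_subgroup_dvd[OF SU U] by (auto elim: dvdE)
  have "x U * of_nat (card U) = (of_nat (card (S \<inter> U)) * x U) * of_nat m" by (simp add: m)
  also have "\<dots> = of_nat (card S) * c * of_nat m" by (simp only: eq)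
  finally have "x U * of_nat (card U) / of_nat (card (normalizer G U)) =
      of_nat (card S) / of_nat (card (normalizer G U)) * (c * of_int (int m))" by simp
  then show ?thesis using Z_at_closed(3)[OF S(3) Z_at_closed(3)[OF c(1) of_int_Z_at]] by metis
qed

text \<open>
  The necessary conditions are sufficient. The support of \<open>x\<close> is enclosed in a family \<open>\<A>\<close> of
  subgroups that is closed under conjugation and under passing to subgroups. Subtracting a
  multiple of the column of a largest member \<open>U\<close> of \<open>\<A>\<close> removes the conjugates of \<open>U\<close> from \<open>\<A>\<close>,
  because that column is supported on the subgroups of conjugates of \<open>U\<close>.
\<close>

theorem burnside_congruent_imp_combination:
  assumes "burnside_congruent x"
  shows "\<exists>c. (\<forall>K. c K \<in> Z_at p) \<and> (\<forall>U. subgroup U G \<longrightarrow> x U = (\<Sum>K\<in>subgroups. c K * fixed_points U K))"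
proof -
  have "\<exists>c. (\<forall>K. c K \<in> Z_at p) \<and> (\<forall>U. subgroup U G \<longrightarrow> x U = (\<Sum>K\<in>subgroups. c K * fixed_points U K))"
    if "burnside_congruent x" and "\<A> \<subseteq> subgroups"
      and "\<And>H K. \<lbrakk>K \<in> \<A>; subgroup H G; H \<subseteq> K\<rbrakk> \<Longrightarrow> H \<in> \<A>"
      and "\<And>K g. \<lbrakk>K \<in> \<A>; g \<in> carrier G\<rbrakk> \<Longrightarrow> conjugate G g K \<in> \<A>"
      and "\<And>H. \<lbrakk>subgroup H G; x H \<noteq> 0\<rbrakk> \<Longrightarrow> H \<in> \<A>"
    for \<A> x
    using that
  proof (induction "card \<A>" arbitrary: \<A> x rule: less_induct)
    case less
    note x = less.prems(1) and sub = less.prems(2) and down = less.prems(3) and conj = less.prems(4)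
      and supp = less.prems(5)
    have finA: "finite \<A>" using sub finite_subgroups by (rule finite_subset)
    show ?case
    proof (cases "\<A> = {}")
      case True
      then have "x U = 0" if "subgroup U G" for U using supp[OF that] by blast
      then show ?thesis by (intro exI[of _ "\<lambda>_. 0"]) (simp add: zero_Z_at)
    next
      case False
      then have "Max (card ` \<A>) \<in> card ` \<A>" using finA by (intro Max_in) simp_all
      then obtain U where UA: "U \<in> \<A>" and cardU: "card U = Max (card ` \<A>)" by (metis imageE)
      have max: "card H \<le> card U" if "H \<in> \<A>" for H
        unfolding cardU using finA that by (intro Max_ge) simp_all
      have U: "subgroup U G" using sub UA by blast
      note Uc = subgroup.subset[OF U]
      define a where "a = x U * of_nat (card U) / of_nat (card (normalizer G U))"
      have big: "x H = 0" if H: "subgroup H G" "U \<subset> H" for H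
      proof (rule ccontr)
        assume "x H \<noteq> 0"
        then have "card H \<le> card U" using max supp[OF H(1)] by blast
        then show False using psubset_card_mono[OF finite_subgroup[OF H(1)] H(2)] by simp
      qed
      have a: "a \<in> Z_at p"
        unfolding a_def using burnside_congruent_leading_coefficient[OF x U big] .
      let ?y = "\<lambda>H. x H - a * fixed_points H U"
      have y: "burnside_congruent ?y" by (rule burnside_congruent_diff[OF x U a])
      have "card (normalizer G U) > 0" using card_subgroup_pos[OF normalizer_imp_subgroup[OF Uc]] .
      then have yU: "?y U = 0"
        using card_subgroup_pos[OF U] by (simp add: fixed_points_self[OF U] a_def)
      let ?B = "\<A> - {conjugate G g U | g. g \<in> carrier G}"
      have "U \<notin> ?B" using conjugate_one[OF Uc] by auto
      then have "card ?B < card \<A>" using UA finA by (intro psubset_card_mono) auto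
      moreover have "?B \<subseteq> subgroups" using sub by blast
      moreover have "H \<in> ?B" if HK: "K \<in> ?B" "subgroup H G" "H \<subseteq> K" for H K
      proof -
        have "H \<noteq> conjugate G g U" if g: "g \<in> carrier G" for g
        proof
          assume H: "H = conjugate G g U"
          have K: "subgroup K G" "card K \<le> card U" using HK(1) sub max by auto
          then have "H = K"
            using card_seteq[OF finite_subgroup[OF K(1)] HK(3)] card_conjugate[OF g Uc] H by simp
          then show False using HK(1) H g by blast
        qed
        then show ?thesis using down[of K H] HK by blast
      qed
      moreover have "conjugate G g K \<in> ?B" if K: "K \<in> ?B" and g: "g \<in> carrier G" for K g
      proof -
        have Kc: "K \<subseteq> carrier G" using K sub subgroup.subset by blast
        have "conjugate G g K \<noteq> conjugate G h U" if h: "h \<in> carrier G" for h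
        proof
          assume eq: "conjugate G g K = conjugate G h U"
          have "K = conjugate G (inv g) (conjugate G g K)"
            using conjugate_mult[OF inv_closed[OF g] g Kc] g conjugate_one[OF Kc] by simp
          also have "\<dots> = conjugate G (inv g \<otimes> h) U"
            using eq conjugate_mult[OF inv_closed[OF g] h Uc] by simp
          finally show False using K g h by blast
        qed
        then show ?thesis using conj[of K g] K g by blast
      qed
      moreover have "H \<in> ?B" if H: "subgroup H G" "?y H \<noteq> 0" for H
      proof -
        have "H \<in> \<A>"
        proof (cases "x H = 0")
          case True
          then have "fixed_points H U \<noteq> 0" using H(2) by auto
          then obtain g where "g \<in> carrier G" "H \<subseteq> conjugate G g U" by (rule fixed_points_nonzeroE)
          then show ?thesis using down[OF conj[OF UA] H(1)] by blast
        qed (use supp[OF H(1)] in blast)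
        moreover have "H \<noteq> conjugate G g U" if "g \<in> carrier G" for g
          using burnside_congruentD(2)[OF y U that] yU H(2) by auto
        ultimately show ?thesis by blast
      qed
      ultimately have "\<exists>c. (\<forall>K. c K \<in> Z_at p) \<and> (\<forall>H. subgroup H G \<longrightarrow> ?y H = (\<Sum>K\<in>subgroups. c K * fixed_points H K))"
        using less.hyps[of ?B ?y] y by blast
      then obtain c where c: "\<And>K. c K \<in> Z_at p"
        "\<And>H. subgroup H G \<Longrightarrow> ?y H = (\<Sum>K\<in>subgroups. c K * fixed_points H K)" by blast
      let ?c = "\<lambda>K. c K + (if K = U then a else 0)"
      have "?c K \<in> Z_at p" for K using Z_at_closed(2) c(1) a zero_Z_at by simp
      moreover have "x H = (\<Sum>K\<in>subgroups. ?c K * fixed_points H K)" if "subgroup H G" for H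
      proof -
        have "(\<Sum>K\<in>subgroups. ?c K * fixed_points H K) =
            (\<Sum>K\<in>subgroups. c K * fixed_points H K) + (\<Sum>K\<in>subgroups. if K = U then a * fixed_points H K else 0)"
          unfolding sum.distrib[symmetric] by (intro sum.cong refl) (simp add: distrib_right)
        also have "\<dots> = ?y H + a * fixed_points H U"
          using c(2)[OF that] U finite_subgroups by (simp add: sum.delta)
        finally show ?thesis by simp
      qed
      ultimately show ?thesis by (intro exI[of _ ?c]) simp
    qed
  qed
  from this[OF assms order_refl] show ?thesis
    using conjugate_subgroup by blast
qed

section \<open>An idempotent detecting p-subgroups\<close>

lemma p_subgroup_conjugate:
  assumes U: "subgroup U G" and g: "g \<in> carrier G" and pU: "p_subgroup p G U"
  shows "p_subgroup p G (conjugate G g U)"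
proof (cases p)
  case (enat q)
  then show ?thesis
    using pU card_conjugate[OF g subgroup.subset[OF U]] by (simp add: p_subgroup_def)
next
  case infinity
  have "group_hom G G (\<lambda>h. g \<otimes> h \<otimes> inv g)"
  proof (intro group_hom.intro group_hom_axioms.intro is_group homI)
    fix x y assume "x \<in> carrier G" "y \<in> carrier G"
    then show "g \<otimes> (x \<otimes> y) \<otimes> inv g = g \<otimes> x \<otimes> inv g \<otimes> (g \<otimes> y \<otimes> inv g)"
      using g by (simp add: m_assoc inv_cancel)
  qed (use g in simp)
  from group_hom.solvable_imp_solvable_img[OF this, of U] show ?thesis
    using pU infinity mem_conjugate[OF g subgroup.subset[OF U]] by (simp add: p_subgroup_def)
qed

text \<open>
  For \<open>g \<in> S\<close>, the subgroup \<open>\<langle>g\<rangle>U\<close> is a \<open>p\<close>-group if and only if \<open>U\<close> is: the quotient by \<open>U\<close> is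
  cyclic, and if \<open>p\<close> is a prime \<open>q\<close> then \<open>g\<close> has \<open>q\<close>-power order. So all the terms of the sum
  agree.
\<close>

lemma p_subgroup_burnside_congruent: "burnside_congruent (\<lambda>U. of_bool (p_subgroup p G U))"
  unfolding burnside_congruent_def
proof (intro allI impI conjI ballI)
  fix U assume U: "subgroup U G"
  note Uc = subgroup.subset[OF U]
  let ?N = "normalizer G U"
  have N: "subgroup ?N G" by (rule normalizer_imp_subgroup[OF Uc])
  show "of_bool (p_subgroup p G U) \<in> Z_at p" using zero_Z_at one_Z_at by simp
  show "of_bool (p_subgroup p G (conjugate G g U)) = (of_bool (p_subgroup p G U) :: rat)"
    if g: "g \<in> carrier G" for g
  proof -
    have "conjugate G (inv g) (conjugate G g U) = U"
      using conjugate_mult[OF inv_closed[OF g] g Uc] g conjugate_one[OF Uc] by simp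
    then have "p_subgroup p G (conjugate G g U) \<longleftrightarrow> p_subgroup p G U"
      using p_subgroup_conjugate[OF U g]
        p_subgroup_conjugate[OF conjugate_subgroup[OF U g] inv_closed[OF g]] by metis
    then show ?thesis by simp
  qed
  have down: "p_subgroup p G U" if "g \<in> ?N" "p_subgroup p G (generate G {g} <#> U)" for g
    using p_subgroup_mono[OF prime_or_infinity U] generate_mult_subgroup(1,2)[OF finite_carrier U that(1)] that(2)
    by blast
  have "\<exists>S. subgroup S G \<and> S \<subseteq> ?N \<and> of_nat (card S) / of_nat (card ?N) \<in> Z_at p \<and>
     (\<forall>g\<in>S. p_subgroup p G U \<longrightarrow> p_subgroup p G (generate G {g} <#> U))"
  proof (cases p)
    case (enat q)
    then have q: "prime q" using prime_or_infinity by (auto simp: prime_or_infinity_def)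
    have "card ?N \<noteq> 0" using card_subgroup_pos[OF N] by simp
    then obtain m where m: "card ?N = q ^ multiplicity q (card ?N) * m" "\<not> q dvd m"
      using q multiplicity_decompose'[of "card ?N" q] by (metis not_prime_unit)
    let ?a = "multiplicity q (card ?N)"
    have "\<exists>S. subgroup S (G\<lparr>carrier := ?N\<rparr>) \<and> card S = q ^ ?a"
    proof (rule sylow_thm[OF q])
      show "group (G\<lparr>carrier := ?N\<rparr>)" using subgroup_imp_group[OF N] .
      show "order (G\<lparr>carrier := ?N\<rparr>) = q ^ ?a * m" using m(1) by (simp add: order_def)
      show "finite (carrier (G\<lparr>carrier := ?N\<rparr>))" using finite_subgroup[OF N] by simp
    qed
    then obtain S where S': "subgroup S (G\<lparr>carrier := ?N\<rparr>)" and cardS: "card S = q ^ ?a" by blast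
    have S: "subgroup S G" using incl_subgroup[OF N S'] .
    have SN: "S \<subseteq> ?N" using subgroup.subset[OF S'] by simp
    have "of_nat (card S) / of_nat (card ?N) = (of_nat (q ^ ?a) / (of_nat (q ^ ?a) * of_nat m) :: rat)"
      by (subst m(1)) (simp only: cardS of_nat_mult)
    also have "\<dots> = of_int 1 / of_int (int m)" using q by (simp add: prime_gt_0_nat)
    finally have "of_nat (card S) / of_nat (card ?N) \<in> Z_at p"
      unfolding Z_at_iff using m(2) enat by (intro exI[of _ 1] exI[of _ "int m"]) simp
    moreover have "p_subgroup p G (generate G {g} <#> U)" if g: "g \<in> S" and pU: "p_subgroup p G U" for g
    proof -
      have gN: "g \<in> ?N" using g SN by blast
      have gc: "g \<in> carrier G" using g subgroup.mem_carrier[OF S] by blast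
      obtain k where k: "card (generate G {g} <#> U) = card U * k" "k dvd ord g"
        using generate_mult_subgroup(5)[OF finite_carrier U gN] by blast
      have "generate G {g} \<subseteq> S" using generate_subgroup_incl[OF _ S] g by simp
      then have "ord g dvd q ^ ?a"
        using card_subgroup_dvd[OF generate_is_subgroup S, of "{g}"] generate_pow_card[OF gc] cardS gc by simp
      then have "k dvd q ^ ?a" using k(2) dvd_trans by blast
      then obtain i where "k = q ^ i" using q by (auto simp: divides_primepow_nat)
      moreover obtain j where "card U = q ^ j" using pU enat by (auto simp: p_subgroup_def)
      ultimately have "card (generate G {g} <#> U) = q ^ (j + i)" using k(1) by (simp add: power_add)
      then show ?thesis using enat by (auto simp: p_subgroup_def)
    qed
    ultimately show ?thesis using S SN by blast
  next
    case infinity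
    have "of_nat (card ?N) / of_nat (card ?N) \<in> Z_at p" using card_subgroup_pos[OF N] one_Z_at by simp
    moreover have "p_subgroup p G (generate G {g} <#> U)" if "g \<in> ?N" "p_subgroup p G U" for g
      using generate_mult_subgroup(6)[OF finite_carrier U that(1)] that(2) infinity by (simp add: p_subgroup_def)
    ultimately show ?thesis using N by blast
  qed
  then obtain S where S: "subgroup S G" "S \<subseteq> ?N" "of_nat (card S) / of_nat (card ?N) \<in> Z_at p"
    and up: "\<And>g. g \<in> S \<Longrightarrow> p_subgroup p G U \<Longrightarrow> p_subgroup p G (generate G {g} <#> U)" by blast
  have "(\<Sum>g\<in>S. of_bool (p_subgroup p G (generate G {g} <#> U))) = (\<Sum>g\<in>S. of_bool (p_subgroup p G U) :: rat)"
  proof (rule sum.cong[OF refl])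
    fix g assume g: "g \<in> S"
    then have "p_subgroup p G (generate G {g} <#> U) \<longleftrightarrow> p_subgroup p G U" using up down S(2) by blast
    then show "of_bool (p_subgroup p G (generate G {g} <#> U)) = (of_bool (p_subgroup p G U) :: rat)" by simp
  qed
  then have "(\<Sum>g\<in>S. of_bool (p_subgroup p G (generate G {g} <#> U))) = of_nat (card S) * (of_bool (p_subgroup p G U) :: rat)"
    by simp
  moreover have "(of_bool (p_subgroup p G U) :: rat) \<in> Z_at p" using zero_Z_at one_Z_at by simp
  ultimately show "\<exists>S. subgroup S G \<and> S \<subseteq> ?N \<and> of_nat (card S) / of_nat (card ?N) \<in> Z_at p \<and>
      (\<exists>c\<in>Z_at p. (\<Sum>g\<in>S. of_bool (p_subgroup p G (generate G {g} <#> U))) = of_nat (card S) * c)"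
    using S by blast
qed

text \<open>
  The combination with marks \<open>1\<close> at \<open>p\<close>-subgroups and \<open>0\<close> elsewhere is formed with the symbols
  of maximal label.
\<close>

lemma exists_p_idempotent:
  obtains e where "e \<in> idempotents \<Omega>"
    "\<And>U t. (U, t) \<in> pairs G L \<Longrightarrow> mark U t e = of_bool (p_subgroup p G U)"
proof -
  obtain c where c: "\<And>K. c K \<in> Z_at p"
    "\<And>U. subgroup U G \<Longrightarrow> of_bool (p_subgroup p G U) = (\<Sum>K\<in>subgroups. c K * fixed_points U K)"
    using burnside_congruent_imp_combination[OF p_subgroup_burnside_congruent] by blast
  let ?e = "\<Sum>K\<in>subgroups. rscale (c K) (symbol G act K (Sup_fin (L K)))"
  have e: "?e \<in> carrier \<Omega>"
    using c(1) Sup_L_pair by (intro sum_in_Omega rscale_in_Omega symbol_in_Omega) auto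
  have mark_e: "mark U t ?e = of_bool (p_subgroup p G U)" if U: "(U, t) \<in> pairs G L" for U t
  proof -
    have "mark U t ?e = (\<Sum>K\<in>subgroups. c K * fixed_points U K)"
      unfolding mark_sum mark_rscale
    proof (rule sum.cong[OF refl])
      fix K assume "K \<in> subgroups"
      then have K: "subgroup K G" by simp
      show "c K * mark U t (symbol G act K (Sup_fin (L K))) = c K * fixed_points U K"
        using mark_symbol[OF subgroup.subset[OF K]] pair_mark_Sup_L[OF U K] by simp
    qed
    then show ?thesis using c(2)[OF pairsD(1)[OF U]] by simp
  qed
  have "?e \<otimes>\<^bsub>\<Omega>\<^esub> ?e = ?e"
  proof (rule Omega_eqI[OF mult_in_Omega[OF e e] e])
    fix U t assume U: "(U, t) \<in> pairs G L"
    show "mark U t (?e \<otimes>\<^bsub>\<Omega>\<^esub> ?e) = mark U t ?e"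
      unfolding mark_mult[OF U e e] mark_e[OF U] by simp
  qed
  then have "?e \<in> idempotents \<Omega>" using e by (simp add: idempotents_def)
  then show ?thesis using that mark_e by blast
qed

lemma p_group_if_trivial_idempotents:
  assumes "idempotents \<Omega> = {\<zero>\<^bsub>\<Omega>\<^esub>, \<one>\<^bsub>\<Omega>\<^esub>}"
  shows "p_group p G"
proof -
  obtain e where e: "e \<in> idempotents \<Omega>"
    and mark_e: "\<And>U t. (U, t) \<in> pairs G L \<Longrightarrow> mark U t e = of_bool (p_subgroup p G U)"
    using exists_p_idempotent by blast
  have "mark {\<one>} (Inf_fin (L {\<one>})) e = 1"
    using mark_e[of "{\<one>}" "Inf_fin (L {\<one>})"] least_pair_in_pairs p_subgroup_trivial by (simp add: least_pair_def)
  then have "e \<noteq> \<zero>\<^bsub>\<Omega>\<^esub>" by auto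
  then have "e = \<one>\<^bsub>\<Omega>\<^esub>" using e assms by blast
  then have "of_bool (p_subgroup p G (carrier G)) = (1 :: rat)"
    using mark_e[OF top_pair] mark_one[OF top_pair] by simp
  then show ?thesis by (simp add: p_group_iff_p_subgroup)
qed

end

section \<open>The connectedness criterion\<close>

text \<open>
  The elements of \<open>W\<^sub>G(K,s)\<^sub>p\<close> are cosets inside the stabilizer of the pair \<open>(K, s)\<close>, to which
  \<open>K\<close> itself belongs because it fixes \<open>s\<close>.
\<close>

lemma p_part_W_pair_subset:
  assumes "admissible_family G act L" and K: "(K, s) \<in> pairs G L"
    and P: "p_part p (W_pair G act K s) P" and g: "g \<in> carrier G" "g <#\<^bsub>G\<^esub> K \<in> P"
  shows "g \<in> N_pair G act K s"
proof -
  interpret admissible_family G act L by fact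
  have sg: "subgroup K G" "s \<in> L K" using K by (auto simp: pairs_def)
  interpret K: subgroup K G by fact
  have "P \<subseteq> carrier (W_pair G act K s)"
    using P by (auto simp: p_part_def sylow_subgroup_def split: enat.splits dest: subgroup.subset)
  then obtain x where x: "x \<in> N_pair G act K s" "g <#\<^bsub>G\<^esub> K = K #>\<^bsub>G\<^esub> x"
    using g(2) by (auto simp: W_pair_def carrier_FactGroup)
  have "g \<in> g <#\<^bsub>G\<^esub> K" using K.one_closed g(1) by (force simp: l_coset_def)
  then obtain k where k: "k \<in> K" "g = k \<otimes>\<^bsub>G\<^esub> x" using x(2) by (auto simp: r_coset_def)
  have "x \<in> carrier G" "conjugate G x K = K" "act x s = s"
    using x(1) by (auto simp: N_pair_def stabilizer_def pair_action_def)
  then show ?thesis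
    using k g(1) K.mem_carrier[OF k(1)] conjugate_self[OF sg(1) k(1)] L_fixed[OF sg(1) k(1) sg(2)] K.subset
    by (simp add: N_pair_def stabilizer_def pair_action_def conjugate_mult act_mult)
qed

theorem theorem6p4:
  fixes p :: enat
    and G :: "('a, 'm) monoid_scheme"
    and act :: "'a \<Rightarrow> 'l::{finite, lattice} \<Rightarrow> 'l"
    and L :: "'a set \<Rightarrow> 'l set"
    and Wp :: "'a set \<Rightarrow> 'l \<Rightarrow> 'a set set"
  assumes "prime_or_infinity p"
    and "group G" and "finite (carrier G)"
    and "admissible_family G act L"
    and "\<And>K s. (K, s) \<in> pairs G L \<Longrightarrow> p_part p (W_pair G act K s) (Wp K s)"
    and "\<And>s. \<exists>K. subgroup K G \<and> s \<in> L K \<Longrightarrow>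
      \<exists>H U. subgroup H G \<and> subgroup U G \<and> U \<subseteq> H \<and> H \<subseteq> normalizer G U \<and>
        {K. subgroup K G \<and> K \<subseteq> H \<and> U \<subseteq> K} = {K. subgroup K G \<and> s \<in> L K} \<and>
        (\<forall>t. covers_in (L U) s t \<longrightarrow>
          (\<exists>g \<in> carrier G. g <#\<^bsub>G\<^esub> U \<in> Wp U t \<and> g \<notin> U \<and>
            s = Inf_fin {s' \<in> L (generate G {g} <#>\<^bsub>G\<^esub> U). t \<le> s'}))"
  shows "(p_group p G \<longleftrightarrow> connected_space (zariski (Omega_at p G act L))) \<and>
         (p_group p G \<longleftrightarrow>
            idempotents (Omega_at p G act L) =
              {\<zero>\<^bsub>Omega_at p G act L\<^esub>, \<one>\<^bsub>Omega_at p G act L\<^esub>})"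
proof -
  interpret lattice_burnside_ring G act L p
    using assms(1,3,4)
    by (intro lattice_burnside_ring.intro finite_admissible_family.intro
        finite_admissible_family_axioms.intro lattice_burnside_ring_axioms.intro)
  have "connected_space (zariski (Omega_at p G act L))" if "p_group p G"
  proof (rule connected_if_linked, rule linked_to_least_pair[OF that])
    fix K s assume "(K, s) \<in> pairs G L"
    then have "\<exists>K. subgroup K G \<and> s \<in> L K" by (auto simp: pairs_def)
    from assms(6)[OF this] obtain H U
      where HU: "subgroup H G" "subgroup U G" "U \<subseteq> H" "H \<subseteq> normalizer G U"
        and interval: "{K. subgroup K G \<and> K \<subseteq> H \<and> U \<subseteq> K} = {K. subgroup K G \<and> s \<in> L K}"
        and cover: "\<forall>t. covers_in (L U) s t \<longrightarrow>
          (\<exists>g \<in> carrier G. g <#\<^bsub>G\<^esub> U \<in> Wp U t \<and> g \<notin> U \<and>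
            s = Inf_fin {s' \<in> L (generate G {g} <#>\<^bsub>G\<^esub> U). t \<le> s'})"
      by (elim exE conjE)
    have "\<exists>g \<in> N_pair G act U t. s = Inf_fin {s' \<in> L (generate G {g} <#>\<^bsub>G\<^esub> U). t \<le> s'}"
      if t: "covers_in (L U) s t" for t
    proof -
      obtain g where g: "g \<in> carrier G" "g <#\<^bsub>G\<^esub> U \<in> Wp U t"
        "s = Inf_fin {s' \<in> L (generate G {g} <#>\<^bsub>G\<^esub> U). t \<le> s'}"
        using cover t by blast
      have tU: "(U, t) \<in> pairs G L" using t HU(2) by (simp add: covers_in_def pairs_def)
      show ?thesis using p_part_W_pair_subset[OF assms(4) tU assms(5)[OF tU] g(1,2)] g(3) by blast
    qed
    then show "\<exists>H U. subgroup H G \<and> subgroup U G \<and> U \<subseteq> H \<and> H \<subseteq> normalizer G U \<and>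
        {K. subgroup K G \<and> K \<subseteq> H \<and> U \<subseteq> K} = {K. subgroup K G \<and> s \<in> L K} \<and>
        (\<forall>t. covers_in (L U) s t \<longrightarrow>
          (\<exists>g \<in> N_pair G act U t. s = Inf_fin {s' \<in> L (generate G {g} <#>\<^bsub>G\<^esub> U). t \<le> s'}))"
      using HU interval by (intro exI[of _ H] exI[of _ U]) simp
  qed
  then show ?thesis
    using idempotents_if_connected p_group_if_trivial_idempotents by blast
qed

end
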